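(* The following hold. (1) As $n\to\infty$, $M_{\mathcal P(n)}(n)\sim \dfrac{n^3}{6\log n}$. (2) If $n\to\infty$ and $k=k(n)$ is a positive integer with $k\to\infty$ and $k=o(n)$, then $$M_k(n)\ge\left(\frac9{16}-o(1)\right)\frac{nk^2}{\log k}.$$ (3) If $n\to\infty$ and $k=k(n)$ is a positive integer with $k/n\to\lambda\in(0,1)$, and $a=\min\{\lambda/2,1/3\}$, then $$M_k(n)\ge\left(\frac{\lambda^2}{2}-\frac{\lambda^3}{3}+\frac{a^2}{4}-\frac{a^3}{2}-o(1)\right)\frac{n^3}{\log n}.$$
   Context: For $N\in\mathbb N=\{1,2,\dots\}$ write $[N]=\{1,\dots,N\}$. A finite family $(C_d)_{d\in D}$ of finite subsets of $\mathbb Z$ is packed into $[N]$ if there are integers $\sigma_d$ ($d\in D$) such that $\sigma_d+C_d\subseteq[N]$ for every $d\in D$ and the sets $\sigma_d+C_d$ are pairwise disjoint. For $n,d\in\mathbb N$ put $B_d=\{jd:1\le j\le n\}$ (depending on $n$). For finite $D\subseteq\mathbb N$, $M_D(n)$ is the least $N$ for which $(B_d)_{d\in D}$ can be packed into $[N]$. Write $M_k(n)=M_{[k]}(n)$. Also $\mathcal P(x)=\{p\le x: p\text{ prime}\}$. Logarithms are natural, and $f\sim g$ means $f/g\to1$. *)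

theory Defs
  imports
    Complex_Main
    "HOL-Library.Disjoint_Sets"
    "HOL-Library.Landau_Symbols"
    "HOL-Computational_Algebra.Primes"
begin

definition translate :: "int \<Rightarrow> int set \<Rightarrow> int set" where
  "translate s C = (\<lambda>x. s + x) ` C"

definition can_be_packed :: "'d set \<Rightarrow> ('d \<Rightarrow> int set) \<Rightarrow> nat \<Rightarrow> bool" where
  "can_be_packed D C N \<longleftrightarrow>
     (\<exists>\<sigma> :: 'd \<Rightarrow> int.
        (\<forall>d\<in>D. translate (\<sigma> d) (C d) \<subseteq> {1..int N}) \<and>
        disjoint_family_on (\<lambda>d. translate (\<sigma> d) (C d)) D)"

definition progression :: "nat \<Rightarrow> nat \<Rightarrow> int set" where
  "progression n d = (\<lambda>j. int (j * d)) ` {1..n}"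

text \<open>
  Intended for finite \<open>D\<close> with all elements positive; a packing then exists for all large
  \<open>N\<close>, so the \<open>LEAST\<close> is attained. The positive integers start at 1, so the value is 1
  (not 0) for \<open>D = {}\<close>.
\<close>

definition min_packing :: "nat set \<Rightarrow> nat \<Rightarrow> nat" where
  "min_packing D n = (LEAST N. 1 \<le> N \<and> can_be_packed D (progression n) N)"

definition primes_upto :: "real \<Rightarrow> nat set" where
  "primes_upto x = {p. prime p \<and> real p \<le> x}"

end

theory Submission
  imports
    "HOL-Complex_Analysis.Complex_Analysis"
    "HOL-Real_Asymp.Real_Asymp"
    "HOL-Number_Theory.Prime_Powers"
    "HOL-Number_Theory.Cong"
    Defs
begin

text \<open>
  Write AP(d) for a translate of {d, 2d, ..., nd}. Two facts about a pair of progressions govern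
  everything. If AP(d) and AP(e) lie in the same class modulo gcd(d, e), the Chinese remainder
  theorem puts a common point into every window of lcm(d, e) consecutive integers inside both spans,
  so disjoint progressions overlap in fewer than lcm(d, e) integers. Conversely, for coprime p and q
  the Frobenius coin problem allows an overlap of nearly pq: the number pq - p - q - t is
  a combination ap + bq with a, b \<ge> 0 only if t is not.

  Lower bounds (\<open>min_packing_lower_bound\<close>). Cut d^2/2 off both ends of the span of AP(d). Since
  de \<le> (d^2 + e^2)/2, the remaining cores of different primes are disjoint, and the core of AP(p) has
  about np - p^2 points. For odd p \<le> n/3 the core of AP(2p) is disjoint from the cores of all odd primes
  other than p, and from the core of AP(2q) when the two have the same parity. So for all p in the parity
  class with the larger total weight, the core of p may be exchanged for the core of 2p, which gains
  np - 3p^2 for each such p. The gain is at least half of the sum of np - 3p^2 over p \<le> min(k/2, n/3), and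
  produces the terms in a and the step from 1/2 to 9/16.

  Upper bound for primes (\<open>primes_upper\<close>). Cut the primes up to n into boundedly many short intervals
  (u, u + w]. In one interval, start the j-th progression close to jS, where S is slightly more than
  (u + w)(n - u), about p(n - p). Only boundedly many earlier progressions reach the new one, and for
  each of them the Frobenius criterion asks that the new starting point, taken modulo the new prime q,
  lies in a dilate of a short interval, the dilation factors being the earlier primes p
  (\<open>chain_extend\<close>). Such a system of conditions has a solution unless the inverses of these p satisfy
  a small linear relation modulo q (\<open>kronecker_mod\<close>, a discrete Kronecker theorem). Clearing
  denominators, a relation means that q divides a nonzero integer of size n^O(1), which excludes only
  O(log n) primes q (\<open>exists_independent_prime\<close>). Hence q can be chosen greedily until O(log n) primes
  are left, and these are packed one after the other at a total cost of O(n^2 log n).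

  Both bounds become sums of p and p^2 over primes, which the prime number theorem evaluates. It is
  proved along Newman's lines. The error of the Chebyshev function psi enters a Dirichlet series with
  bounded coefficients (psi(m) - m)/m which extends holomorphically to a neighbourhood of the half-plane
  Re s \<ge> 1, because zeta has no zero there; Newman's Tauberian theorem yields convergence at s = 1, and
  this forces psi(m) to be asymptotic to m as psi is monotone.
\<close>

section \<open>Newman's Tauberian theorem\<close>

text \<open>
  By the mean value theorem the right-hand side is z^(u-1) for some z below m + 1. With u > 0 it bounds
  partial sums of n^(u-1), with u < 0 tails of such a series.
\<close>
lemma Suc_powr_le_diff:
  fixes u :: real and m :: nat
  assumes "u \<noteq> 0" "u \<le> 1" "m \<ge> 1"
  shows "real (Suc m) powr (u - 1) \<le> (real (Suc m) powr u - real m powr u) / u"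
proof -
  have "\<exists>z. real m < z \<and> z < real (Suc m) \<and>
      (real (Suc m) powr u / u - real m powr u / u) = (real (Suc m) - real m) * (z powr (u - 1))"
    by (rule MVT2) (use assms in \<open>auto intro!: derivative_eq_intros simp: powr_diff\<close>)
  then obtain z where z: "real m < z" "z < real (Suc m)"
    "real (Suc m) powr u / u - real m powr u / u = z powr (u - 1)" by auto
  have "real (Suc m) powr (u - 1) \<le> z powr (u - 1)"
    using z assms by (intro powr_mono2') auto
  thus ?thesis using z by (simp add: diff_divide_distrib)
qed

lemma Suc_powr_le_diff':
  fixes u :: real and m :: nat
  assumes "u \<ge> 1"
  shows "real (Suc m) powr (u - 1) \<le> (real (Suc (Suc m)) powr u - real (Suc m) powr u) / u"
proof -
  have "\<exists>z. real (Suc m) < z \<and> z < real (Suc (Suc m)) \<and>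
      (real (Suc (Suc m)) powr u / u - real (Suc m) powr u / u)
         = (real (Suc (Suc m)) - real (Suc m)) * (z powr (u - 1))"
    by (rule MVT2) (use assms in \<open>auto intro!: derivative_eq_intros simp: powr_diff\<close>)
  then obtain z where z: "real (Suc m) < z" "z < real (Suc (Suc m))"
    "real (Suc (Suc m)) powr u / u - real (Suc m) powr u / u = z powr (u - 1)" by auto
  have "real (Suc m) powr (u - 1) \<le> z powr (u - 1)"
    using z assms by (intro powr_mono2) auto
  thus ?thesis using z by (simp add: diff_divide_distrib)
qed

text \<open>
  For u \<le> 1 the summand decreases and the integral from 0 to N suffices; for u > 1 it increases, the
  integral from 1 to N bounds all but the last term, and this one contributes the summand 1/N.
\<close>
lemma sum_Suc_powr_le:
  fixes u :: real and N :: nat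
  assumes "u > 0" "N \<ge> 1"
  shows "(\<Sum>n<N. real (Suc n) powr (u - 1)) \<le> real N powr u * (1 / N + 1 / u)"
proof (cases "u \<le> 1")
  case True
  have "(\<Sum>n<M. real (Suc n) powr (u - 1)) \<le> real M powr u / u" for M
  proof (induction M)
    case (Suc M)
    show ?case
    proof (cases "M = 0")
      case True
      thus ?thesis using assms \<open>u \<le> 1\<close> by simp
    next
      case False
      have "real (Suc M) powr (u - 1) \<le> (real (Suc M) powr u - real M powr u) / u"
        using False assms \<open>u \<le> 1\<close> by (intro Suc_powr_le_diff) auto
      with Suc show ?thesis by (simp add: diff_divide_distrib)
    qed
  qed auto
  from this[of N] show ?thesis
    by (rule order.trans) (use assms in \<open>auto simp: field_simps\<close>)
next
  case False
  have "(\<Sum>n<M. real (Suc n) powr (u - 1)) \<le> real (Suc M) powr u / u" for M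
  proof (induction M)
    case 0
    show ?case using assms by simp
  next
    case (Suc M)
    have "real (Suc M) powr (u - 1) \<le> (real (Suc (Suc M)) powr u - real (Suc M) powr u) / u"
      using False by (intro Suc_powr_le_diff') auto
    with Suc show ?case by (simp add: diff_divide_distrib)
  qed
  from this[of "N - 1"] have "(\<Sum>n<N-1. real (Suc n) powr (u - 1)) \<le> real N powr u / u"
    using assms by simp
  moreover have "{..<N} = insert (N - 1) {..<N-1}" using assms by auto
  ultimately have "(\<Sum>n<N. real (Suc n) powr (u - 1)) \<le> real N powr u / u + real N powr (u - 1)"
    using assms by simp
  also have "real N powr (u - 1) = real N powr u / N"
    using assms by (simp add: powr_diff)
  finally show ?thesis by (simp add: field_simps)
qed

lemma powr_tail_bounds:
  fixes x :: real and N :: nat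
  assumes "x > 0" "N \<ge> 1"
  shows "summable (\<lambda>n. real (Suc (n + N)) powr (- 1 - x))"
    and "(\<Sum>n. real (Suc (n + N)) powr (- 1 - x)) \<le> real N powr (- x) / x"
proof -
  have le: "(\<Sum>n<M. real (Suc (n + N)) powr (- 1 - x)) \<le> real N powr (- x) / x" for M
  proof -
    have "(\<Sum>n<M. real (Suc (n + N)) powr (- 1 - x))
       \<le> (real N powr (- x) - real (M + N) powr (- x)) / x"
    proof (induction M)
      case (Suc M)
      have "real (Suc (M + N)) powr (- x - 1) \<le>
         (real (Suc (M + N)) powr (- x) - real (M + N) powr (- x)) / (- x)"
        using assms by (intro Suc_powr_le_diff) auto
      also have "- x - 1 = - 1 - x" by simp
      finally show ?case using Suc by (simp add: diff_divide_distrib)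
    qed auto
    also have "\<dots> \<le> real N powr (- x) / x"
      using assms by (intro divide_right_mono) auto
    finally show ?thesis .
  qed
  show s: "summable (\<lambda>n. real (Suc (n + N)) powr (- 1 - x))"
    by (rule summableI_nonneg_bounded[OF _ le]) auto
  show "(\<Sum>n. real (Suc (n + N)) powr (- 1 - x)) \<le> real N powr (- x) / x"
    by (rule suminf_le_const[OF s le])
qed

text \<open>
  The index is shifted so that sequences on the naturals, starting at 0, are the coefficient sequences of
  Dirichlet series: the term of index n belongs to the integer n + 1.
\<close>
abbreviation npow :: "nat \<Rightarrow> complex \<Rightarrow> complex" where
  "npow n s \<equiv> of_nat (Suc n) powr (- s)"

lemma norm_nat_powr: "norm (of_nat (Suc n) powr (s :: complex)) = real (Suc n) powr Re s"
  by (subst norm_powr_real_powr) auto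

lemma arc_integral_inverse:
  assumes "R > 0" "a < b"
  shows "((\<lambda>z. 1 / z) has_contour_integral (\<i> * of_real (b - a))) (part_circlepath 0 R a b)"
proof -
  have *: "1 / (of_real R * exp (\<i> * of_real t)) * of_real R * \<i> * exp (\<i> * of_real t) = \<i>" for t
    using assms by (simp add: field_simps)
  show ?thesis
    unfolding has_contour_integral_part_circlepath_iff[OF assms(2)]
    using has_integral_const_real[of \<i> a b] assms *
    by (simp add: cis_conv_exp mult_ac scaleR_conv_of_real)
qed

lemma Re_part_circlepath_right:
  assumes "z \<in> path_image (part_circlepath 0 R (-pi/2) (pi/2))" "R > 0"
  shows "norm z = R" "Re z \<ge> 0"
proof -
  obtain t where t: "t \<in> {-pi/2..pi/2}" "z = of_real R * exp (\<i> * of_real t)"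
    using assms by (auto simp: path_image_part_circlepath)
  show "norm z = R" using t assms by (simp add: norm_mult)
  have "cos t \<ge> 0" using t by (intro cos_ge_zero) auto
  thus "Re z \<ge> 0" using t assms by (auto simp: Re_exp)
qed

lemma Re_part_circlepath_left:
  assumes "z \<in> path_image (part_circlepath 0 R (pi/2) (3*pi/2))" "R > 0"
  shows "norm z = R" "Re z \<le> 0"
proof -
  obtain t where t: "t \<in> {pi/2..3*pi/2}" "z = of_real R * exp (\<i> * of_real t)"
    using assms by (auto simp: path_image_part_circlepath)
  show "norm z = R" using t assms by (simp add: norm_mult)
  have "cos (t - pi) \<ge> 0" using t by (intro cos_ge_zero) auto
  hence "cos t \<le> 0" by (simp add: cos_diff)
  thus "Re z \<le> 0" using t assms by (auto simp: Re_exp intro!: mult_nonneg_nonpos)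
qed

text \<open>
  This is the point of Newman's kernel: on the circle, 1/z is the conjugate of z divided by R^2, so the
  kernel is real there and vanishes at the two points where the estimates of the series break down.
\<close>
lemma newman_kernel_norm:
  fixes z :: complex
  assumes "norm z = R" "R > 0"
  shows "norm (1 / z + z / of_real R ^ 2) = 2 * \<bar>Re z\<bar> / R ^ 2"
proof -
  have z: "z \<noteq> 0" using assms by auto
  have "of_real R ^ 2 = z * cnj z" using assms complex_norm_square[of z] by simp
  hence "1 / z = cnj z / of_real R ^ 2" using z by (simp add: field_simps)
  hence "1 / z + z / of_real R ^ 2 = of_real (2 * Re z) / of_real R ^ 2"
    by (metis add.commute add_divide_distrib complex_add_cnj)
  also have "norm \<dots> = 2 * \<bar>Re z\<bar> / R ^ 2"
    using assms by (simp add: norm_divide norm_power norm_mult)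
  finally show ?thesis .
qed

lemma on_imaginary_axis: "norm z = R \<Longrightarrow> Re z = 0 \<Longrightarrow> z \<in> {\<i> * of_real R, - \<i> * of_real R}"
  by (cases z) (auto simp: complex_eq_iff cmod_def abs_if)

text \<open>
  Cauchy's formula at the centre, with the circle cut into its right and left half because the two
  halves are estimated by different means. Subtracting E(0)/z leaves an entire function, and 1/z
  contributes \<open>\<i> * pi\<close> on each half.
\<close>
lemma circle_kernel_integral:
  fixes E :: "complex \<Rightarrow> complex"
  assumes hol: "E holomorphic_on UNIV" and R: "R > 0"
  shows "contour_integral (part_circlepath 0 R (-pi/2) (pi/2)) (\<lambda>z. E z / z) +
         contour_integral (part_circlepath 0 R (pi/2) (3*pi/2)) (\<lambda>z. E z / z) = 2 * pi * \<i> * E 0"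
proof -
  let ?p = "part_circlepath 0 R (-pi/2) (pi/2)" and ?m = "part_circlepath 0 R (pi/2) (3*pi/2)"
  define q where "q = (\<lambda>z. if z = 0 then deriv E 0 else (E z - E 0) / (z - 0))"
  have qh: "q holomorphic_on UNIV"
    unfolding q_def by (rule pole_lemma[OF hol]) auto
  have fin: "pathfinish ?p = pathstart ?m" "pathfinish ?m = pathstart ?p"
    by (simp_all add: exp_eq)
  have "(q has_contour_integral 0) (?p +++ ?m)"
    by (rule Cauchy_theorem_convex_simple[OF qh]) (use fin in \<open>auto simp: valid_path_join\<close>)
  moreover have ci: "q contour_integrable_on ?p" "q contour_integrable_on ?m"
    by (intro contour_integrable_continuous_part_circlepath holomorphic_on_imp_continuous_on
         holomorphic_on_subset[OF qh] subset_UNIV)+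
  ultimately have q0: "contour_integral ?p q + contour_integral ?m q = 0"
    by (metis contour_integral_join contour_integral_unique valid_path_part_circlepath)
  have split: "contour_integral g (\<lambda>z. E z / z) = contour_integral g q + E 0 * c"
    if g: "q contour_integrable_on g" "((\<lambda>z. 1 / z) has_contour_integral c) g" "0 \<notin> path_image g" for g c
  proof -
    have "((\<lambda>z. q z + E 0 * (1 / z)) has_contour_integral (contour_integral g q + E 0 * c)) g"
      by (intro has_contour_integral_add has_contour_integral_lmul g has_contour_integral_integral)
    hence "((\<lambda>z. E z / z) has_contour_integral (contour_integral g q + E 0 * c)) g"
      by (rule has_contour_integral_eq) (use g(3) in \<open>auto simp: q_def field_simps\<close>)
    thus ?thesis by (rule contour_integral_unique)
  qed
  have nz: "0 \<notin> path_image ?p" "0 \<notin> path_image ?m"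
    using Re_part_circlepath_left(1)[of 0 R] Re_part_circlepath_right(1)[of 0 R] R by auto
  show ?thesis
    using split[OF ci(1) arc_integral_inverse[OF R] nz(1)]
      split[OF ci(2) arc_integral_inverse[OF R] nz(2)] q0
    by (simp add: algebra_simps)
qed

text \<open>
  Integration by parts on a segment of the imaginary axis, where the exponential has modulus one: the
  Riemann-Lebesgue lemma with a rate.
\<close>
lemma segment_exp_integral_bound:
  fixes \<phi> :: "complex \<Rightarrow> complex"
  assumes V: "open V" "\<phi> holomorphic_on V" "closed_segment a b \<subseteq> V" and ab: "Re a = 0" "Re b = 0"
  obtains B where "\<And>L. L > 0 \<Longrightarrow> norm (contour_integral (linepath a b) (\<lambda>z. \<phi> z * exp (z * of_real L))) \<le> B / L"
proof -
  have dh: "deriv \<phi> holomorphic_on V" using V by (intro holomorphic_deriv)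
  have "compact (deriv \<phi> ` closed_segment a b)"
    using dh V(3) by (intro compact_continuous_image holomorphic_on_imp_continuous_on)
       (auto intro: holomorphic_on_subset)
  then obtain B0 where B0: "\<And>z. z \<in> closed_segment a b \<Longrightarrow> norm (deriv \<phi> z) \<le> B0"
    by (meson bounded_iff compact_imp_bounded imageI)
  have B0': "B0 \<ge> 0" using B0[of a] norm_ge_zero order.trans by (metis ends_in_segment(1))
  define B where "B = norm (\<phi> a) + norm (\<phi> b) + B0 * norm (b - a)"
  show ?thesis
  proof (rule that)
    fix L :: real assume L: "L > 0"
    have re0: "Re z = 0" if "z \<in> closed_segment a b" for z
      using that ab by (auto simp: closed_segment_def)
    have en: "norm (exp (z * of_real L)) = 1" if "Re z = 0" for z
      using that by simp
    have sub: "path_image (linepath a b) \<subseteq> V" using V(3) by simp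
    have d: "((\<lambda>z. \<phi> z * exp (z * of_real L) / of_real L) has_field_derivative
           (deriv \<phi> z * exp (z * of_real L) / of_real L + \<phi> z * exp (z * of_real L))) (at z within V)"
      if "z \<in> V" for z
    proof -
      have "(\<phi> has_field_derivative deriv \<phi> z) (at z)"
        using V that holomorphic_derivI by blast
      moreover have "((\<lambda>z. exp (z * of_real L)) has_field_derivative exp (z * of_real L) * of_real L) (at z)"
        by (auto intro!: derivative_eq_intros)
      ultimately have "((\<lambda>z. \<phi> z * exp (z * of_real L) / of_real L) has_field_derivative
           (\<phi> z * (exp (z * of_real L) * of_real L) + deriv \<phi> z * exp (z * of_real L)) / of_real L) (at z)"
        by (intro DERIV_cdivide DERIV_mult')
      moreover have "(\<phi> z * (exp (z * of_real L) * of_real L) + deriv \<phi> z * exp (z * of_real L)) / of_real L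
          = deriv \<phi> z * exp (z * of_real L) / of_real L + \<phi> z * exp (z * of_real L)"
        using L by (simp add: add_divide_distrib)
      ultimately have "((\<lambda>z. \<phi> z * exp (z * of_real L) / of_real L) has_field_derivative
           (deriv \<phi> z * exp (z * of_real L) / of_real L + \<phi> z * exp (z * of_real L))) (at z)"
        by simp
      thus ?thesis by (rule has_field_derivative_at_within)
    qed
    have 1: "((\<lambda>z. deriv \<phi> z * exp (z * of_real L) / of_real L + \<phi> z * exp (z * of_real L)) has_contour_integral
       (\<phi> b * exp (b * of_real L) / of_real L - \<phi> a * exp (a * of_real L) / of_real L)) (linepath a b)"
      using contour_integral_primitive[OF d _ sub] by simp
    have ci: "(\<lambda>z. deriv \<phi> z * exp (z * of_real L) / of_real L) contour_integrable_on linepath a b"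
      by (intro contour_integrable_continuous_linepath continuous_intros
           continuous_on_subset[OF holomorphic_on_imp_continuous_on[OF dh] V(3)]) (use L in auto)
    have 2: "norm (contour_integral (linepath a b) (\<lambda>z. deriv \<phi> z * exp (z * of_real L) / of_real L))
             \<le> B0 / L * norm (b - a)"
      using ci B0' L B0 re0 en
      by (intro contour_integral_bound_linepath)
         (auto simp: norm_mult norm_divide intro!: divide_right_mono)
    have "((\<lambda>z. \<phi> z * exp (z * of_real L)) has_contour_integral
       ((\<phi> b * exp (b * of_real L) / of_real L - \<phi> a * exp (a * of_real L) / of_real L)
        - contour_integral (linepath a b) (\<lambda>z. deriv \<phi> z * exp (z * of_real L) / of_real L))) (linepath a b)"
      using has_contour_integral_diff[OF 1 has_contour_integral_integral[OF ci]] by simp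
    hence "norm (contour_integral (linepath a b) (\<lambda>z. \<phi> z * exp (z * of_real L)))
        = norm ((\<phi> b * exp (b * of_real L) / of_real L - \<phi> a * exp (a * of_real L) / of_real L)
        - contour_integral (linepath a b) (\<lambda>z. deriv \<phi> z * exp (z * of_real L) / of_real L))"
      by (simp add: contour_integral_unique)
    also have "\<dots> \<le> norm (\<phi> b * exp (b * of_real L) / of_real L) + norm (\<phi> a * exp (a * of_real L) / of_real L)
           + norm (contour_integral (linepath a b) (\<lambda>z. deriv \<phi> z * exp (z * of_real L) / of_real L))"
      by (meson add_mono norm_triangle_ineq4 order.refl order.trans)
    also have "\<dots> \<le> norm (\<phi> b) / L + norm (\<phi> a) / L + B0 / L * norm (b - a)"
      using 2 ab L by (intro add_mono) (auto simp: norm_mult norm_divide)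
    also have "\<dots> = B / L" by (simp add: B_def add_divide_distrib)
    finally show "norm (contour_integral (linepath a b) (\<lambda>z. \<phi> z * exp (z * of_real L))) \<le> B / L" .
  qed
qed

text \<open>
  By compactness, a half disc with its diameter on the line Re s = 1 stays inside the open set when it is
  slightly enlarged.
\<close>
lemma half_plane_nbhd:
  fixes S :: "complex set"
  assumes "open S" "{s. Re s \<ge> 1} \<subseteq> S"
  obtains d where "d > 0" "\<And>z. Re z > - d \<Longrightarrow> norm z < R + d \<Longrightarrow> 1 + z \<in> S"
proof -
  define K where "K = {s :: complex. Re s \<ge> 1} \<inter> cball 1 (max R 0 + 1)"
  have "compact K"
    unfolding K_def by (intro closed_Int_compact closed_halfspace_Re_ge compact_cball)
  moreover have "K \<subseteq> S" using assms by (auto simp: K_def)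
  ultimately have K: "compact K" "K \<subseteq> S" by auto
  obtain e where e: "e > 0" "(\<Union>x\<in>K. ball x e) \<subseteq> S"
    using compact_subset_open_imp_ball_epsilon_subset[OF K(1) assms(1) K(2)] by blast
  define d where "d = min (e/2) (1/2)"
  show ?thesis
  proof (rule that[of d])
    show "d > 0" using e by (simp add: d_def)
    fix z assume z: "Re z > - d" "norm z < R + d"
    define w where "w = 1 + z + of_real (max 0 (- Re z))"
    have "Re w \<ge> 1" by (auto simp: w_def)
    moreover have "norm (w - 1) \<le> norm z + max 0 (- Re z)"
      unfolding w_def by (simp add: norm_triangle_le add.assoc)
    hence "dist 1 w \<le> max R 0 + 1" using z unfolding dist_norm norm_minus_commute[of 1 w]
      by (auto simp: d_def)
    ultimately have "w \<in> K" by (simp add: K_def)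
    moreover have "dist w (1 + z) < e" using z e by (auto simp: w_def dist_norm d_def)
    ultimately show "1 + z \<in> S" using e(2) by (auto simp: ball_def)
  qed
qed

lemma norm_diff3: "norm (x - y - z) \<le> norm x + norm y + norm (z :: complex)"
  using norm_triangle_ineq4[of "x - y" z] norm_triangle_ineq4[of x y] by linarith

text \<open>
  The remainder of the series is at most C N^(-x) / x with x = Re z; the exponential cancels N^(-x) and the
  kernel cancels 1/x.
\<close>
lemma newman_right_bound:
  fixes a :: "nat \<Rightarrow> complex"
  assumes bd: "\<And>n. norm (a n) \<le> C" and N: "N \<ge> 1" and R: "R > 0"
    and z: "norm z = R" "Re z > 0"
    and sums: "(\<lambda>n. a n * npow n (1 + z)) sums w"
  shows "norm ((w - (\<Sum>n<N. a n * npow n (1 + z))) * exp (z * of_real (ln N)) *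
              (1 / z + z / of_real R ^ 2)) \<le> 2 * C / R ^ 2"
proof -
  let ?x = "Re z"
  have C: "C \<ge> 0" using bd[of 0] norm_ge_zero order.trans by blast
  have tail: "(\<lambda>n. a (n + N) * of_nat (Suc (n + N)) powr (- (1 + z))) sums
      (w - (\<Sum>n<N. a n * npow n (1 + z)))"
    using sums_split_initial_segment[OF sums] .
  have nb: "norm (a (n + N) * of_nat (Suc (n + N)) powr (- (1 + z))) \<le>
              C * real (Suc (n + N)) powr (- 1 - ?x)" for n
    unfolding norm_mult norm_nat_powr using bd[of "n + N"] C by (intro mult_mono) auto
  note T = powr_tail_bounds[OF z(2) N]
  have s: "summable (\<lambda>n. C * real (Suc (n + N)) powr (- 1 - ?x))"
    by (intro summable_mult T)
  have "norm (w - (\<Sum>n<N. a n * npow n (1 + z))) \<le>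
     (\<Sum>n. C * real (Suc (n + N)) powr (- 1 - ?x))"
    unfolding sums_unique[OF tail] by (rule norm_suminf_le[OF nb s])
  also have "\<dots> = C * (\<Sum>n. real (Suc (n + N)) powr (- 1 - ?x))"
    by (intro suminf_mult T)
  also have "\<dots> \<le> C * (real N powr (- ?x) / ?x)"
    by (intro mult_left_mono T C)
  finally have 1: "norm (w - (\<Sum>n<N. a n * npow n (1 + z))) \<le> C * (real N powr (- ?x) / ?x)" .
  have e: "norm (exp (z * of_real (ln N))) = real N powr ?x"
    using N by (simp add: powr_def)
  have "norm ((w - (\<Sum>n<N. a n * npow n (1 + z))) * exp (z * of_real (ln N)) *
              (1 / z + z / of_real R ^ 2)) \<le> C * (real N powr (- ?x) / ?x) * real N powr ?x * (2 * \<bar>Re z\<bar> / R ^ 2)"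
    unfolding norm_mult newman_kernel_norm[OF z(1) R] e
    by (intro mult_right_mono 1) auto
  also have "\<dots> = (real N powr (- ?x) * real N powr ?x) * 2 * C / R ^ 2"
    using z R by (simp add: field_simps)
  also have "real N powr (- ?x) * real N powr ?x = 1"
    using N by (simp add: powr_minus)
  finally show ?thesis by simp
qed

text \<open>
  On the left half circle the partial sum, being entire, is estimated on its own: it is at most
  C N^u (1/N + 1/u) with u = -Re z.
\<close>
lemma newman_left_bound:
  fixes a :: "nat \<Rightarrow> complex"
  assumes bd: "\<And>n. norm (a n) \<le> C" and N: "N \<ge> 1" and R: "R > 0"
    and z: "norm z = R" "Re z < 0"
  shows "norm ((\<Sum>n<N. a n * npow n (1 + z)) * exp (z * of_real (ln N)) *
              (1 / z + z / of_real R ^ 2)) \<le> 2 * C / R ^ 2 + 2 * C / (R * N)"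
proof -
  define u where "u = - Re z"
  have u: "u > 0" "u \<le> R" using z abs_Re_le_cmod[of z] by (auto simp: u_def)
  have C: "C \<ge> 0" using bd[of 0] norm_ge_zero order.trans by blast
  have "norm (\<Sum>n<N. a n * npow n (1 + z)) \<le> (\<Sum>n<N. C * real (Suc n) powr (u - 1))"
  proof (rule sum_norm_le)
    fix n
    have e0: "Re (- (1 + z)) = u - 1" by (simp add: u_def)
    have "norm (a n * npow n (1 + z)) = norm (a n) * real (Suc n) powr (u - 1)"
      unfolding norm_mult norm_nat_powr by (simp only: e0)
    thus "norm (a n * npow n (1 + z)) \<le> C * real (Suc n) powr (u - 1)"
      using mult_right_mono[OF bd[of n], of "real (Suc n) powr (u - 1)"] by simp
  qed
  also have "\<dots> = C * (\<Sum>n<N. real (Suc n) powr (u - 1))" by (simp add: sum_distrib_left)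
  also have "\<dots> \<le> C * (real N powr u * (1 / N + 1 / u))"
    by (intro mult_left_mono sum_Suc_powr_le u N C)
  finally have 1: "norm (\<Sum>n<N. a n * npow n (1 + z)) \<le> C * (real N powr u * (1 / N + 1 / u))" .
  have e: "norm (exp (z * of_real (ln N))) = real N powr (- u)"
    using N by (simp add: powr_def u_def)
  have ab: "\<bar>Re z\<bar> = u" using z by (simp add: u_def)
  have "norm ((\<Sum>n<N. a n * npow n (1 + z)) * exp (z * of_real (ln N)) *
              (1 / z + z / of_real R ^ 2)) \<le> C * (real N powr u * (1 / N + 1 / u)) * real N powr (-u) * (2 * u / R ^ 2)"
    unfolding norm_mult newman_kernel_norm[OF z(1) R] e ab
    by (intro mult_right_mono 1) (use u in auto)
  also have "\<dots> = (real N powr (- u) * real N powr u) * (2 * C / R ^ 2 * (u / N + 1))"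
    using u R by (simp add: field_simps)
  also have "real N powr (- u) * real N powr u = 1"
    using N by (simp add: powr_minus)
  also have "1 * (2 * C / R ^ 2 * (u / N + 1)) \<le> 2 * C / R ^ 2 * (R / N + 1)"
    using u C N R by (auto intro!: mult_left_mono divide_right_mono add_right_mono)
  also have "\<dots> = 2 * C / R ^ 2 + 2 * C / (R * N)"
    using R N by (simp add: field_simps power2_eq_square)
  finally show ?thesis .
qed

text \<open>
  The partial sum at z = 0 is an integral of its product with the kernel over the whole circle. On the
  right half it is compared with G itself, whose product with the kernel has integral zero around the
  half disc since G(1) = 0; the diameter of the half disc contributes O(1/log N). Taking the diameter on the axis itself is possible
  because G is holomorphic on a neighbourhood of it.
\<close>
lemma newman_radius_estimate:
  fixes a :: "nat \<Rightarrow> complex" and G :: "complex \<Rightarrow> complex"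
  assumes bd: "\<And>n. norm (a n) \<le> C"
    and S: "open S" "{s. Re s \<ge> 1} \<subseteq> S" "G holomorphic_on S"
    and sums: "\<And>s. Re s > 1 \<Longrightarrow> (\<lambda>n. a n * npow n s) sums G s"
    and G1: "G 1 = 0" and R: "R > 0"
  obtains B where "\<And>N. N \<ge> 2 \<Longrightarrow> norm (\<Sum>n<N. a n / of_nat (Suc n)) \<le> 2 * C / R + C / N + B / ln N"
proof -
  let ?p = "part_circlepath 0 R (-pi/2) (pi/2)" and ?m = "part_circlepath 0 R (pi/2) (3*pi/2)"
  let ?s = "linepath (\<i> * of_real R) (- \<i> * of_real R)"
  obtain d where d: "d > 0" "\<And>z. Re z > - d \<Longrightarrow> norm z < R + d \<Longrightarrow> 1 + z \<in> S"
    using half_plane_nbhd[OF S(1,2), of R] by blast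
  define V where "V = {z. Re z > - d} \<inter> ball 0 (R + d)"
  have V: "open V" "convex V"
    unfolding V_def by (auto intro!: open_Int convex_Int open_halfspace_Re_gt convex_halfspace_Re_gt)
  have V0: "0 \<in> V" using d R by (simp add: V_def)
  define F where "F = (\<lambda>z. G (1 + z))"
  have Fh: "F holomorphic_on V"
  proof -
    have "(G \<circ> (\<lambda>z. 1 + z)) holomorphic_on V"
      by (rule holomorphic_on_compose_gen[OF _ S(3)]) (use d in \<open>auto simp: V_def intro!: holomorphic_intros\<close>)
    thus ?thesis by (simp add: F_def o_def)
  qed
  define h where "h = (\<lambda>z. if z = 0 then deriv F 0 else (F z - F 0) / (z - 0))"
  have hh: "h holomorphic_on V" unfolding h_def using V V0 Fh
    by (intro pole_lemma) (auto simp: interior_open)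
  define \<phi> where "\<phi> = (\<lambda>z. h z * (1 + z ^ 2 / of_real R ^ 2))"
  have \<phi>h: "\<phi> holomorphic_on V" unfolding \<phi>_def using R by (intro holomorphic_intros hh) auto
  have \<phi>_eq: "\<phi> z = F z * (1 / z + z / of_real R ^ 2)" if "z \<noteq> 0" for z
    using that G1 by (simp add: \<phi>_def h_def F_def field_simps power2_eq_square)
  have pV: "path_image ?p \<subseteq> V"
    using Re_part_circlepath_right[of _ R] R d unfolding V_def by force
  have sV: "closed_segment (\<i> * of_real R) (- \<i> * of_real R) \<subseteq> V"
    by (rule closed_segment_subset) (use d R V in \<open>auto simp: V_def norm_mult\<close>)
  obtain B where B: "\<And>L. L > 0 \<Longrightarrow> norm (contour_integral ?s (\<lambda>z. \<phi> z * exp (z * of_real L))) \<le> B / L"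
    using segment_exp_integral_bound[OF V(1) \<phi>h sV] by auto
  show ?thesis
  proof (rule that)
    fix N :: nat assume N: "N \<ge> 2"
    hence N1: "N \<ge> 1" by simp
    define L where "L = ln (real N)"
    have L: "L > 0" using N by (simp add: L_def)
    define P where "P = (\<lambda>z. \<Sum>n<N. a n * npow n (1 + z))"
    define k where "k = (\<lambda>z::complex. exp (z * of_real L) * (1 / z + z / of_real R ^ 2))"
    define E where "E = (\<lambda>z. P z * exp (z * of_real L) * (1 + z ^ 2 / of_real R ^ 2))"
    have Ph: "P holomorphic_on UNIV" unfolding P_def
      by (intro holomorphic_intros)
    have Eh: "E holomorphic_on UNIV" unfolding E_def using R by (intro holomorphic_intros Ph) auto
    have Ek: "E z / z = P z * k z" if "z \<noteq> 0" for z
      using that R by (simp add: E_def k_def field_simps power2_eq_square)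
    have nz: "z \<noteq> 0" if "z \<in> path_image ?p \<or> z \<in> path_image ?m" for z
      using that Re_part_circlepath_left(1)[of z R] Re_part_circlepath_right(1)[of z R] R by auto
    have kc: "continuous_on T k" if "0 \<notin> T" for T
      unfolding k_def using R that by (intro continuous_intros) auto
    have Pc: "continuous_on T P" for T
      by (meson Ph continuous_on_subset holomorphic_on_imp_continuous_on subset_UNIV)
    have circ: "contour_integral ?p (\<lambda>z. P z * k z) + contour_integral ?m (\<lambda>z. P z * k z) = 2 * pi * \<i> * P 0"
    proof -
      have "contour_integral ?p (\<lambda>z. P z * k z) = contour_integral ?p (\<lambda>z. E z / z)"
           "contour_integral ?m (\<lambda>z. P z * k z) = contour_integral ?m (\<lambda>z. E z / z)"
        using Ek nz by (intro contour_integral_cong; force)+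
      thus ?thesis using circle_kernel_integral[OF Eh R] by (simp add: E_def)
    qed
    have ph: "(\<lambda>z. \<phi> z * exp (z * of_real L)) holomorphic_on V" by (intro holomorphic_intros \<phi>h)
    have e2: "exp (\<i> * of_real (pi/2)) = \<i>" "exp (\<i> * of_real (-pi/2)) = - \<i>"
      by (simp_all add: exp_eq_polar cis.code complex_eq_iff)
    have fin: "pathfinish ?p = pathstart ?s" "pathfinish ?s = pathstart ?p"
      unfolding pathfinish_part_circlepath pathstart_part_circlepath
        pathfinish_linepath pathstart_linepath e2 by simp_all
    \<comment> \<open>The boundary of the half disc, traversed along the right half circle and back along its diameter.\<close>
    have "((\<lambda>z. \<phi> z * exp (z * of_real L)) has_contour_integral 0) (?p +++ ?s)"
    proof (rule Cauchy_theorem_convex_simple[OF ph V(2)])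
      show "valid_path (?p +++ ?s)"
        by (intro valid_path_join valid_path_part_circlepath valid_path_linepath fin)
      show "path_image (?p +++ ?s) \<subseteq> V"
        unfolding path_image_join[OF fin(1)] path_image_linepath by (intro Un_least pV sV)
      show "pathfinish (?p +++ ?s) = pathstart (?p +++ ?s)"
        unfolding pathfinish_join pathstart_join by (rule fin)
    qed
    moreover have cip: "(\<lambda>z. \<phi> z * exp (z * of_real L)) contour_integrable_on ?p"
      by (intro contour_integrable_continuous_part_circlepath continuous_on_subset[OF _ pV]
           holomorphic_on_imp_continuous_on ph)
    moreover have "(\<lambda>z. \<phi> z * exp (z * of_real L)) contour_integrable_on ?s"
      by (intro contour_integrable_continuous_linepath continuous_on_subset[OF _ sV]
           holomorphic_on_imp_continuous_on ph)
    ultimately have half: "contour_integral ?p (\<lambda>z. \<phi> z * exp (z * of_real L))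
        + contour_integral ?s (\<lambda>z. \<phi> z * exp (z * of_real L)) = 0"
      using contour_integral_unique contour_integral_join[OF _ _ valid_path_part_circlepath valid_path_linepath]
      by fastforce
    have pk: "\<phi> z * exp (z * of_real L) = F z * k z" if "z \<in> path_image ?p" for z
      using \<phi>_eq nz that by (simp add: k_def)
    have ciF: "(\<lambda>z. F z * k z) contour_integrable_on ?p"
      using contour_integrable_eq[OF cip pk] .
    have halfF: "contour_integral ?p (\<lambda>z. F z * k z) = - contour_integral ?s (\<lambda>z. \<phi> z * exp (z * of_real L))"
      using half contour_integral_cong[OF refl pk] by (simp add: eq_neg_iff_add_eq_0)
    have ciP: "(\<lambda>z. P z * k z) contour_integrable_on ?p" "(\<lambda>z. P z * k z) contour_integrable_on ?m"
      using nz by (intro contour_integrable_continuous_part_circlepath continuous_intros Pc kc; blast)+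
    have diff: "contour_integral ?p (\<lambda>z. (F z - P z) * k z) =
       contour_integral ?p (\<lambda>z. F z * k z) - contour_integral ?p (\<lambda>z. P z * k z)"
      using contour_integral_diff[OF ciF ciP(1)] by (simp add: left_diff_distrib)
    have cid: "(\<lambda>z. (F z - P z) * k z) contour_integrable_on ?p"
      using contour_integrable_diff[OF ciF ciP(1)] by (simp add: left_diff_distrib)
    have C: "C \<ge> 0" using bd[of 0] norm_ge_zero order.trans by blast
    let ?k = "{\<i> * of_real R, - \<i> * of_real R}"
    have b1: "norm (contour_integral ?p (\<lambda>z. (F z - P z) * k z)) \<le> 2 * C / R ^ 2 * R * (pi / 2 - (- pi / 2))"
    proof (rule has_contour_integral_bound_part_circlepath_strong[OF has_contour_integral_integral[OF cid], of ?k])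
      fix z assume z: "z \<in> path_image ?p - ?k"
      have z1: "norm z = R" "Re z \<ge> 0" using Re_part_circlepath_right[of z R] z R by auto
      hence "Re z \<noteq> 0" using on_imaginary_axis[of z R] z by blast
      hence "Re z > 0" using z1 by simp
      with newman_right_bound[OF bd N1 R z1(1) this sums]
      show "norm ((F z - P z) * k z) \<le> 2 * C / R ^ 2"
        by (simp add: F_def P_def k_def L_def mult.assoc)
    qed (use C R in auto)
    have b2: "norm (contour_integral ?m (\<lambda>z. P z * k z)) \<le> (2 * C / R ^ 2 + 2 * C / (R * N)) * R * (3 * pi / 2 - pi / 2)"
    proof (rule has_contour_integral_bound_part_circlepath_strong[OF has_contour_integral_integral[OF ciP(2)], of ?k])
      fix z assume z: "z \<in> path_image ?m - ?k"
      have z1: "norm z = R" "Re z \<le> 0" using Re_part_circlepath_left[of z R] z R by auto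
      hence "Re z \<noteq> 0" using on_imaginary_axis[of z R] z by blast
      hence "Re z < 0" using z1 by simp
      with newman_left_bound[OF bd N1 R z1(1) this]
      show "norm (P z * k z) \<le> 2 * C / R ^ 2 + 2 * C / (R * N)"
        by (simp add: P_def k_def L_def mult.assoc)
    qed (use C R in auto)
    have P0: "2 * pi * \<i> * P 0 = contour_integral ?m (\<lambda>z. P z * k z)
        - contour_integral ?p (\<lambda>z. (F z - P z) * k z) - contour_integral ?s (\<lambda>z. \<phi> z * exp (z * of_real L))"
      unfolding circ[symmetric] diff halfF by (simp add: algebra_simps)
    have "norm (2 * pi * \<i> * P 0) \<le> norm (contour_integral ?m (\<lambda>z. P z * k z))
        + norm (contour_integral ?p (\<lambda>z. (F z - P z) * k z)) + norm (contour_integral ?s (\<lambda>z. \<phi> z * exp (z * of_real L)))"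
      unfolding P0 by (rule norm_diff3)
    also have "\<dots> \<le> (2 * C / R ^ 2 + 2 * C / (R * N)) * R * (3 * pi / 2 - pi / 2)
         + 2 * C / R ^ 2 * R * (pi / 2 - (- pi / 2)) + B / L"
      by (intro add_mono b1 b2 B L)
    also have "\<dots> = 2 * pi * (2 * C / R + C / N + B / (2 * pi) / L)"
      using R N L by (simp add: field_simps power2_eq_square)
    finally have "2 * pi * norm (P 0) \<le> 2 * pi * (2 * C / R + C / N + B / (2 * pi) / L)"
      by (simp add: norm_mult)
    hence "norm (P 0) \<le> 2 * C / R + C / N + B / (2 * pi) / L"
      by (subst (asm) mult_le_cancel_left_pos) auto
    moreover have "P 0 = (\<Sum>n<N. a n / of_nat (Suc n))"
      unfolding P_def by (intro sum.cong refl) (simp add: powr_minus divide_inverse powr_one')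
    ultimately show "norm (\<Sum>n<N. a n / of_nat (Suc n)) \<le> 2 * C / R + C / N + (B / (2 * pi)) / ln N"
      by (simp add: L_def)
  qed
qed

text \<open>
  Changing the first coefficient by G(1) reduces to the case G(1) = 0. Then the radius R is chosen large
  in terms of the wanted precision, before N tends to infinity.
\<close>
theorem newman_tauberian:
  fixes a :: "nat \<Rightarrow> complex" and G :: "complex \<Rightarrow> complex"
  assumes bd: "\<And>n. norm (a n) \<le> C"
    and S: "open S" "{s. Re s \<ge> 1} \<subseteq> S" "G holomorphic_on S"
    and sums: "\<And>s. Re s > 1 \<Longrightarrow> (\<lambda>n. a n * npow n s) sums G s"
  shows "(\<lambda>n. a n / of_nat (Suc n)) sums G 1"
proof -
  \<comment> \<open>The index 0 belongs to the integer 1, whose Dirichlet term is constant in s.\<close>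
  define a' where "a' = (\<lambda>n. a n - (if n = 0 then G 1 else 0))"
  define C' where "C' = C + norm (G 1)"
  have C0: "C \<ge> 0" using bd[of 0] norm_ge_zero order.trans by blast
  have bd': "norm (a' n) \<le> C'" for n
    using bd[of n] norm_triangle_ineq4[of "a 0" "G 1"]
    by (auto simp: a'_def C'_def add_increasing2)
  have s': "(\<lambda>n. a' n * npow n s) sums (G s - G 1)" if "Re s > 1" for s
  proof -
    have "(\<lambda>n. (if n = 0 then G 1 else 0) * npow n s) sums (G 1)"
      using sums_If_finite_set[of "{0::nat}" "\<lambda>n. G 1 * npow n s"]
      by (simp add: if_distrib[where f="\<lambda>x. x * _"] cong: if_cong)
    from sums_diff[OF sums[OF that] this] show ?thesis by (simp add: a'_def left_diff_distrib)
  qed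
  have hol: "(\<lambda>s. G s - G 1) holomorphic_on S" by (intro holomorphic_intros S)
  have "(\<lambda>N. \<Sum>n<N. a' n / of_nat (Suc n)) \<longlonglongrightarrow> 0"
  proof (rule tendstoI)
    fix e :: real assume e: "e > 0"
    define R where "R = 8 * (C' + 1) / e"
    have C': "C' \<ge> 0" using C0 by (simp add: C'_def)
    hence R: "R > 0" using e by (simp add: R_def)
    obtain B where B: "\<And>N. N \<ge> 2 \<Longrightarrow> norm (\<Sum>n<N. a' n / of_nat (Suc n)) \<le> 2 * C' / R + C' / N + B / ln N"
      using newman_radius_estimate[OF bd' S(1,2) hol s' _ R] by auto
    have lim: "(\<lambda>N. C' / real N + B / ln (real N)) \<longlonglongrightarrow> 0" by real_asymp
    have ev: "\<forall>\<^sub>F N::nat in sequentially. norm (C' / real N + B / ln (real N)) < e / 2"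
      using tendstoD[OF lim, of "e / 2"] e by simp
    have R4: "2 * C' / R \<le> e / 4" using C' e by (simp add: R_def field_simps)
    show "\<forall>\<^sub>F N in sequentially. dist (\<Sum>n<N. a' n / of_nat (Suc n)) 0 < e"
      using ev eventually_ge_at_top[of "2::nat"]
    proof eventually_elim
      case (elim N)
      have "norm (\<Sum>n<N. a' n / of_nat (Suc n)) \<le> 2 * C' / R + C' / N + B / ln N"
        using elim by (intro B)
      also have "\<dots> < e / 4 + e / 2"
      proof -
        have "C' / N + B / ln N < e / 2"
          using elim(1) abs_ge_self unfolding real_norm_def by (rule le_less_trans[rotated])
        with R4 show ?thesis by linarith
      qed
      also have "\<dots> \<le> e" using e by simp
      finally show ?case by simp
    qed
  qed
  hence "(\<lambda>n. a' n / of_nat (Suc n)) sums 0" by (simp add: sums_def)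
  moreover have "(\<lambda>n. (if n = 0 then G 1 else 0) / of_nat (Suc n)) sums (G 1)"
      using sums_If_finite_set[of "{0::nat}" "\<lambda>n. G 1 / of_nat (Suc n)"]
      by (simp add: if_distrib[where f="\<lambda>x. x / _"] cong: if_cong)
  ultimately have "(\<lambda>n. a' n / of_nat (Suc n) + (if n = 0 then G 1 else 0) / of_nat (Suc n)) sums (0 + G 1)"
    by (rule sums_add)
  thus ?thesis by (simp add: a'_def diff_divide_distrib)
qed

section \<open>The zeta function with its pole removed\<close>

text \<open>
  The Weierstrass test in the form in which all series below satisfy it: near a point x, with
  d = (Re x - c) / 2, the terms are dominated by a multiple of n^(-1-d).
\<close>
lemma holomorphic_suminf_powr_bound:
  fixes f :: "nat \<Rightarrow> complex \<Rightarrow> complex" and P :: "real \<Rightarrow> real" and c :: real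
  assumes hol: "\<And>n. f n holomorphic_on {s. Re s > c}"
    and bound: "\<And>n s. Re s > c \<Longrightarrow> norm (f n s) \<le> P (norm s) * real (Suc n) powr (c - 1 - Re s)"
    and P: "mono_on {0..} P" "P 0 \<ge> 0"
  shows "\<And>s. Re s > c \<Longrightarrow> (\<lambda>n. f n s) sums (\<Sum>n. f n s)"
    and "(\<lambda>s. \<Sum>n. f n s) holomorphic_on {s. Re s > c}"
    and "\<And>s. Re s > c \<Longrightarrow> (\<lambda>n. deriv (f n) s) sums deriv (\<lambda>s. \<Sum>n. f n s) s"
proof -
  let ?S = "{s. Re s > c}"
  have S: "open ?S" by (rule open_halfspace_Re_gt)
  have Pnn: "P r \<ge> 0" if "r \<ge> 0" for r
    using mono_onD[OF P(1), of 0 r] P(2) that by auto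
  have loc: "\<exists>d h. 0 < d \<and> summable h \<and> range h \<subseteq> \<real>\<^sub>\<ge>\<^sub>0 \<and>
     (\<forall>\<^sub>F n in sequentially. \<forall>y\<in>ball x d \<inter> ?S. cmod (f n y) \<le> cmod (h n))" if x: "x \<in> ?S" for x
  proof -
    define d where "d = (Re x - c) / 2"
    have d: "d > 0" using x by (simp add: d_def)
    define h where "h = (\<lambda>n. complex_of_real (P (norm x + d) * real (Suc n) powr (- 1 - d)))"
    have sum0: "summable (\<lambda>n. real (Suc n) powr (- 1 - d))"
    proof -
      have "summable (\<lambda>n. real (Suc (n + 1)) powr (- 1 - d))"
        by (rule powr_tail_bounds(1)[OF d]) simp
      thus ?thesis using summable_iff_shift[of "\<lambda>n. real (Suc n) powr (- 1 - d)" 1] by simp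
    qed
    have "summable h" unfolding h_def summable_of_real_iff by (intro summable_mult sum0)
    moreover have "range h \<subseteq> \<real>\<^sub>\<ge>\<^sub>0" using d unfolding h_def image_subset_iff nonneg_Reals_of_real_iff
      by (auto intro!: mult_nonneg_nonneg Pnn simp del: of_nat_Suc)
    moreover have "cmod (f n y) \<le> cmod (h n)" if y: "y \<in> ball x d \<inter> ?S" for n y
    proof -
      have ny: "norm y \<le> norm x + d"
        using y norm_triangle_sub[of y x] by (auto simp: dist_norm norm_minus_commute)
      have "\<bar>Re x - Re y\<bar> < d" using y abs_Re_le_cmod[of "x - y"] by (auto simp: dist_norm)
      hence "Re x - Re y < d" by linarith
      hence ry: "Re y \<ge> c + d" unfolding d_def by (simp add: field_simps)
      have "cmod (f n y) \<le> P (norm y) * real (Suc n) powr (c - 1 - Re y)" using y by (intro bound) auto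
      also have "\<dots> \<le> P (norm x + d) * real (Suc n) powr (- 1 - d)"
        using ny ry d by (intro mult_mono powr_mono mono_onD[OF P(1)] Pnn) auto
      also have "\<dots> = cmod (h n)" using d by (simp add: h_def norm_mult Pnn del: of_nat_Suc)
      finally show ?thesis .
    qed
    ultimately show ?thesis using d by (intro exI[of _ d] exI[of _ h]) simp
  qed
  have hfd: "(f n has_field_derivative deriv (f n) x) (at x)" if "x \<in> ?S" for n x
    using hol that S by (metis holomorphic_derivI)
  obtain g g' where g: "\<forall>x\<in>?S. ((\<lambda>n. f n x) sums g x) \<and> ((\<lambda>n. deriv (f n) x) sums g' x) \<and>
      (g has_field_derivative g' x) (at x)"
    using series_and_derivative_comparison_complex[OF S hfd loc] by blast
  have geq: "g x = (\<Sum>n. f n x)" if "x \<in> ?S" for x using g that sums_unique by blast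
  have der: "((\<lambda>s. \<Sum>n. f n s) has_field_derivative g' x) (at x)" if "x \<in> ?S" for x
  proof (rule has_field_derivative_transform_within_open[OF _ S that])
    show "(g has_field_derivative g' x) (at x)" using g that by blast
  qed (rule geq)
  show "(\<lambda>n. f n s) sums (\<Sum>n. f n s)" if "Re s > c" for s
    using g geq that by auto
  show "(\<lambda>s. \<Sum>n. f n s) holomorphic_on ?S"
    using der S by (auto simp: holomorphic_on_open)
  show "(\<lambda>n. deriv (f n) s) sums deriv (\<lambda>s. \<Sum>n. f n s) s" if "Re s > c" for s
    using der[of s] g that by (auto simp: DERIV_imp_deriv)
qed

lemma norm_powr_diff_le:
  fixes m t :: real and s :: complex
  assumes "0 < m" "m \<le> t" "Re s > -1"
  shows "norm (of_real t powr (- s) - of_real m powr (- s)) \<le> norm s * m powr (- Re s - 1) * (t - m)"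
proof -
  let ?S = "closed_segment (complex_of_real m) (complex_of_real t)"
  have S: "\<exists>x. z = of_real x \<and> m \<le> x" if "z \<in> ?S" for z
    using that assms by (auto simp: closed_segment_of_real closed_segment_eq_real_ivl)
  have "norm (of_real t powr (- s) - of_real m powr (- s)) \<le>
          (norm s * m powr (- Re s - 1)) * norm (complex_of_real t - of_real m)"
  proof (rule field_differentiable_bound[of ?S])
    fix z assume z: "z \<in> ?S"
    then obtain x where x: "z = of_real x" "m \<le> x" using S by blast
    show "((\<lambda>z. z powr (- s)) has_field_derivative - s * z powr (- s - 1)) (at z within ?S)"
    proof (rule has_field_derivative_at_within, rule has_field_derivative_powr)
      show "z \<notin> \<real>\<^sub>\<le>\<^sub>0" using x assms by (auto simp: complex_nonpos_Reals_iff)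
    qed
    have "norm (- s * z powr (- s - 1)) = norm s * x powr (- Re s - 1)"
      using x assms by (simp add: norm_mult norm_powr_real_powr)
    also have "\<dots> \<le> norm s * m powr (- Re s - 1)"
      using x assms by (intro mult_left_mono powr_mono2') auto
    finally show "norm (- s * z powr (- s - 1)) \<le> norm s * m powr (- Re s - 1)" .
  qed auto
  also have "norm (complex_of_real t - of_real m) = t - m"
    using assms by (metis abs_of_nonneg diff_ge_0_iff_ge norm_of_real of_real_diff)
  finally show ?thesis .
qed

text \<open>
  For m = n + 1 this is s - 1 times the difference between m^(-s) and the integral of t^(-s) over
  [m, m + 1]. In this form it is visibly entire, and it is small because t^(-s) varies little on [m, m + 1].
\<close>
definition zeta_gap :: "nat \<Rightarrow> complex \<Rightarrow> complex" where
  "zeta_gap n s = (s - 1) * npow n s - of_nat (Suc n) powr (1 - s)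
      + of_nat (Suc (Suc n)) powr (1 - s)"

lemma zeta_gap_holomorphic: "zeta_gap n holomorphic_on A"
  unfolding zeta_gap_def by (intro holomorphic_intros)

lemma norm_zeta_gap_le:
  assumes "Re s > -1"
  shows "norm (zeta_gap n s) \<le> norm (s - 1) * norm s * real (Suc n) powr (- 1 - Re s)"
proof -
  define m where "m = real (Suc n)"
  have m: "m > 0" by (simp add: m_def)
  let ?S = "closed_segment (complex_of_real m) (complex_of_real (m + 1))"
  let ?f = "\<lambda>z. (s - 1) * of_real m powr (- s) * z + z powr (1 - s)"
  have S: "\<exists>x. z = of_real x \<and> m \<le> x \<and> x \<le> m + 1" if "z \<in> ?S" for z
    using that m unfolding closed_segment_of_real by (auto simp: closed_segment_eq_real_ivl)
  let ?B = "norm (s - 1) * (norm s * m powr (- 1 - Re s))"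
  have "norm (?f (of_real (m + 1)) - ?f (of_real m)) \<le> ?B * norm (complex_of_real (m + 1) - of_real m)"
  proof (rule field_differentiable_bound[of ?S])
    fix z assume z: "z \<in> ?S"
    then obtain x where x: "z = of_real x" "m \<le> x" "x \<le> m + 1" using S by blast
    show "(?f has_field_derivative ((s - 1) * of_real m powr (- s) + (1 - s) * z powr (- s))) (at z within ?S)"
    proof (rule has_field_derivative_at_within, rule DERIV_add)
      show "((\<lambda>z. (s - 1) * of_real m powr (- s) * z) has_field_derivative (s - 1) * of_real m powr (- s)) (at z)"
        by (auto intro!: derivative_eq_intros)
      show "((\<lambda>z. z powr (1 - s)) has_field_derivative (1 - s) * z powr (- s)) (at z)"
        using has_field_derivative_powr[of z "1 - s"] x m by (auto simp: complex_nonpos_Reals_iff)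
    qed
    have "(s - 1) * of_real m powr (- s) + (1 - s) * z powr (- s) =
         - ((s - 1) * (of_real x powr (- s) - of_real m powr (- s)))"
      by (simp add: x algebra_simps)
    also have "norm \<dots> = norm (s - 1) * norm (of_real x powr (- s) - of_real m powr (- s))"
      by (simp add: norm_mult)
    also have "\<dots> \<le> norm (s - 1) * (norm s * m powr (- Re s - 1) * (x - m))"
      using x m assms by (intro mult_left_mono norm_powr_diff_le) auto
    also have "\<dots> \<le> norm (s - 1) * (norm s * m powr (- Re s - 1) * 1)"
      using x by (intro mult_left_mono) auto
    also have "- Re s - 1 = - 1 - Re s" by simp
    finally show "norm ((s - 1) * of_real m powr (- s) + (1 - s) * z powr (- s)) \<le> ?B" by simp
  qed auto
  also have "?f (of_real (m + 1)) - ?f (of_real m) = zeta_gap n s"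
    by (simp add: zeta_gap_def m_def algebra_simps)
  finally show ?thesis by (simp add: m_def)
qed

text \<open>
  The function (s - 1) zeta(s), continued to Re s > 0: for Re s > 1 the integrals subtracted in the gaps
  add up to 1 / (s - 1), which accounts for the summand 1.
\<close>
definition pole_free_zeta :: "complex \<Rightarrow> complex" where
  "pole_free_zeta s = 1 + (\<Sum>n. zeta_gap n s)"

lemma zeta_gap_sum:
  shows zeta_gap_sums: "\<And>s. Re s > 0 \<Longrightarrow> (\<lambda>n. zeta_gap n s) sums (\<Sum>n. zeta_gap n s)"
    and zeta_gap_suminf_holomorphic: "(\<lambda>s. \<Sum>n. zeta_gap n s) holomorphic_on {s. Re s > 0}"
proof -
  have b: "norm (zeta_gap n s) \<le> (norm s + 1) * norm s * real (Suc n) powr (0 - 1 - Re s)"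
    if "Re s > 0" for n s
  proof -
    have "norm (zeta_gap n s) \<le> norm (s - 1) * norm s * real (Suc n) powr (- 1 - Re s)"
      using that by (intro norm_zeta_gap_le) auto
    also have "\<dots> \<le> (norm s + 1) * norm s * real (Suc n) powr (- 1 - Re s)"
      using norm_triangle_ineq4[of s 1] by (intro mult_right_mono) auto
    finally show ?thesis by simp
  qed
  have m: "mono_on {0..} (\<lambda>r::real. (r + 1) * r)"
    by (intro mono_onI mult_mono) auto
  note T = holomorphic_suminf_powr_bound[of zeta_gap 0 "\<lambda>r. (r + 1) * r", OF zeta_gap_holomorphic b m]
  show "(\<lambda>n. zeta_gap n s) sums (\<Sum>n. zeta_gap n s)" if "Re s > 0" for s
    by (rule T(1)) (use that in simp_all)
  show "(\<lambda>s. \<Sum>n. zeta_gap n s) holomorphic_on {s. Re s > 0}"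
    by (rule T(2)) simp_all
qed

lemma pole_free_zeta_holomorphic: "pole_free_zeta holomorphic_on {s. Re s > 0}"
  unfolding pole_free_zeta_def by (intro holomorphic_intros zeta_gap_suminf_holomorphic)

lemma pole_free_zeta_1: "pole_free_zeta 1 = 1"
proof -
  have "zeta_gap n 1 = 0" for n
    unfolding zeta_gap_def by (simp add: powr_0 del: of_nat_Suc)
  thus ?thesis by (simp add: pole_free_zeta_def)
qed

definition zeta_series :: "complex \<Rightarrow> complex" where
  "zeta_series s = (\<Sum>n. npow n s)"

lemma zeta_series:
  shows zeta_series_sums: "\<And>s. Re s > 1 \<Longrightarrow> (\<lambda>n. npow n s) sums zeta_series s"
    and zeta_series_holomorphic: "zeta_series holomorphic_on {s. Re s > 1}"
    and zeta_series_deriv_sums: "\<And>s. Re s > 1 \<Longrightarrow>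
       (\<lambda>n. of_real (ln (real (Suc n))) * npow n s) sums (- deriv zeta_series s)"
proof -
  have h: "(\<lambda>s. npow n s) holomorphic_on {s. Re s > 1}" for n
    by (intro holomorphic_intros)
  have b: "norm (npow n s) \<le> 1 * real (Suc n) powr (1 - 1 - Re s)" for n s
    unfolding norm_nat_powr by simp
  have m: "mono_on {0..} (\<lambda>_::real. 1::real)" by (auto intro: mono_onI)
  note T = holomorphic_suminf_powr_bound[of "\<lambda>n s. npow n s" 1 "\<lambda>_. 1", OF h b m]
  show "(\<lambda>n. npow n s) sums zeta_series s" if "Re s > 1" for s
    unfolding zeta_series_def by (rule T(1)) (use that in simp_all)
  show "zeta_series holomorphic_on {s. Re s > 1}"
    unfolding zeta_series_def[abs_def] by (rule T(2)) simp_all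
  have d: "deriv (\<lambda>s. npow n s) s =
      - (of_real (ln (real (Suc n))) * npow n s)" for n and s :: complex
  proof (rule DERIV_imp_deriv)
    have "((\<lambda>s. exp (- s * of_real (ln (real (Suc n))))) has_field_derivative
        - (of_real (ln (real (Suc n))) * exp (- s * of_real (ln (real (Suc n)))))) (at s)"
      by (auto intro!: derivative_eq_intros)
    moreover have "npow n t = exp (- t * of_real (ln (real (Suc n))))" for t :: complex
      unfolding powr_def using Ln_of_nat[of "Suc n"] by (simp del: of_nat_Suc)
    ultimately show "((\<lambda>s. npow n s) has_field_derivative
        - (of_real (ln (real (Suc n))) * npow n s)) (at s)"
      by (simp del: of_nat_Suc)
  qed
  show "(\<lambda>n. of_real (ln (real (Suc n))) * npow n s) sums (- deriv zeta_series s)"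
    if "Re s > 1" for s
    using sums_minus[OF T(3)[OF _ that]] unfolding zeta_series_def[abs_def] d by simp
qed

lemma pole_free_zeta_eq:
  assumes "Re s > 1"
  shows "pole_free_zeta s = (s - 1) * zeta_series s"
proof -
  have "(\<lambda>n. of_nat (Suc n) powr (1 - s)) \<longlonglongrightarrow> 0"
    using assms by (intro tendsto_neg_powr_complex_of_nat filterlim_Suc) auto
  hence "(\<lambda>n. of_nat (Suc n) powr (1 - s) - of_nat (Suc (Suc n)) powr (1 - s)) sums
      (of_nat (Suc 0) powr (1 - s) - 0)"
    by (rule telescope_sums')
  hence "(\<lambda>n. (s - 1) * npow n s -
      (of_nat (Suc n) powr (1 - s) - of_nat (Suc (Suc n)) powr (1 - s))) sums ((s - 1) * zeta_series s - 1)"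
    using assms by (intro sums_diff sums_mult zeta_series_sums) auto
  also have "(\<lambda>n. (s - 1) * npow n s -
      (of_nat (Suc n) powr (1 - s) - of_nat (Suc (Suc n)) powr (1 - s))) = (\<lambda>n. zeta_gap n s)"
    by (simp add: zeta_gap_def fun_eq_iff)
  finally show ?thesis by (simp add: pole_free_zeta_def sums_iff)
qed

lemma has_sum_Times_mult:
  fixes f :: "'a \<Rightarrow> complex" and g :: "'b \<Rightarrow> complex"
  assumes f: "(f has_sum S) A" "(\<lambda>x. norm (f x)) summable_on A"
    and g: "(g has_sum T) B" "(\<lambda>x. norm (g x)) summable_on B"
  shows "((\<lambda>(x,y). f x * g y) has_sum (S * T)) (A \<times> B)"
proof -
  \<comment> \<open>Absolute summability of the products, from which the rearrangement follows.\<close>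
  define T' where "T' = infsum (\<lambda>y. norm (g y)) B"
  have T': "((\<lambda>y. norm (g y)) has_sum T') B" using g(2) by (simp add: T'_def)
  have "(\<lambda>p. norm (case p of (x, y) \<Rightarrow> f x * g y)) summable_on (A \<times> B)"
  proof (rule summable_on_SigmaI)
    fix x assume "x \<in> A"
    show "((\<lambda>y. norm (case (x, y) of (x, y) \<Rightarrow> f x * g y)) has_sum (norm (f x) * T')) B"
      using has_sum_cmult_right[OF T', of "norm (f x)"] by (simp add: norm_mult)
  next
    show "(\<lambda>x. norm (f x) * T') summable_on A" by (intro summable_on_cmult_left f)
  qed auto
  hence "(\<lambda>(x, y). f x * g y) summable_on (A \<times> B)" by (rule abs_summable_summable)
  then obtain U where U: "((\<lambda>(x, y). f x * g y) has_sum U) (A \<times> B)" by (auto simp: summable_on_def)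
  have "((\<lambda>x. f x * T) has_sum U) A"
    by (rule has_sum_Sigma'[OF U]) (use has_sum_cmult_right[OF g(1)] in simp)
  moreover have "((\<lambda>x. f x * T) has_sum (S * T)) A" by (intro has_sum_cmult_left f)
  ultimately have "U = S * T" by (rule has_sum_unique)
  thus ?thesis using U by simp
qed

lemma nat_has_sum_atLeast1_iff:
  "(f has_sum S) {1..} \<longleftrightarrow> ((\<lambda>n. f (Suc n)) has_sum S) (UNIV :: nat set)"
  by (rule has_sum_reindex_bij_witness[of _ Suc "\<lambda>n. n - 1"]) auto

lemma nat_summable_on_atLeast1_iff:
  "f summable_on {1..} \<longleftrightarrow> (\<lambda>n. f (Suc n)) summable_on (UNIV :: nat set)"
  unfolding summable_on_def nat_has_sum_atLeast1_iff ..

abbreviation mangoldt_term :: "nat \<Rightarrow> complex \<Rightarrow> complex" where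
  "mangoldt_term n s \<equiv> of_real (mangoldt (Suc n)) * npow n s"

definition mangoldt_series :: "complex \<Rightarrow> complex" where
  "mangoldt_series s = (\<Sum>n. mangoldt_term n s)"

lemma mangoldt_powr_norm_summable:
  assumes "Re s > 1"
  shows "summable (\<lambda>n. norm (mangoldt_term n s :: complex))"
proof -
  have "(\<lambda>n. of_real (ln (real (Suc n))) * npow n (complex_of_real (Re s))) sums
      (- deriv zeta_series (of_real (Re s)))"
    using assms by (intro zeta_series_deriv_sums) simp
  hence "summable (\<lambda>n. Re (of_real (ln (real (Suc n))) * npow n (complex_of_real (Re s))))"
    by (intro summable_Re) (auto simp: sums_iff)
  also have "(\<lambda>n. Re (of_real (ln (real (Suc n))) * npow n (complex_of_real (Re s)))) =
     (\<lambda>n. ln (real (Suc n)) * real (Suc n) powr (- Re s))"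
  proof
    fix n
    have "npow n (complex_of_real (Re s)) = of_real (real (Suc n) powr (- Re s))"
      using powr_of_real[of "real (Suc n)" "- Re s"] by (simp del: of_nat_Suc)
    thus "Re (of_real (ln (real (Suc n))) * npow n (complex_of_real (Re s))) =
        ln (real (Suc n)) * real (Suc n) powr (- Re s)" by (simp del: of_nat_Suc)
  qed
  finally show ?thesis
  proof (rule summable_comparison_test[rotated])
    show "\<exists>N. \<forall>n\<ge>N. norm (norm (mangoldt_term n s :: complex))
        \<le> ln (real (Suc n)) * real (Suc n) powr (- Re s)"
    proof (intro exI[of _ 0] allI impI)
      fix n
      have "norm (norm (mangoldt_term n s :: complex)) =
         mangoldt (Suc n) * real (Suc n) powr (- Re s)"
        by (simp add: norm_mult norm_nat_powr mangoldt_nonneg del: of_nat_Suc)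
      also have "\<dots> \<le> ln (real (Suc n)) * real (Suc n) powr (- Re s)"
        by (intro mult_right_mono mangoldt_le) auto
      finally show "norm (norm (mangoldt_term n s :: complex))
        \<le> ln (real (Suc n)) * real (Suc n) powr (- Re s)" .
    qed
  qed
qed

lemma mangoldt_series_sums:
  assumes "Re s > 1"
  shows "(\<lambda>n. mangoldt_term n s) sums mangoldt_series s"
  unfolding mangoldt_series_def
  using mangoldt_powr_norm_summable[OF assms] by (rule summable_sums[OF summable_norm_cancel])

text \<open>
  The sum of the von Mangoldt function over the divisors of n is log n, so the Dirichlet product of the two
  series is the derived series of zeta.
\<close>
lemma zeta_mangoldt_product:
  assumes s: "Re s > 1"
  shows "mangoldt_series s * zeta_series s = - deriv zeta_series s"
proof -
  let ?A = "{1..} :: nat set"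
  define F where "F = (\<lambda>d. of_real (mangoldt d) * of_nat d powr (- s) :: complex)"
  define E where "E = (\<lambda>m. of_nat m powr (- s) :: complex)"
  have nE: "summable (\<lambda>n. norm (E (Suc n)))"
  proof -
    have "summable (\<lambda>n. real (Suc (n + 1)) powr (- 1 - (Re s - 1)))"
      using s by (intro powr_tail_bounds(1)) auto
    hence "summable (\<lambda>n. real (Suc n) powr (- Re s))"
      using summable_iff_shift[of "\<lambda>n. real (Suc n) powr (- Re s)" 1] by simp
    thus ?thesis unfolding E_def norm_nat_powr by simp
  qed
  have nF: "summable (\<lambda>n. norm (F (Suc n)))"
    unfolding F_def by (rule mangoldt_powr_norm_summable[OF s])
  have sF: "(\<lambda>n. F (Suc n)) sums mangoldt_series s"
    unfolding F_def by (rule mangoldt_series_sums[OF s])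
  have sE: "(\<lambda>n. E (Suc n)) sums zeta_series s"
    unfolding E_def by (rule zeta_series_sums[OF s])
  have F: "(F has_sum mangoldt_series s) ?A" "(\<lambda>x. norm (F x)) summable_on ?A"
    unfolding nat_has_sum_atLeast1_iff nat_summable_on_atLeast1_iff
    using norm_summable_imp_has_sum[OF nF sF]
      norm_summable_imp_summable_on[of "\<lambda>n. norm (F (Suc n))"] nF by auto
  have E: "(E has_sum zeta_series s) ?A" "(\<lambda>x. norm (E x)) summable_on ?A"
    unfolding nat_has_sum_atLeast1_iff nat_summable_on_atLeast1_iff
    using norm_summable_imp_has_sum[OF nE sE]
      norm_summable_imp_summable_on[of "\<lambda>n. norm (E (Suc n))"] nE by auto
  have "((\<lambda>(d,m). F d * E m) has_sum (mangoldt_series s * zeta_series s)) (?A \<times> ?A)"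
    by (rule has_sum_Times_mult[OF F E])
  \<comment> \<open>Sort the pairs (d, m) by their product n = dm.\<close>
  also have "?this \<longleftrightarrow> ((\<lambda>(n,d). F d * E (n div d)) has_sum (mangoldt_series s * zeta_series s))
       (Sigma ?A (\<lambda>n. {d. d dvd n}))"
  proof (rule has_sum_reindex_bij_witness[of _ "\<lambda>(n,d). (d, n div d)" "\<lambda>(d,m). (d * m, d)"])
  qed (auto simp: Suc_le_eq dvd_pos_nat intro!: Nat.gr0I elim!: dvdE)
  finally have "((\<lambda>n. \<Sum>d | d dvd n. F d * E (n div d)) has_sum (mangoldt_series s * zeta_series s)) ?A"
    by (rule has_sum_Sigma') (auto intro!: has_sum_finite finite_divisors_nat)
  hence "((\<lambda>n. \<Sum>d | d dvd Suc n. F d * E (Suc n div d)) has_sum (mangoldt_series s * zeta_series s)) UNIV"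
    unfolding nat_has_sum_atLeast1_iff .
  hence "(\<lambda>n. \<Sum>d | d dvd Suc n. F d * E (Suc n div d)) sums (mangoldt_series s * zeta_series s)"
    by (rule has_sum_imp_sums)
  also have "(\<lambda>n. \<Sum>d | d dvd Suc n. F d * E (Suc n div d)) =
      (\<lambda>n. of_real (ln (real (Suc n))) * npow n s)"
  proof
    fix n
    have "(\<Sum>d | d dvd Suc n. F d * E (Suc n div d)) =
       (\<Sum>d | d dvd Suc n. of_real (mangoldt d) * npow n s)"
    proof (intro sum.cong refl)
      fix d assume "d \<in> {d. d dvd Suc n}"
      then have d: "d dvd Suc n" by simp
      have "complex_of_nat d powr (- s) * of_nat (Suc n div d) powr (- s) =
          (of_nat d * of_nat (Suc n div d)) powr (- s)"
        by (rule powr_times_real_left[symmetric]) auto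
      also have "complex_of_nat d * of_nat (Suc n div d) = of_nat (Suc n)"
        using d by (metis dvd_mult_div_cancel of_nat_mult)
      finally show "F d * E (Suc n div d) = of_real (mangoldt d) * npow n s"
        by (simp add: F_def E_def mult.assoc)
    qed
    also have "\<dots> = of_real (\<Sum>d | d dvd Suc n. mangoldt d) * npow n s"
      by (simp add: sum_distrib_right)
    also have "(\<Sum>d | d dvd Suc n. mangoldt d) = ln (real (Suc n))"
      using mangoldt_sum[of "Suc n", where 'a = real] by (simp del: of_nat_Suc)
    finally show "(\<Sum>d | d dvd Suc n. F d * E (Suc n div d)) =
        of_real (ln (real (Suc n))) * npow n s" .
  qed
  finally show ?thesis using zeta_series_deriv_sums[OF s] sums_unique2 by blast
qed

text \<open>
  The logarithmic derivative of zeta is minus the series of the von Mangoldt function. The identity is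
  kept free of division, because it is also the reason why there are no zeros with Re s > 1.
\<close>
lemma pole_free_zeta_mangoldt:
  assumes s: "Re s > 1"
  shows "pole_free_zeta s * (mangoldt_series s - 1 / (s - 1)) = - deriv pole_free_zeta s"
proof -
  have s1: "s \<noteq> 1" using s by auto
  have op: "open {s. Re s > 1}" by (rule open_halfspace_Re_gt)
  have "(zeta_series has_field_derivative deriv zeta_series s) (at s)"
    using zeta_series_holomorphic op s by (metis holomorphic_derivI mem_Collect_eq)
  hence "((\<lambda>s. (s - 1) * zeta_series s) has_field_derivative
          (zeta_series s + (s - 1) * deriv zeta_series s)) (at s)"
    by (auto intro!: derivative_eq_intros)
  hence "(pole_free_zeta has_field_derivative (zeta_series s + (s - 1) * deriv zeta_series s)) (at s)"
    by (rule has_field_derivative_transform_within_open[OF _ op])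
       (use s pole_free_zeta_eq in auto)
  hence "deriv pole_free_zeta s = zeta_series s + (s - 1) * deriv zeta_series s"
    by (rule DERIV_imp_deriv)
  also have "deriv zeta_series s = - (mangoldt_series s * zeta_series s)"
    using zeta_mangoldt_product[OF s] by simp
  finally have d: "deriv pole_free_zeta s = zeta_series s + (s - 1) * - (mangoldt_series s * zeta_series s)" .
  have "(s - 1) * (mangoldt_series s - 1 / (s - 1)) = (s - 1) * mangoldt_series s - 1"
    using s1 by (simp add: right_diff_distrib)
  hence "pole_free_zeta s * (mangoldt_series s - 1 / (s - 1)) = ((s - 1) * mangoldt_series s - 1) * zeta_series s"
    unfolding pole_free_zeta_eq[OF s] by (metis mult.assoc mult.commute)
  thus ?thesis unfolding d by (simp add: algebra_simps)
qed

text \<open>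
  Approaching a point z horizontally from the right, the logarithmic derivative grows like m/e with m the
  order of vanishing at z. This is how zeros on the line Re s = 1 enter the inequality 3-4-1.
\<close>
lemma logderiv_at_right:
  fixes f :: "complex \<Rightarrow> complex"
  assumes hol: "f holomorphic_on S" "open S" "connected S" and z: "z \<in> S" and w: "w \<in> S" "f w \<noteq> 0"
  obtains m :: nat where "((\<lambda>e::real. of_real e * deriv f (z + of_real e) / f (z + of_real e)) \<longlongrightarrow> of_nat m) (at_right 0)"
     "f z = 0 \<Longrightarrow> m > 0" "f z \<noteq> 0 \<Longrightarrow> m = 0"
     "\<forall>\<^sub>F e in at_right 0. f (z + of_real e) \<noteq> 0"
proof -
  obtain g r m where gr: "0 < r" "ball z r \<subseteq> S" "g holomorphic_on ball z r"
    "\<And>w. w \<in> ball z r \<Longrightarrow> f w = (w - z) ^ m * g w" "\<And>w. w \<in> ball z r \<Longrightarrow> g w \<noteq> 0"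
    and m: "f z = 0 \<Longrightarrow> m > 0" "f z \<noteq> 0 \<Longrightarrow> m = (0::nat)"
  proof (cases "f z = 0")
    case True
    have "\<not> f constant_on S" using True z w by (metis constant_on_def)
    from holomorphic_factor_zero_nonconstant[OF hol z True this] show ?thesis
      using that True by metis
  next
    case False
    have "isCont f z" using hol z by (meson continuous_on_eq_continuous_at holomorphic_on_imp_continuous_on)
    then obtain r1 where r1: "r1 > 0" "\<And>w. dist z w < r1 \<Longrightarrow> f w \<noteq> 0"
      using continuous_at_avoid[of z f 0] False by blast
    obtain r2 where r2: "r2 > 0" "ball z r2 \<subseteq> S" using hol z open_contains_ball by blast
    show ?thesis
      by (rule that[of "min r1 r2" f 0])
         (use False r1 r2 hol in \<open>auto intro: holomorphic_on_subset simp: subset_iff\<close>)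
  qed
  have gz: "isCont g z" "g z \<noteq> 0"
    using gr by (auto intro: continuous_on_interior holomorphic_on_imp_continuous_on)
  have "deriv g holomorphic_on ball z r" using gr by (intro holomorphic_deriv) auto
  hence dgz: "isCont (deriv g) z"
    using gr by (auto intro: continuous_on_interior holomorphic_on_imp_continuous_on)
  have lz: "((\<lambda>e::real. z + of_real e) \<longlongrightarrow> z) (at_right 0)"
    by (auto intro!: tendsto_eq_intros)
  have "((\<lambda>e::real. of_nat m + of_real e * deriv g (z + of_real e) / g (z + of_real e)) \<longlongrightarrow>
      of_nat m + of_real 0 * deriv g z / g z) (at_right 0)"
    by (intro tendsto_intros isCont_tendsto_compose[OF gz(1) lz] isCont_tendsto_compose[OF dgz lz] gz)
  hence lim: "((\<lambda>e::real. of_nat m + of_real e * deriv g (z + of_real e) / g (z + of_real e)) \<longlongrightarrow> of_nat m) (at_right 0)"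
    by simp
  have ev: "\<forall>\<^sub>F e::real in at_right 0. e > 0 \<and> e < r"
    using gr(1) by (auto simp: eventually_at_right_field)
  have nz: "f (z + of_real e) \<noteq> 0" if "e > 0" "e < r" for e
    using gr that by (auto simp: dist_norm)
  have eq: "of_real e * deriv f (z + of_real e) / f (z + of_real e) =
        of_nat m + of_real e * deriv g (z + of_real e) / g (z + of_real e)" if e: "e > 0" "e < r" for e
  proof -
    let ?w = "z + of_real e"
    have wb: "?w \<in> ball z r" using e by (simp add: dist_norm)
    have "(g has_field_derivative deriv g ?w) (at ?w)"
      using gr wb by (metis holomorphic_derivI open_ball)
    hence "((\<lambda>w. (w - z) ^ m * g w) has_field_derivative
         (of_nat m * (?w - z) ^ (m - 1) * g ?w + (?w - z) ^ m * deriv g ?w)) (at ?w)"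
      by (auto intro!: derivative_eq_intros)
    hence "(f has_field_derivative
         (of_nat m * (?w - z) ^ (m - 1) * g ?w + (?w - z) ^ m * deriv g ?w)) (at ?w)"
      by (rule has_field_derivative_transform_within_open[OF _ open_ball wb]) (use gr in auto)
    hence d: "deriv f ?w = of_nat m * of_real e ^ (m - 1) * g ?w + of_real e ^ m * deriv g ?w"
      by (simp add: DERIV_imp_deriv)
    have f: "f ?w = of_real e ^ m * g ?w" using gr(4)[OF wb] by simp
    have p: "of_real e * (of_nat m * of_real e ^ (m - 1)) = (of_nat m * of_real e ^ m :: complex)"
      by (cases m) auto
    have "of_real e * deriv f ?w = of_nat m * of_real e ^ m * g ?w + of_real e * (of_real e ^ m * deriv g ?w)"
      unfolding d distrib_left by (metis p mult.assoc)
    thus ?thesis unfolding f using e gr(5)[OF wb] by (simp add: field_simps)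
  qed
  show ?thesis
  proof (rule that)
    show "((\<lambda>e::real. of_real e * deriv f (z + of_real e) / f (z + of_real e)) \<longlongrightarrow> of_nat m) (at_right 0)"
      by (rule Lim_transform_eventually[OF lim]) (use ev eq in \<open>auto elim!: eventually_mono\<close>)
    show "\<forall>\<^sub>F e in at_right 0. f (z + of_real e) \<noteq> 0"
      by (rule eventually_mono[OF ev]) (use nz in auto)
  qed (use m in auto)
qed

section \<open>Non-vanishing on the line of real part one\<close>

lemma right_half_plane_connected: "connected {s :: complex. Re s > 0}"
  by (intro convex_connected convex_halfspace_Re_gt)

lemma norm_mangoldt_series_le:
  assumes "Re z > 1" "Re s \<ge> Re z"
  shows "norm (mangoldt_series s) \<le> (\<Sum>n. norm (mangoldt_term n z :: complex))"
  unfolding mangoldt_series_def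
proof (rule norm_suminf_le)
  fix n
  show "norm (mangoldt_term n s :: complex) \<le>
        norm (mangoldt_term n z :: complex)"
    unfolding norm_mult norm_nat_powr
    using assms by (intro mult_left_mono powr_mono) (auto simp: mangoldt_nonneg)
qed (rule mangoldt_powr_norm_summable[OF assms(1)])

text \<open>
  A zero would make the logarithmic derivative unbounded, but it equals a function bounded in terms of the
  absolutely convergent von Mangoldt series.
\<close>
lemma pole_free_zeta_nonzero_right:
  assumes z: "Re z > 1"
  shows "pole_free_zeta z \<noteq> 0"
proof
  assume zero: "pole_free_zeta z = 0"
  let ?H = pole_free_zeta
  obtain m where m: "((\<lambda>e::real. of_real e * deriv ?H (z + of_real e) / ?H (z + of_real e)) \<longlongrightarrow> of_nat m) (at_right 0)"
     "m > 0" "\<forall>\<^sub>F e in at_right 0. ?H (z + of_real e) \<noteq> 0"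
    using logderiv_at_right[OF pole_free_zeta_holomorphic open_halfspace_Re_gt right_half_plane_connected, of z 1]
      zero z pole_free_zeta_1 by auto
  define K where "K = (\<Sum>n. norm (mangoldt_term n z :: complex)) + 1 / (Re z - 1)"
  have "((\<lambda>e::real. of_real e * deriv ?H (z + of_real e) / ?H (z + of_real e)) \<longlongrightarrow> 0) (at_right 0)"
  proof (rule Lim_null_comparison)
    have "\<forall>\<^sub>F e::real in at_right 0. e > 0" by (auto simp: eventually_at_right_field intro: exI[of _ 1])
    with m(3) show "\<forall>\<^sub>F e in at_right 0. norm (of_real e * deriv ?H (z + of_real e) / ?H (z + of_real e)) \<le> e * K"
    proof eventually_elim
      case (elim e)
      let ?s = "z + of_real e"
      have "Re ?s > 1" using z elim by simp
      from pole_free_zeta_mangoldt[OF this] have "deriv ?H ?s = - (?H ?s * (mangoldt_series ?s - 1 / (?s - 1)))"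
        by (metis add.inverse_inverse)
      hence "of_real e * deriv ?H ?s / ?H ?s = - of_real e * (mangoldt_series ?s - 1 / (?s - 1))"
        using elim by simp
      hence "norm (of_real e * deriv ?H ?s / ?H ?s) = e * norm (mangoldt_series ?s - 1 / (?s - 1))"
        using elim by (simp add: norm_mult)
      also have "\<dots> \<le> e * K"
      proof (rule mult_left_mono)
        have "norm (1 / (?s - 1)) \<le> 1 / (Re z - 1)"
        proof -
          have "Re z - 1 \<le> Re (?s - 1)" using elim by simp
          also have "\<dots> \<le> norm (?s - 1)" by (rule complex_Re_le_cmod)
          finally show ?thesis using z by (auto simp: norm_divide intro!: divide_left_mono mult_pos_pos)
        qed
        moreover have "norm (mangoldt_series ?s) \<le> (\<Sum>n. norm (mangoldt_term n z :: complex))"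
          using elim by (intro norm_mangoldt_series_le z) simp
        ultimately show "norm (mangoldt_series ?s - 1 / (?s - 1)) \<le> K"
          unfolding K_def using norm_triangle_ineq4[of "mangoldt_series ?s" "1 / (?s - 1)"] by linarith
      qed (use elim in auto)
      finally show ?case .
    qed
    show "((\<lambda>e::real. e * K) \<longlongrightarrow> 0) (at_right 0)" by (auto intro!: tendsto_eq_intros)
  qed
  hence "(of_nat m :: complex) = 0" using m(1) by (intro tendsto_unique[of "at_right (0::real)"]) auto
  thus False using m(2) by simp
qed

text \<open>
  Because 3 + 4 cos x + cos 2x = 2 (1 + cos x)^2.
\<close>
lemma three_four_one:
  assumes \<sigma>: "\<sigma> > 1"
  shows "3 * Re (mangoldt_series (of_real \<sigma>)) + 4 * Re (mangoldt_series (of_real \<sigma> + \<i> * of_real t))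
     + Re (mangoldt_series (of_real \<sigma> + \<i> * of_real (2 * t))) \<ge> 0"
proof -
  have re: "(\<lambda>n. mangoldt (Suc n) * (real (Suc n) powr (- \<sigma>) * cos (\<tau> * ln (real (Suc n))))) sums
       Re (mangoldt_series (of_real \<sigma> + \<i> * of_real \<tau>))" for \<tau>
  proof -
    have "(\<lambda>n. mangoldt_term n (of_real \<sigma> + \<i> * of_real \<tau>)) sums
       mangoldt_series (of_real \<sigma> + \<i> * of_real \<tau>)"
      using \<sigma> by (intro mangoldt_series_sums) simp
    hence "(\<lambda>n. Re (mangoldt_term n (of_real \<sigma> + \<i> * of_real \<tau>))) sums
       Re (mangoldt_series (of_real \<sigma> + \<i> * of_real \<tau>))" by (rule sums_Re)
    also have "(\<lambda>n. Re (mangoldt_term n (of_real \<sigma> + \<i> * of_real \<tau>))) =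
      (\<lambda>n. mangoldt (Suc n) * (real (Suc n) powr (- \<sigma>) * cos (\<tau> * ln (real (Suc n)))))"
    proof
      fix n
      have "npow n (of_real \<sigma> + \<i> * of_real \<tau>) =
         exp (- (of_real \<sigma> + \<i> * of_real \<tau>) * of_real (ln (real (Suc n))))"
        unfolding powr_def using Ln_of_nat[of "Suc n"] by (simp del: of_nat_Suc)
      hence "Re (npow n (of_real \<sigma> + \<i> * of_real \<tau>)) =
           exp (- \<sigma> * ln (real (Suc n))) * cos (\<tau> * ln (real (Suc n)))"
        by (simp add: Re_exp del: of_nat_Suc)
      also have "exp (- \<sigma> * ln (real (Suc n))) = real (Suc n) powr (- \<sigma>)"
        by (simp add: powr_def)
      finally show "Re (mangoldt_term n (of_real \<sigma> + \<i> * of_real \<tau>))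
        = mangoldt (Suc n) * (real (Suc n) powr (- \<sigma>) * cos (\<tau> * ln (real (Suc n))))"
        by (simp del: of_nat_Suc of_real_mangoldt)
    qed
    finally show ?thesis .
  qed
  have "(\<lambda>n. 3 * (mangoldt (Suc n) * (real (Suc n) powr (- \<sigma>) * cos (0 * ln (real (Suc n))))) +
      4 * (mangoldt (Suc n) * (real (Suc n) powr (- \<sigma>) * cos (t * ln (real (Suc n))))) +
      mangoldt (Suc n) * (real (Suc n) powr (- \<sigma>) * cos (2 * t * ln (real (Suc n))))) sums
     (3 * Re (mangoldt_series (of_real \<sigma> + \<i> * of_real 0)) + 4 * Re (mangoldt_series (of_real \<sigma> + \<i> * of_real t))
     + Re (mangoldt_series (of_real \<sigma> + \<i> * of_real (2 * t))))"
    by (intro sums_add sums_mult re)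
  moreover have "0 \<le> 3 * (mangoldt (Suc n) * (real (Suc n) powr (- \<sigma>) * cos (0 * ln (real (Suc n))))) +
      4 * (mangoldt (Suc n) * (real (Suc n) powr (- \<sigma>) * cos (t * ln (real (Suc n))))) +
      mangoldt (Suc n) * (real (Suc n) powr (- \<sigma>) * cos (2 * t * ln (real (Suc n))))" for n
  proof -
    let ?x = "t * ln (real (Suc n))"
    have c: "cos (2 * t * ln (real (Suc n))) = 2 * (cos ?x)\<^sup>2 - 1"
      using cos_double_cos[of ?x] by (simp only: mult.assoc)
    have "3 * (mangoldt (Suc n) * (real (Suc n) powr (- \<sigma>) * cos (0 * ln (real (Suc n))))) +
      4 * (mangoldt (Suc n) * (real (Suc n) powr (- \<sigma>) * cos (t * ln (real (Suc n))))) +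
      mangoldt (Suc n) * (real (Suc n) powr (- \<sigma>) * cos (2 * t * ln (real (Suc n)))) =
      mangoldt (Suc n) * (real (Suc n) powr (- \<sigma>) * (2 * (1 + cos ?x)\<^sup>2))"
      unfolding c by (simp add: algebra_simps power2_eq_square del: of_nat_Suc)
    also have "\<dots> \<ge> 0" by (intro mult_nonneg_nonneg mangoldt_nonneg) auto
    finally show ?thesis .
  qed
  ultimately show ?thesis
    using sums_le[of "\<lambda>_. 0 :: real", OF _ sums_zero] by force
qed

text \<open>
  Multiplying the inequality 3-4-1 at 1 + e by e and letting e tend to 0 gives 3 - 4 m1 - m2 \<ge> 0, where m1
  and m2 are the orders of vanishing at 1 + it and 1 + 2it. Hence m1 = 0.
\<close>
lemma pole_free_zeta_nonzero_line:
  "pole_free_zeta (1 + \<i> * of_real t) \<noteq> 0"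
proof
  assume zero: "pole_free_zeta (1 + \<i> * of_real t) = 0"
  let ?H = pole_free_zeta
  have t: "t \<noteq> 0" using zero pole_free_zeta_1 by auto
  note L = logderiv_at_right[OF pole_free_zeta_holomorphic open_halfspace_Re_gt right_half_plane_connected, of _ 1]
  let ?D = "\<lambda>\<tau> e::real. of_real e * deriv ?H (1 + \<i> * of_real \<tau> + of_real e) / ?H (1 + \<i> * of_real \<tau> + of_real e)"
  obtain m0 where m0: "(?D 0 \<longlongrightarrow> of_nat m0) (at_right 0)" "m0 = 0"
    using L[of "1 + \<i> * of_real 0"] pole_free_zeta_1 by auto
  obtain m1 where m1: "(?D t \<longlongrightarrow> of_nat m1) (at_right 0)" "m1 > 0"
    using L[of "1 + \<i> * of_real t"] pole_free_zeta_1 zero by auto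
  obtain m2 where m2: "(?D (2 * t) \<longlongrightarrow> of_nat m2) (at_right 0)"
    using L[of "1 + \<i> * of_real (2 * t)"] pole_free_zeta_1 by auto
  have ev: "\<forall>\<^sub>F e::real in at_right 0. e > 0" by (auto simp: eventually_at_right_field intro: exI[of _ 1])
  have M: "of_real e * mangoldt_series (of_real (1 + e) + \<i> * of_real \<tau>) =
       of_real e / (of_real e + \<i> * of_real \<tau>) - ?D \<tau> e" if "e > 0" for e \<tau>
  proof -
    let ?s = "1 + \<i> * of_real \<tau> + of_real e"
    have s: "Re ?s > 1" using that by simp
    have "mangoldt_series ?s - 1 / (?s - 1) = - deriv ?H ?s / ?H ?s"
      using pole_free_zeta_mangoldt[OF s] pole_free_zeta_nonzero_right[OF s]
      by (metis nonzero_mult_div_cancel_left)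
    hence "mangoldt_series ?s = 1 / (of_real e + \<i> * of_real \<tau>) - deriv ?H ?s / ?H ?s"
      by (simp add: algebra_simps)
    hence "of_real e * mangoldt_series ?s = of_real e / (of_real e + \<i> * of_real \<tau>) - ?D \<tau> e"
      by (simp only: right_diff_distrib times_divide_eq_right mult_1_right)
    moreover have eq: "of_real (1 + e) + \<i> * of_real \<tau> = ?s" by simp
    ultimately show ?thesis unfolding eq by simp
  qed
  have lim: "((\<lambda>e. Re (of_real e * mangoldt_series (of_real (1 + e) + \<i> * of_real \<tau>))) \<longlongrightarrow> Re (c - d)) (at_right 0)"
    if "(?D \<tau> \<longlongrightarrow> d) (at_right 0)" "((\<lambda>e::real. of_real e / (of_real e + \<i> * of_real \<tau>)) \<longlongrightarrow> c) (at_right 0)" for \<tau> c d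
  proof (rule tendsto_Re, rule Lim_transform_eventually)
    show "((\<lambda>e. of_real e / (of_real e + \<i> * of_real \<tau>) - ?D \<tau> e) \<longlongrightarrow> c - d) (at_right 0)"
      by (intro tendsto_diff that)
    show "\<forall>\<^sub>F e in at_right 0. of_real e / (of_real e + \<i> * of_real \<tau>) - ?D \<tau> e =
        of_real e * mangoldt_series (of_real (1 + e) + \<i> * of_real \<tau>)"
      using ev by eventually_elim (simp only: M)
  qed
  have c0: "((\<lambda>e::real. of_real e / (of_real e + \<i> * of_real 0)) \<longlongrightarrow> (1::complex)) (at_right 0)"
    by (rule Lim_transform_eventually[OF tendsto_const]) (use ev in eventually_elim, simp)
  have c1: "((\<lambda>e::real. of_real e / (of_real e + \<i> * of_real \<tau>)) \<longlongrightarrow> (0::complex)) (at_right 0)" if "\<tau> \<noteq> 0" for \<tau>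
    using that by (auto intro!: tendsto_eq_intros)
  have "((\<lambda>e. 3 * Re (of_real e * mangoldt_series (of_real (1 + e) + \<i> * of_real 0)) +
      4 * Re (of_real e * mangoldt_series (of_real (1 + e) + \<i> * of_real t)) +
      Re (of_real e * mangoldt_series (of_real (1 + e) + \<i> * of_real (2 * t)))) \<longlongrightarrow>
      3 * Re (1 - of_nat m0) + 4 * Re (0 - of_nat m1) + Re (0 - of_nat m2)) (at_right 0)"
    using t by (intro tendsto_add tendsto_mult tendsto_const lim m0 m1 m2 c0 c1) auto
  hence "3 * Re (1 - of_nat m0) + 4 * Re (0 - of_nat m1) + Re (0 - of_nat m2) \<ge> 0"
  proof (rule tendsto_lowerbound)
    show "\<forall>\<^sub>F e in at_right 0. 0 \<le> 3 * Re (of_real e * mangoldt_series (of_real (1 + e) + \<i> * of_real 0)) +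
      4 * Re (of_real e * mangoldt_series (of_real (1 + e) + \<i> * of_real t)) +
      Re (of_real e * mangoldt_series (of_real (1 + e) + \<i> * of_real (2 * t)))"
      using ev
    proof eventually_elim
      case (elim e)
      have "0 \<le> e * (3 * Re (mangoldt_series (of_real (1 + e))) + 4 * Re (mangoldt_series (of_real (1 + e) + \<i> * of_real t))
     + Re (mangoldt_series (of_real (1 + e) + \<i> * of_real (2 * t))))"
        using elim three_four_one[of "1 + e" t] by (intro mult_nonneg_nonneg) auto
      thus ?case by (simp add: algebra_simps)
    qed
  qed auto
  thus False using m0 m1 by simp
qed

lemma pole_free_zeta_nonzero: "Re s \<ge> 1 \<Longrightarrow> pole_free_zeta s \<noteq> 0"
  using pole_free_zeta_nonzero_right[of s] pole_free_zeta_nonzero_line[of "Im s"] complex_eq[of s]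
  by (cases "Re s = 1") auto

section \<open>Chebyshev's bound\<close>

definition chebyshev_psi :: "nat \<Rightarrow> real" where
  "chebyshev_psi n = (\<Sum>m=1..n. mangoldt m)"

lemma chebyshev_psi_0: "chebyshev_psi 0 = 0"
  by (simp add: chebyshev_psi_def)

lemma chebyshev_psi_Suc: "chebyshev_psi (Suc n) = chebyshev_psi n + mangoldt (Suc n)"
  by (simp add: chebyshev_psi_def)

lemma mono_chebyshev_psi: "mono chebyshev_psi"
  by (rule incseq_SucI) (simp add: chebyshev_psi_Suc mangoldt_nonneg)

lemma chebyshev_psi_nonneg: "chebyshev_psi n \<ge> 0"
  by (auto simp: chebyshev_psi_def intro!: sum_nonneg mangoldt_nonneg)

text \<open>
  Both sides grow by log (n + 1), the divisor sum of the von Mangoldt function, from n to n + 1.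
\<close>
lemma ln_fact_eq_sum_mangoldt:
  "ln (fact n) = (\<Sum>d=1..n. mangoldt d * real (n div d))"
proof (induction n)
  case (Suc n)
  have "(\<Sum>d=1..Suc n. mangoldt d * real (Suc n div d)) =
      (\<Sum>d=1..Suc n. mangoldt d * real (n div d) + (if d dvd Suc n then mangoldt d else 0))"
    by (intro sum.cong refl) (auto simp: div_Suc dvd_eq_mod_eq_0 algebra_simps)
  also have "\<dots> = (\<Sum>d=1..Suc n. mangoldt d * real (n div d)) +
       (\<Sum>d=1..Suc n. if d dvd Suc n then mangoldt d else 0)" by (rule sum.distrib)
  also have "(\<Sum>d=1..Suc n. if d dvd Suc n then mangoldt d else 0) = (\<Sum>d | d dvd Suc n. mangoldt d)"
  proof -
    have "{d. d dvd Suc n} = {d \<in> {1..Suc n}. d dvd Suc n}"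
      by (auto dest: dvd_imp_le intro!: Nat.gr0I simp: Suc_le_eq)
    thus ?thesis by (simp only: sum.inter_filter[OF finite_atLeastAtMost])
  qed
  also have "\<dots> = ln (real (Suc n))"
    using mangoldt_sum[of "Suc n", where 'a = real] by (simp del: of_nat_Suc)
  also have "(\<Sum>d=1..Suc n. mangoldt d * real (n div d)) = ln (fact n)"
    using Suc by simp
  also have "ln (fact n) + ln (real (Suc n)) = ln (fact (Suc n))"
    by (simp add: ln_mult fact_Suc del: of_nat_Suc)
  finally show ?case ..
qed auto

text \<open>
  Every integer d in (n, 2n] occurs with coefficient 1 in the expansion of the logarithm of the central
  binomial coefficient, and no coefficient is negative.
\<close>
lemma chebyshev_psi_double: "chebyshev_psi (2 * n) \<le> chebyshev_psi n + real n * ln 4"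
proof -
  have "chebyshev_psi (2 * n) - chebyshev_psi n = (\<Sum>d\<in>{n+1..2*n}. mangoldt d)"
  proof -
    have "{1..2*n} = {1..n} \<union> {n+1..2*n}" by auto
    thus ?thesis unfolding chebyshev_psi_def by (simp add: sum.union_disjoint)
  qed
  also have "\<dots> = (\<Sum>d\<in>{n+1..2*n}. mangoldt d * (real (2 * n div d) - 2 * real (n div d)))"
  proof (intro sum.cong refl)
    fix d assume d: "d \<in> {n+1..2*n}"
    have "2 * n div d = 1" using d by (intro div_nat_eqI) auto
    thus "mangoldt d = mangoldt d * (real (2 * n div d) - 2 * real (n div d))" using d by simp
  qed
  also have "\<dots> \<le> (\<Sum>d\<in>{1..2*n}. mangoldt d * (real (2 * n div d) - 2 * real (n div d)))"
  proof (rule sum_mono2)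
    fix d assume "d \<in> {1..2*n} - {n+1..2*n}"
    hence "d > 0" by auto
    moreover have "n div d * d \<le> n" by (rule div_times_less_eq_dividend)
    ultimately have "2 * (n div d) \<le> 2 * n div d"
      by (simp add: less_eq_div_iff_mult_less_eq)
    hence "2 * real (n div d) \<le> real (2 * n div d)" by (metis of_nat_le_iff of_nat_mult of_nat_numeral)
    thus "0 \<le> mangoldt d * (real (2 * n div d) - 2 * real (n div d))"
      by (intro mult_nonneg_nonneg mangoldt_nonneg) auto
  qed auto
  also have "\<dots> = (\<Sum>d\<in>{1..2*n}. mangoldt d * real (2 * n div d)) - 2 * (\<Sum>d\<in>{1..2*n}. mangoldt d * real (n div d))"
    by (simp add: algebra_simps sum_subtractf sum_distrib_left)
  also have "(\<Sum>d\<in>{1..2*n}. mangoldt d * real (n div d)) = (\<Sum>d\<in>{1..n}. mangoldt d * real (n div d))"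
    by (rule sum.mono_neutral_right) auto
  also have "(\<Sum>d\<in>{1..2*n}. mangoldt d * real (2 * n div d)) - 2 * \<dots> = ln (fact (2 * n)) - 2 * ln (fact n)"
    by (simp only: ln_fact_eq_sum_mangoldt)
  also have "\<dots> = ln (real (2 * n choose n))"
    using binomial_fact[of n "2 * n", where 'a = real] by (simp add: ln_div ln_mult)
  also have "\<dots> \<le> ln (4 ^ n)"
  proof -
    have "2 * n choose n \<le> (\<Sum>k\<le>2*n. 2 * n choose k)" by (intro member_le_sum) auto
    also have "\<dots> = 2 ^ (2 * n)" by (rule choose_row_sum)
    also have "\<dots> = 4 ^ n" by (simp add: power_mult)
    finally have "real (2 * n choose n) \<le> 4 ^ n" by (metis of_nat_le_iff of_nat_numeral of_nat_power)
    thus ?thesis by (subst ln_le_cancel_iff) (auto simp: zero_less_binomial)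
  qed
  also have "\<dots> = real n * ln 4" by (simp add: ln_realpow)
  finally show ?thesis by simp
qed

lemma chebyshev_psi_le: "chebyshev_psi n \<le> 4 * real n"
proof (induction n rule: less_induct)
  case (less n)
  have ln4: "ln (4::real) \<le> 2"
  proof -
    have "ln (4::real) = ln (2 ^ 2)" by simp
    also have "\<dots> = 2 * ln 2" by (subst ln_realpow) auto
    finally show ?thesis using ln_2_less_1 by simp
  qed
  define m where "m = n div 2"
  show ?case
  proof (cases "n = 0")
    case True thus ?thesis by (simp add: chebyshev_psi_0)
  next
    case False
    hence m: "m < n" by (simp add: m_def)
    have 1: "chebyshev_psi (2 * m) \<le> 4 * real m + real m * 2"
      using chebyshev_psi_double[of m] less[OF m] mult_left_mono[OF ln4, of "real m"] by simp
    show ?thesis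
    proof (cases "even n")
      case True
      thus ?thesis using 1 by (simp add: m_def)
    next
      case False
      hence n: "n = Suc (2 * m)" by (simp add: m_def)
      have "mangoldt n \<le> ln (real n)" using n by (intro mangoldt_le) auto
      also have "\<dots> \<le> real n - 1" using n by (intro ln_le_minus_one) auto
      finally show ?thesis using 1 chebyshev_psi_Suc[of "2 * m"] n by simp
    qed
  qed
qed

section \<open>The prime number theorem\<close>

abbreviation psi_error :: "nat \<Rightarrow> real" where
  "psi_error n \<equiv> chebyshev_psi n - real n"

text \<open>
  Summation by parts; the boundary terms vanish in the limit by Chebyshev's bound.
\<close>
lemma mangoldt_minus_zeta_sums:
  assumes s: "Re s > 1"
  shows "(\<lambda>n. of_real (psi_error (Suc n)) *
           (npow n s - npow (Suc n) s)) sums (mangoldt_series s - zeta_series s)"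
proof -
  define c where "c = (\<lambda>N. chebyshev_psi N - real N)"
  define x where "x = (\<lambda>n. npow n s)"
  have part: "(\<Sum>n<N. of_real (c (Suc n)) * (x n - x (Suc n))) =
      (\<Sum>n<N. of_real (mangoldt (Suc n)) * x n - x n) - of_real (c N) * x N" for N
  proof (induction N)
    case (Suc N)
    have "c (Suc N) = c N + mangoldt (Suc N) - 1" by (simp add: c_def chebyshev_psi_Suc)
    hence "complex_of_real (c (Suc N)) = of_real (c N) + of_real (mangoldt (Suc N)) - 1"
      by (simp only: of_real_add of_real_diff of_real_1)
    hence eq: "of_real (c (Suc N)) * x N = of_real (c N) * x N + of_real (mangoldt (Suc N)) * x N - x N"
      by (simp only: distrib_right left_diff_distrib mult_1_left)
    show ?case unfolding sum.lessThan_Suc Suc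
      right_diff_distrib[of "complex_of_real (c (Suc N))" "x N" "x (Suc N)"] eq by simp
  qed (simp add: c_def chebyshev_psi_0)
  have "(\<lambda>n. of_real (mangoldt (Suc n)) * x n - x n) sums (mangoldt_series s - zeta_series s)"
    unfolding x_def by (intro sums_diff mangoldt_series_sums zeta_series_sums s)
  hence 1: "(\<lambda>N. \<Sum>n<N. of_real (mangoldt (Suc n)) * x n - x n) \<longlonglongrightarrow> mangoldt_series s - zeta_series s"
    by (simp add: sums_def)
  have 2: "(\<lambda>N. of_real (c N) * x N) \<longlonglongrightarrow> 0"
  proof (rule Lim_null_comparison)
    show "\<forall>\<^sub>F N in sequentially. norm (of_real (c N) * x N) \<le> 4 * real (Suc N) powr (1 - Re s)"
    proof (intro always_eventually allI)
      fix N
      have "\<bar>c N\<bar> \<le> 4 * real (Suc N)"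
        using chebyshev_psi_nonneg[of N] chebyshev_psi_le[of N] by (auto simp: c_def)
      hence "norm (of_real (c N) * x N) \<le> 4 * real (Suc N) * real (Suc N) powr (- Re s)"
        unfolding x_def norm_mult norm_nat_powr by (intro mult_mono) auto
      also have "\<dots> = 4 * real (Suc N) powr (1 - Re s)"
        by (simp add: powr_diff powr_minus field_simps)
      finally show "norm (of_real (c N) * x N) \<le> 4 * real (Suc N) powr (1 - Re s)" .
    qed
    have "filterlim (\<lambda>N. real (Suc N)) at_top sequentially"
      by (intro filterlim_compose[OF filterlim_real_sequentially] filterlim_Suc)
    hence "(\<lambda>N. real (Suc N) powr (1 - Re s)) \<longlonglongrightarrow> 0"
      using s by (intro tendsto_neg_powr) auto
    thus "(\<lambda>N. 4 * real (Suc N) powr (1 - Re s)) \<longlonglongrightarrow> 0"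
      using tendsto_mult_right_zero by blast
  qed
  show ?thesis
    using tendsto_diff[OF 1 2] unfolding sums_def part[symmetric] by (simp add: c_def x_def)
qed

text \<open>
  One power of n is gained from the gap and one is lost to the error of psi, so the series converges
  locally uniformly for Re s > 0.
\<close>
lemma psi_error_gap_series:
  defines "f \<equiv> (\<lambda>n s. of_real (psi_error (Suc n)) * zeta_gap n (s + 1))"
  shows "\<And>s. Re s > 0 \<Longrightarrow> (\<lambda>n. f n s) sums (\<Sum>n. f n s)"
    and "(\<lambda>s. \<Sum>n. f n s) holomorphic_on {s. Re s > 0}"
proof -
  have h: "f n holomorphic_on {s. Re s > 0}" for n
    unfolding f_def zeta_gap_def by (intro holomorphic_intros)
  have b: "norm (f n s) \<le> (4 * (norm s * (norm s + 1))) * real (Suc n) powr (0 - 1 - Re s)"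
    if s: "Re s > 0" for n s
  proof -
    have c: "\<bar>psi_error (Suc n)\<bar> \<le> 4 * real (Suc n)"
      using chebyshev_psi_nonneg[of "Suc n"] chebyshev_psi_le[of "Suc n"] by auto
    have "norm (zeta_gap n (s + 1)) \<le> norm (s + 1 - 1) * norm (s + 1) * real (Suc n) powr (- 1 - Re (s + 1))"
      using s by (intro norm_zeta_gap_le) auto
    also have "\<dots> \<le> (norm s * (norm s + 1)) * real (Suc n) powr (- 1 - Re (s + 1))"
      using norm_triangle_ineq[of s 1] by (intro mult_right_mono mult_mono) auto
    finally have g: "norm (zeta_gap n (s + 1)) \<le> (norm s * (norm s + 1)) * real (Suc n) powr (- 1 - Re (s + 1))" .
    have "norm (f n s) = \<bar>psi_error (Suc n)\<bar> * norm (zeta_gap n (s + 1))"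
      unfolding f_def norm_mult norm_of_real ..
    also have "\<dots> \<le> (4 * real (Suc n)) * ((norm s * (norm s + 1)) * real (Suc n) powr (- 1 - Re (s + 1)))"
      using c g by (intro mult_mono) auto
    also have "\<dots> = (4 * (norm s * (norm s + 1))) * (real (Suc n) powr 1 * real (Suc n) powr (- 1 - Re (s + 1)))"
      by (simp add: mult_ac del: of_nat_Suc)
    also have "real (Suc n) powr 1 * real (Suc n) powr (- 1 - Re (s + 1)) = real (Suc n) powr (0 - 1 - Re s)"
      unfolding powr_add[symmetric] by simp
    finally show ?thesis .
  qed
  have m: "mono_on {0..} (\<lambda>r::real. 4 * (r * (r + 1)))"
    by (intro mono_onI mult_mono) auto
  note T = holomorphic_suminf_powr_bound[of f 0 "\<lambda>r. 4 * (r * (r + 1))", OF h b m]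
  show "(\<lambda>n. f n s) sums (\<Sum>n. f n s)" if "Re s > 0" for s
    by (rule T(1)) (use that in simp_all)
  show "(\<lambda>s. \<Sum>n. f n s) holomorphic_on {s. Re s > 0}"
    by (rule T(2)) simp_all
qed

text \<open>
  The Dirichlet series with the bounded coefficients (psi(m) - m)/m is not a familiar function, but s
  times it is the sum of the series in \<open>mangoldt_minus_zeta_sums\<close> and in \<open>psi_error_gap_series\<close>. The
  first of these equals -H'/H - (H - 1)/(s - 1) for H(s) = (s - 1) zeta(s), which is holomorphic wherever
  H does not vanish, since H(1) = 1.
\<close>
lemma psi_error_summable:
  "summable (\<lambda>n. psi_error (Suc n) / real (Suc n) ^ 2)"
proof -
  let ?H = pole_free_zeta
  define a where "a = (\<lambda>n. complex_of_real (psi_error (Suc n) / real (Suc n)))"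
  define X where "X = (\<lambda>s. \<Sum>n. of_real (psi_error (Suc n)) * zeta_gap n (s + 1))"
  define Q where "Q = (\<lambda>s. if s = 1 then deriv ?H 1 else (?H s - ?H 1) / (s - 1))"
  define G where "G = (\<lambda>s. (X s - deriv ?H s / ?H s - Q s) / s)"
  define R where "R = {s :: complex. Re s > 0}"
  define S where "S = {s \<in> R. ?H s \<noteq> 0}"
  have oR: "open R" unfolding R_def by (rule open_halfspace_Re_gt)
  note Hh = pole_free_zeta_holomorphic[folded R_def]
  have SR: "S \<subseteq> R" by (auto simp: S_def)
  have "open (R \<inter> ?H -` (- {0}))"
    by (intro continuous_open_preimage holomorphic_on_imp_continuous_on Hh oR) auto
  also have "R \<inter> ?H -` (- {0}) = S" by (auto simp: S_def)
  finally have S: "open S" .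
  have Ssup: "{s. Re s \<ge> 1} \<subseteq> S" using pole_free_zeta_nonzero by (auto simp: S_def R_def)
  have Q: "Q holomorphic_on R" unfolding Q_def
    using oR by (intro pole_lemma Hh) (auto simp: interior_open R_def)
  have X: "X holomorphic_on R" unfolding X_def R_def by (rule psi_error_gap_series(2))
  have G: "G holomorphic_on S" unfolding G_def
    by (intro holomorphic_intros holomorphic_on_subset[OF X SR] holomorphic_on_subset[OF Q SR]
         holomorphic_on_subset[OF Hh SR] holomorphic_deriv[OF _ S]) (auto simp: S_def R_def)
  have bd: "norm (a n) \<le> 4" for n
  proof -
    have c: "\<bar>psi_error (Suc n)\<bar> \<le> 4 * real (Suc n)"
      using chebyshev_psi_nonneg[of "Suc n"] chebyshev_psi_le[of "Suc n"] by auto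
    have "norm (a n) = \<bar>psi_error (Suc n)\<bar> / real (Suc n)"
      unfolding a_def norm_of_real by simp
    also have "\<dots> \<le> 4" using c by (simp add: divide_le_eq)
    finally show ?thesis .
  qed
  have sums: "(\<lambda>n. a n * npow n s) sums G s" if s: "Re s > 1" for s
  proof -
    have s0: "s \<noteq> 0" "s \<noteq> 1" using s by auto
    have nz: "?H s \<noteq> 0" using s by (intro pole_free_zeta_nonzero) auto
    have "mangoldt_series s - 1 / (s - 1) = - deriv ?H s / ?H s"
      using pole_free_zeta_mangoldt[OF s] nz by (metis nonzero_mult_div_cancel_left)
    moreover have "zeta_series s = ?H s / (s - 1)" using pole_free_zeta_eq[OF s] s0 by simp
    ultimately have MZ: "mangoldt_series s - zeta_series s = - deriv ?H s / ?H s - Q s"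
      using s0 by (simp add: Q_def pole_free_zeta_1 diff_divide_distrib algebra_simps)
    have "(\<lambda>n. (of_real (psi_error (Suc n)) * zeta_gap n (s + 1) +
       of_real (psi_error (Suc n)) *
           (npow n s - npow (Suc n) s)) / s) sums
       ((X s + (mangoldt_series s - zeta_series s)) / s)"
      unfolding X_def using s
      by (intro sums_divide sums_add mangoldt_minus_zeta_sums psi_error_gap_series(1)) auto
    also have "(X s + (mangoldt_series s - zeta_series s)) / s = G s"
      unfolding MZ G_def by simp
    also have "(\<lambda>n. (of_real (psi_error (Suc n)) * zeta_gap n (s + 1) +
       of_real (psi_error (Suc n)) *
           (npow n s - npow (Suc n) s)) / s) =
        (\<lambda>n. a n * npow n s)"
    proof
      fix n
      define c where "c = complex_of_real (psi_error (Suc n))"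
      define w where "w = complex_of_nat (Suc n)"
      have w: "w \<noteq> 0" by (simp add: w_def del: of_nat_Suc)
      have "w powr (- (s + 1)) = w powr (- s + (- 1))" by simp
      also have "\<dots> = w powr (- s) * w powr (- 1)" by (rule powr_add)
      also have "w powr (- 1) = 1 / w" using w by (simp add: powr_minus divide_inverse)
      finally have p: "w powr (- (s + 1)) = w powr (- s) / w" by simp
      have g: "zeta_gap n (s + 1) = s * w powr (- (s + 1)) - w powr (- s) + npow (Suc n) s"
        by (simp add: zeta_gap_def w_def)
      have "(c * zeta_gap n (s + 1) + c * (w powr (- s) - npow (Suc n) s)) / s =
           c * w powr (- (s + 1))"
        unfolding g using s0 by (simp add: field_simps)
      also have "\<dots> = c / w * w powr (- s)" unfolding p by simp
      also have "c / w = a n" by (simp add: c_def w_def a_def)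
      finally show "(of_real (psi_error (Suc n)) * zeta_gap n (s + 1) +
       of_real (psi_error (Suc n)) *
           (npow n s - npow (Suc n) s)) / s = a n * npow n s"
        by (simp only: c_def w_def)
    qed
    finally show ?thesis .
  qed
  have "(\<lambda>n. a n / of_nat (Suc n)) sums G 1"
    by (rule newman_tauberian[OF bd S Ssup G sums])
  hence "summable (\<lambda>n. Re (a n / of_nat (Suc n)))" by (intro summable_Re) (auto simp: sums_iff)
  also have "(\<lambda>n. Re (a n / of_nat (Suc n))) = (\<lambda>n. psi_error (Suc n) / real (Suc n) ^ 2)"
  proof
    fix n
    have "a n / of_nat (Suc n) = complex_of_real (psi_error (Suc n) / real (Suc n) ^ 2)"
      unfolding a_def by (simp add: power2_eq_square del: of_nat_Suc)
    thus "Re (a n / of_nat (Suc n)) = psi_error (Suc n) / real (Suc n) ^ 2"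
      by (simp only: Re_complex_of_real)
  qed
  finally show ?thesis .
qed

text \<open>
  If f(n) exceeds (1 + e) n, monotonicity keeps f(m) - m above en/2 for all m up to (1 + e/2) n, so that
  a block of the series has a sum bounded below in terms of e, against Cauchy's criterion. If f(n) is
  below (1 - e) n the same happens on a block to the left of n.
\<close>
lemma mono_summable_error_imp_asymp:
  fixes f :: "nat \<Rightarrow> real"
  assumes mono: "mono f" and summ: "summable (\<lambda>n. (f (Suc n) - real (Suc n)) / real (Suc n) ^ 2)"
  shows "(\<lambda>n. f n / real n) \<longlonglongrightarrow> 1"
proof (rule tendstoI)
  fix e0 :: real assume e0: "e0 > 0"
  define e where "e = min e0 1 / 2"
  have e: "e > 0" "e \<le> 1 / 2" "e < e0" using e0 by (auto simp: e_def)
  define g where "g = (\<lambda>n. (f (Suc n) - real (Suc n)) / real (Suc n) ^ 2)"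
  have "\<exists>N. \<forall>m\<ge>N. \<forall>n. norm (sum g {m..<n}) < e ^ 2 / 32"
    using summ[folded g_def, unfolded summable_Cauchy, rule_format, of "e ^ 2 / 32"] e(1) by simp
  then obtain N where N: "\<And>m n. m \<ge> N \<Longrightarrow> \<bar>sum g {m..<n}\<bar> < e ^ 2 / 32" by auto
  have "\<forall>\<^sub>F n in sequentially. real n \<ge> max (4 / e) (2 * (real N + 1))"
    by (rule eventually_sequentiallyI[of "nat \<lceil>max (4 / e) (2 * (real N + 1))\<rceil>"]) linarith
  thus "\<forall>\<^sub>F n in sequentially. dist (f n / real n) 1 < e0"
  proof eventually_elim
    case (elim n)
    have n: "real n \<ge> 4 / e" "real n \<ge> 2 * (real N + 1)" using elim by auto
    have en: "e * real n \<ge> 4" using n(1) e by (simp add: field_simps)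
    have n0: "real n > 0" using n(2) by (cases n) auto
    define q where "q = nat \<lfloor>e * real n / 2\<rfloor>"
    have q: "real q \<le> e * real n / 2" "real q \<ge> e * real n / 4"
      using en unfolding q_def by linarith+
    have qn: "real q \<le> real n / 4" using q(1) e(2) n0 mult_right_mono[of e "1/2" "real n"] by linarith
    have up: "f n \<le> (1 + e) * real n"
    proof (rule ccontr)
      assume "\<not> f n \<le> (1 + e) * real n"
      hence big: "f n > (1 + e) * real n" by simp
      have "real q * (e / (8 * real n)) \<le> sum g {n..<n+q}"
      proof -
        have "g k \<ge> e / (8 * real n)" if k: "k \<in> {n..<n+q}" for k
        proof -
          have k1: "real (Suc k) \<le> real n + e * real n / 2" "real (Suc k) \<ge> real n"
            using k q(1) by auto
          have "f (Suc k) \<ge> f n" using mono k by (auto simp: mono_def)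
          hence a: "f (Suc k) - real (Suc k) \<ge> e * real n / 2" using big k1 by (simp add: algebra_simps)
          have "e * real n / 2 \<ge> 0" using e n0 by simp
          with a have a0: "f (Suc k) - real (Suc k) \<ge> 0" by linarith
          have "real (Suc k) \<le> 2 * real n" using k1 q qn e n0 mult_right_mono[of e "1/2" "real n"] by linarith
          hence b: "real (Suc k) ^ 2 \<le> 4 * real n ^ 2"
            using power_mono[of "real (Suc k)" "2 * real n" 2] by (simp add: power_mult_distrib)
          have "e / (8 * real n) = (e * real n / 2) / (4 * real n ^ 2)"
            using n0 by (simp add: power2_eq_square field_simps)
          also have "\<dots> \<le> (f (Suc k) - real (Suc k)) / real (Suc k) ^ 2"
            using a b a0 by (intro frac_le) auto
          finally show ?thesis by (simp add: g_def)
        qed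
        thus ?thesis using sum_mono[of "{n..<n+q}" "\<lambda>_. e / (8 * real n)" g] by simp
      qed
      moreover have "sum g {n..<n+q} < e ^ 2 / 32" using N[of n "n + q"] n by auto
      moreover have "real q * (e / (8 * real n)) \<ge> (e * real n / 4) * (e / (8 * real n))"
        using q(2) e n0 by (intro mult_right_mono) auto
      moreover have "(e * real n / 4) * (e / (8 * real n)) = e ^ 2 / 32"
        using n0 by (simp add: power2_eq_square)
      ultimately show False by linarith
    qed
    have lo: "f n \<ge> (1 - e) * real n"
    proof (rule ccontr)
      assume "\<not> f n \<ge> (1 - e) * real n"
      hence small: "f n < (1 - e) * real n" by simp
      have qn': "q \<le> n" using qn n0 by linarith
      have "sum g {n-q..<n} \<le> real q * (- (e / (2 * real n)))"
      proof -
        have "g k \<le> - (e / (2 * real n))" if k: "k \<in> {n-q..<n}" for k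
        proof -
          have k1: "real (Suc k) \<ge> real n - e * real n / 2" "real (Suc k) \<le> real n"
            using k q(1) qn' by auto
          have "f (Suc k) \<le> f n" using mono k by (auto simp: mono_def)
          hence a: "real (Suc k) - f (Suc k) \<ge> e * real n / 2" using small k1 by (simp add: algebra_simps)
          have "e * real n / 2 \<ge> 0" using e n0 by simp
          with a have a0: "real (Suc k) - f (Suc k) \<ge> 0" by linarith
          have b: "real (Suc k) ^ 2 \<le> real n ^ 2"
            using power_mono[OF k1(2), of 2] by simp
          have "e / (2 * real n) = (e * real n / 2) / (real n ^ 2)"
            using n0 by (simp add: power2_eq_square field_simps)
          also have "\<dots> \<le> (real (Suc k) - f (Suc k)) / real (Suc k) ^ 2"
            using a b a0 by (intro frac_le) auto
          also have "\<dots> = - g k" by (simp add: g_def diff_divide_distrib)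
          finally show ?thesis by simp
        qed
        thus ?thesis using sum_mono[of "{n-q..<n}" g "\<lambda>_. - (e / (2 * real n))"] qn' by simp
      qed
      moreover have "\<bar>sum g {n-q..<n}\<bar> < e ^ 2 / 32"
      proof (rule N)
        have "real N \<le> real (n - q)" using qn n qn' by (simp add: of_nat_diff)
        thus "n - q \<ge> N" by simp
      qed
      moreover have "real q * (e / (2 * real n)) \<ge> (e * real n / 4) * (e / (2 * real n))"
        using q(2) e n0 by (intro mult_right_mono) auto
      moreover have "(e * real n / 4) * (e / (2 * real n)) = e ^ 2 / 8"
        using n0 by (simp add: power2_eq_square)
      moreover have "e ^ 2 > 0" using e by simp
      ultimately show False by linarith
    qed
    have "f n / real n \<le> 1 + e" "f n / real n \<ge> 1 - e"
      using up lo n0 by (simp_all add: field_simps)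
    thus ?case using e by (simp add: dist_real_def abs_le_iff abs_less_iff)
  qed
qed

theorem chebyshev_psi_asymp: "(\<lambda>n. chebyshev_psi n / real n) \<longlonglongrightarrow> 1"
  by (rule mono_summable_error_imp_asymp[OF mono_chebyshev_psi psi_error_summable])

definition prime_count :: "real \<Rightarrow> nat" where
  "prime_count x = card {p. prime p \<and> real p \<le> x}"

lemma finite_primes_real_le: "finite {p::nat. prime p \<and> real p \<le> x}"
proof (rule finite_subset)
  show "{p::nat. prime p \<and> real p \<le> x} \<subseteq> {..nat \<lfloor>x\<rfloor>}" by (auto simp: le_nat_floor)
qed auto

text \<open>
  The powers of one prime p up to n contribute at most log n to psi(n).
\<close>
lemma chebyshev_psi_le_prime_count:
  assumes "n \<ge> 1"
  shows "chebyshev_psi n \<le> real (prime_count (real n)) * ln (real n)"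
proof -
  define P where "P = {p::nat. prime p \<and> real p \<le> real n}"
  have fP: "finite P" unfolding P_def by (rule finite_primes_real_le)
  define A where "A = {m\<in>{1..n}. primepow m}"
  have "chebyshev_psi n = (\<Sum>m\<in>A. mangoldt m)"
    unfolding chebyshev_psi_def A_def by (intro sum.mono_neutral_right) (auto simp: mangoldt_def)
  also have "\<dots> = (\<Sum>p\<in>P. \<Sum>m\<in>{m\<in>A. aprimedivisor m = p}. mangoldt m)"
  proof (rule sum.group[symmetric])
    show "aprimedivisor ` A \<subseteq> P"
    proof safe
      fix m assume m: "m \<in> A"
      hence "m \<noteq> 1" "m > 0" "m \<le> n" by (auto simp: A_def)
      moreover have "prime (aprimedivisor m)" using calculation by (intro prime_aprimedivisor') auto
      moreover have "aprimedivisor m dvd m" using calculation by (intro aprimedivisor_dvd') auto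
      ultimately show "aprimedivisor m \<in> P" unfolding P_def by (auto dest!: dvd_imp_le)
    qed
  qed (use fP in \<open>auto simp: A_def\<close>)
  also have "\<dots> \<le> (\<Sum>p\<in>P. ln (real n))"
  proof (rule sum_mono)
    fix p assume p: "p \<in> P"
    hence pp: "prime p" "p \<le> n" by (auto simp: P_def)
    have p1: "real p > 1" using prime_gt_1_nat[OF pp(1)] by simp
    define K where "K = nat \<lfloor>ln (real n) / ln (real p)\<rfloor>"
    have sub: "{m\<in>A. aprimedivisor m = p} \<subseteq> (\<lambda>k. p ^ k) ` {1..K}"
    proof
      fix m assume "m \<in> {m\<in>A. aprimedivisor m = p}"
      hence m: "primepow m" "aprimedivisor m = p" "m \<le> n" by (auto simp: A_def)
      obtain q k where qk: "prime q" "k > 0" "m = q ^ k" using m(1) by (auto simp: primepow_def)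
      have "q = p" using qk m(2) by (simp add: aprimedivisor_prime_power)
      hence mk: "m = p ^ k" using qk by simp
      have "0 < real m" using mk p1 by simp
      hence "ln (real m) \<le> ln (real n)" using m(3) by simp
      hence "real k * ln (real p) \<le> ln (real n)" using p1 by (simp add: mk ln_realpow)
      hence "real k \<le> ln (real n) / ln (real p)" using p1 by (simp add: field_simps)
      hence "k \<le> K" unfolding K_def by linarith
      thus "m \<in> (\<lambda>k. p ^ k) ` {1..K}" using mk qk by auto
    qed
    have card: "card {m\<in>A. aprimedivisor m = p} \<le> K"
      using card_mono[OF _ sub] card_image_le[of "{1..K}" "\<lambda>k. p ^ k"] by simp
    have "(\<Sum>m\<in>{m\<in>A. aprimedivisor m = p}. mangoldt m) = (\<Sum>m\<in>{m\<in>A. aprimedivisor m = p}. ln (real p))"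
      by (intro sum.cong refl) (auto simp: mangoldt_def A_def)
    also have "\<dots> = real (card {m\<in>A. aprimedivisor m = p}) * ln (real p)" by simp
    also have "\<dots> \<le> real K * ln (real p)" using card p1 by (intro mult_right_mono) auto
    also have "\<dots> \<le> (ln (real n) / ln (real p)) * ln (real p)"
    proof (rule mult_right_mono)
      have "ln (real n) / ln (real p) \<ge> 0" using assms p1 by simp
      thus "real K \<le> ln (real n) / ln (real p)" unfolding K_def by linarith
    qed (use p1 in auto)
    also have "\<dots> = ln (real n)" using p1 by simp
    finally show "(\<Sum>m\<in>{m\<in>A. aprimedivisor m = p}. mangoldt m) \<le> ln (real n)" .
  qed
  also have "\<dots> = real (prime_count (real n)) * ln (real n)" by (simp add: P_def prime_count_def)
  finally show ?thesis .
qed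

lemma prime_count_le_chebyshev_psi:
  assumes y: "y > 1" "y \<le> real n"
  shows "real (prime_count (real n)) \<le> y + chebyshev_psi n / ln y"
proof -
  define A where "A = {p::nat. prime p \<and> y < real p \<and> p \<le> n}"
  have fA: "finite A" by (rule finite_subset[of _ "{..n}"]) (auto simp: A_def)
  have sub: "{p::nat. prime p \<and> real p \<le> real n} \<subseteq> {1..nat \<lfloor>y\<rfloor>} \<union> A"
  proof
    fix p assume p: "p \<in> {p::nat. prime p \<and> real p \<le> real n}"
    show "p \<in> {1..nat \<lfloor>y\<rfloor>} \<union> A"
    proof (cases "real p \<le> y")
      case True
      thus ?thesis using p prime_gt_0_nat[of p] by (auto intro: le_nat_floor)
    qed (use p in \<open>auto simp: A_def\<close>)
  qed
  have "prime_count (real n) \<le> card ({1..nat \<lfloor>y\<rfloor>} \<union> A)"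
    unfolding prime_count_def by (intro card_mono sub) (use fA in auto)
  also have "\<dots> \<le> nat \<lfloor>y\<rfloor> + card A" using card_Un_le[of "{1..nat \<lfloor>y\<rfloor>}" A] by simp
  finally have 1: "real (prime_count (real n)) \<le> y + real (card A)" using y by linarith
  have "real (card A) * ln y = (\<Sum>p\<in>A. ln y)" by simp
  also have "\<dots> \<le> (\<Sum>p\<in>A. mangoldt p)"
    using y by (intro sum_mono) (auto simp: A_def)
  also have "\<dots> \<le> chebyshev_psi n" unfolding chebyshev_psi_def
    by (intro sum_mono2) (auto simp: A_def mangoldt_nonneg Suc_le_eq prime_gt_0_nat)
  finally have "real (card A) \<le> chebyshev_psi n / ln y" using y by (simp add: field_simps)
  with 1 show ?thesis by simp
qed

text \<open>
  The two inequalities between the number of primes and psi are applied with y = n / (log n)^2, which is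
  negligible against n / log n while log y is asymptotic to log n.
\<close>
theorem prime_number_theorem_nat: "(\<lambda>n. real (prime_count (real n)) * ln (real n) / real n) \<longlonglongrightarrow> 1"
proof (rule tendsto_sandwich)
  show "(\<lambda>n. chebyshev_psi n / real n) \<longlonglongrightarrow> 1" by (rule chebyshev_psi_asymp)
  show "\<forall>\<^sub>F n in sequentially. chebyshev_psi n / real n \<le> real (prime_count (real n)) * ln (real n) / real n"
    using eventually_ge_at_top[of 1]
    by eventually_elim (intro divide_right_mono chebyshev_psi_le_prime_count, auto)
  let ?u = "\<lambda>n::nat. 1 / ln (real n) + chebyshev_psi n / real n * (ln (real n) / ln (real n / ln (real n) ^ 2))"
  have "(\<lambda>n::nat. 1 / ln (real n)) \<longlonglongrightarrow> 0" by real_asymp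
  moreover have "(\<lambda>n::nat. ln (real n) / ln (real n / ln (real n) ^ 2)) \<longlonglongrightarrow> 1" by real_asymp
  ultimately have "?u \<longlonglongrightarrow> 0 + 1 * 1" by (intro tendsto_add tendsto_mult chebyshev_psi_asymp)
  thus "?u \<longlonglongrightarrow> 1" by simp
  have "\<forall>\<^sub>F n::nat in sequentially. real n / ln (real n) ^ 2 > 1" by real_asymp
  moreover have "\<forall>\<^sub>F n::nat in sequentially. real n / ln (real n) ^ 2 \<le> real n" by real_asymp
  ultimately show "\<forall>\<^sub>F n in sequentially. real (prime_count (real n)) * ln (real n) / real n \<le> ?u n"
    using eventually_ge_at_top[of 2]
  proof eventually_elim
    case (elim n)
    let ?y = "real n / ln (real n) ^ 2"
    have l: "ln (real n) > 0" using elim by simp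
    have "real (prime_count (real n)) * ln (real n) / real n \<le> (?y + chebyshev_psi n / ln ?y) * ln (real n) / real n"
      using elim l by (intro divide_right_mono mult_right_mono prime_count_le_chebyshev_psi) auto
    also have "\<dots> = ?u n" using elim l by (simp add: field_simps power2_eq_square)
    finally show ?case .
  qed
qed

section \<open>Sums over primes\<close>

text \<open>
  Used in place of partial summation with integrals: it turns the asymptotics of the prime counting
  function into those of its weighted sums.
\<close>
lemma stolz_cesaro:
  fixes x y :: "nat \<Rightarrow> real"
  assumes inc: "\<forall>\<^sub>F n in sequentially. y n < y (Suc n)" and top: "filterlim y at_top sequentially"
    and lim: "(\<lambda>n. (x (Suc n) - x n) / (y (Suc n) - y n)) \<longlonglongrightarrow> L"
  shows "(\<lambda>n. x n / y n) \<longlonglongrightarrow> L"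
proof (rule tendstoI)
  fix e :: real assume e: "e > 0"
  have "\<forall>\<^sub>F n in sequentially. dist ((x (Suc n) - x n) / (y (Suc n) - y n)) L < e / 2"
    using lim e by (intro tendstoD) auto
  with inc have "\<forall>\<^sub>F n in sequentially. y n < y (Suc n) \<and>
      \<bar>x (Suc n) - x n - L * (y (Suc n) - y n)\<bar> \<le> e / 2 * (y (Suc n) - y n)"
  proof eventually_elim
    case (elim n)
    have "x (Suc n) - x n - L * (y (Suc n) - y n) = ((x (Suc n) - x n) / (y (Suc n) - y n) - L) * (y (Suc n) - y n)"
      using elim by (simp add: field_simps)
    hence "\<bar>x (Suc n) - x n - L * (y (Suc n) - y n)\<bar> = \<bar>(x (Suc n) - x n) / (y (Suc n) - y n) - L\<bar> * (y (Suc n) - y n)"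
      using elim by (simp add: abs_mult)
    also have "\<dots> \<le> e / 2 * (y (Suc n) - y n)"
      using elim by (intro mult_right_mono) (auto simp: dist_real_def)
    finally show ?case using elim by simp
  qed
  then obtain N where N: "\<And>n. n \<ge> N \<Longrightarrow> y n < y (Suc n)"
    "\<And>n. n \<ge> N \<Longrightarrow> \<bar>x (Suc n) - x n - L * (y (Suc n) - y n)\<bar> \<le> e / 2 * (y (Suc n) - y n)"
    by (auto simp: eventually_sequentially)
  have bound: "\<bar>x n - L * y n - (x N - L * y N)\<bar> \<le> e / 2 * (y n - y N)" if "n \<ge> N" for n
    using that
  proof (induction n rule: dec_induct)
    case (step n)
    have "x (Suc n) - L * y (Suc n) - (x N - L * y N) =
        (x n - L * y n - (x N - L * y N)) + (x (Suc n) - x n - L * (y (Suc n) - y n))"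
      by (simp add: algebra_simps)
    hence "\<bar>x (Suc n) - L * y (Suc n) - (x N - L * y N)\<bar> \<le>
        \<bar>x n - L * y n - (x N - L * y N)\<bar> + \<bar>x (Suc n) - x n - L * (y (Suc n) - y n)\<bar>"
      by (simp only: abs_triangle_ineq)
    also have "\<dots> \<le> e / 2 * (y n - y N) + e / 2 * (y (Suc n) - y n)"
      using step N(2)[of n] by (intro add_mono) auto
    also have "\<dots> = e / 2 * (y (Suc n) - y N)" by (simp only: distrib_left[symmetric]) simp
    finally show ?case .
  qed auto
  define M where "M = \<bar>x N - L * y N\<bar> + e / 2 * \<bar>y N\<bar>"
  have "\<forall>\<^sub>F n in sequentially. y n > max 1 (4 * M / e)"
    using top unfolding filterlim_at_top_dense by blast
  thus "\<forall>\<^sub>F n in sequentially. dist (x n / y n) L < e"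
    using eventually_ge_at_top[of N]
  proof eventually_elim
    case (elim n)
    have yn: "y n > 0" "y n > 4 * M / e" using elim by auto
    have "\<bar>x n - L * y n\<bar> \<le> \<bar>x N - L * y N\<bar> + e / 2 * (y n - y N)"
      using bound[OF elim(2)] by linarith
    also have "\<dots> \<le> M + e / 2 * y n"
    proof -
      have "e / 2 * (- y N) \<le> e / 2 * \<bar>y N\<bar>" using e by (intro mult_left_mono) auto
      thus ?thesis by (simp add: M_def right_diff_distrib)
    qed
    also have "M < e / 4 * y n" using yn e by (simp add: field_simps)
    finally have "\<bar>x n - L * y n\<bar> < 3 / 4 * e * y n" by simp
    moreover have "x n / y n - L = (x n - L * y n) / y n" using yn by (simp add: field_simps)
    ultimately have "\<bar>x n / y n - L\<bar> < 3 / 4 * e" using yn by (simp add: abs_divide pos_divide_less_eq)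
    thus ?case using e by (simp add: dist_real_def)
  qed
qed

definition prime_power_sum :: "nat \<Rightarrow> nat \<Rightarrow> real" where
  "prime_power_sum j N = (\<Sum>p | prime p \<and> p \<le> N. real p ^ j)"

lemma primes_le_Suc:
  "{p::nat. prime p \<and> p \<le> Suc N} = (if prime (Suc N) then insert (Suc N) {p. prime p \<and> p \<le> N} else {p. prime p \<and> p \<le> N})"
  by (auto simp: le_Suc_eq)

lemma prime_power_sum_0: "prime_power_sum j 0 = 0"
proof -
  have "{p::nat. prime p \<and> p \<le> 0} = {}" by auto
  thus ?thesis unfolding prime_power_sum_def by (simp only: sum.empty)
qed

lemma prime_power_sum_Suc:
  "prime_power_sum j (Suc N) = prime_power_sum j N + (if prime (Suc N) then real (Suc N) ^ j else 0)"
  unfolding prime_power_sum_def primes_le_Suc by auto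

abbreviation prime_pi :: "nat \<Rightarrow> real" where "prime_pi \<equiv> prime_power_sum 0"

lemma prime_count_eq: "real (prime_count (real n)) = prime_pi n"
  by (simp add: prime_count_def prime_power_sum_def)

lemma prime_number_theorem: "(\<lambda>n. prime_pi n * ln (real n) / real n) \<longlonglongrightarrow> 1"
  using prime_number_theorem_nat by (simp only: prime_count_eq)

lemma prime_power_sum_Suc_pi:
  "prime_power_sum j (Suc N) - prime_power_sum j N = real (Suc N) ^ j * (prime_pi (Suc N) - prime_pi N)"
  by (simp add: prime_power_sum_Suc)

lemma prime_sum_by_parts:
  "prime_power_sum 1 N = real N * prime_pi N - (\<Sum>m<N. prime_pi m)"
proof (induction N)
  case (Suc N)
  thus ?case using prime_power_sum_Suc_pi[of 1 N] by (simp add: algebra_simps)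
qed (simp add: prime_power_sum_0)

lemma prime_square_sum_by_parts:
  "prime_power_sum 2 N = real N ^ 2 * prime_pi N - (\<Sum>m<N. (2 * real m + 1) * prime_pi m)"
proof (induction N)
  case (Suc N)
  thus ?case using prime_power_sum_Suc_pi[of 2 N] by (simp add: algebra_simps power2_eq_square)
qed (simp add: prime_power_sum_0)

lemma prime_sum_asymp: "(\<lambda>n. prime_power_sum 1 n * ln (real n) / real n ^ 2) \<longlonglongrightarrow> 1 / 2"
proof -
  let ?y = "\<lambda>n::nat. real n ^ 2 / ln (real n)"
  have "(\<lambda>n. (\<Sum>m<n. prime_pi m) / ?y n) \<longlonglongrightarrow> 1 * (1 / 2)"
  proof (rule stolz_cesaro)
    show "\<forall>\<^sub>F n in sequentially. ?y n < ?y (Suc n)" unfolding of_nat_Suc by real_asymp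
    show "filterlim ?y at_top sequentially" by real_asymp
    have "(\<lambda>n::nat. (real n / ln (real n)) / (?y (Suc n) - ?y n)) \<longlonglongrightarrow> 1 / 2"
      unfolding of_nat_Suc by real_asymp
    from tendsto_mult[OF prime_number_theorem this]
    show "(\<lambda>n. ((\<Sum>m<Suc n. prime_pi m) - (\<Sum>m<n. prime_pi m)) / (?y (Suc n) - ?y n)) \<longlonglongrightarrow> 1 * (1 / 2)"
    proof (rule Lim_transform_eventually)
      show "\<forall>\<^sub>F n in sequentially. prime_pi n * ln (real n) / real n * ((real n / ln (real n)) / (?y (Suc n) - ?y n)) =
         ((\<Sum>m<Suc n. prime_pi m) - (\<Sum>m<n. prime_pi m)) / (?y (Suc n) - ?y n)"
        using eventually_ge_at_top[of 2] by eventually_elim simp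
    qed
  qed
  from tendsto_diff[OF prime_number_theorem this]
  have "(\<lambda>n. prime_pi n * ln (real n) / real n - (\<Sum>m<n. prime_pi m) / ?y n) \<longlonglongrightarrow> 1 / 2" by simp
  thus ?thesis
  proof (rule Lim_transform_eventually)
    show "\<forall>\<^sub>F n in sequentially. prime_pi n * ln (real n) / real n - (\<Sum>m<n. prime_pi m) / ?y n =
       prime_power_sum 1 n * ln (real n) / real n ^ 2"
      using eventually_ge_at_top[of 2]
      by eventually_elim (simp only: prime_sum_by_parts, simp add: field_simps power2_eq_square)
  qed
qed

lemma prime_square_sum_asymp: "(\<lambda>n. prime_power_sum 2 n * ln (real n) / real n ^ 3) \<longlonglongrightarrow> 1 / 3"
proof -
  let ?y = "\<lambda>n::nat. real n ^ 3 / ln (real n)"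
  have "(\<lambda>n. (\<Sum>m<n. (2 * real m + 1) * prime_pi m) / ?y n) \<longlonglongrightarrow> 1 * (2 / 3)"
  proof (rule stolz_cesaro)
    show "\<forall>\<^sub>F n in sequentially. ?y n < ?y (Suc n)" unfolding of_nat_Suc by real_asymp
    show "filterlim ?y at_top sequentially" by real_asymp
    have "(\<lambda>n::nat. (real n * (2 * real n + 1) / ln (real n)) / (?y (Suc n) - ?y n)) \<longlonglongrightarrow> 2 / 3"
      unfolding of_nat_Suc by real_asymp
    from tendsto_mult[OF prime_number_theorem this]
    show "(\<lambda>n. ((\<Sum>m<Suc n. (2 * real m + 1) * prime_pi m) - (\<Sum>m<n. (2 * real m + 1) * prime_pi m)) / (?y (Suc n) - ?y n)) \<longlonglongrightarrow> 1 * (2 / 3)"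
    proof (rule Lim_transform_eventually)
      show "\<forall>\<^sub>F n in sequentially. prime_pi n * ln (real n) / real n * ((real n * (2 * real n + 1) / ln (real n)) / (?y (Suc n) - ?y n)) =
         ((\<Sum>m<Suc n. (2 * real m + 1) * prime_pi m) - (\<Sum>m<n. (2 * real m + 1) * prime_pi m)) / (?y (Suc n) - ?y n)"
        using eventually_ge_at_top[of 2] by eventually_elim simp
    qed
  qed
  from tendsto_diff[OF prime_number_theorem this]
  have "(\<lambda>n. prime_pi n * ln (real n) / real n - (\<Sum>m<n. (2 * real m + 1) * prime_pi m) / ?y n) \<longlonglongrightarrow> 1 / 3" by simp
  thus ?thesis
  proof (rule Lim_transform_eventually)
    show "\<forall>\<^sub>F n in sequentially. prime_pi n * ln (real n) / real n - (\<Sum>m<n. (2 * real m + 1) * prime_pi m) / ?y n =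
       prime_power_sum 2 n * ln (real n) / real n ^ 3"
      using eventually_ge_at_top[of 2]
      by eventually_elim (simp only: prime_square_sum_by_parts, simp add: field_simps power2_eq_square power3_eq_cube)
  qed
qed

lemma linear_growth:
  fixes f :: "nat \<Rightarrow> nat"
  assumes f: "(\<lambda>n. real (f n) / real n) \<longlonglongrightarrow> c" and c: "c > 0"
  shows "filterlim f at_top sequentially" "(\<lambda>n. ln (real n) / ln (real (f n))) \<longlonglongrightarrow> 1"
    "\<forall>\<^sub>F n in sequentially. f n \<ge> 2"
proof -
  have top: "filterlim (\<lambda>n. real (f n)) at_top sequentially"
  proof (rule filterlim_at_top_mono)
    show "filterlim (\<lambda>n::nat. c / 2 * real n) at_top sequentially" using c by real_asymp
    have "\<forall>\<^sub>F n in sequentially. real (f n) / real n > c / 2" using f c by (intro order_tendstoD) auto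
    thus "\<forall>\<^sub>F n in sequentially. c / 2 * real n \<le> real (f n)"
      using eventually_gt_at_top[of 0] by eventually_elim (simp add: field_simps)
  qed
  thus ft: "filterlim f at_top sequentially" using filterlim_sequentially_iff_filterlim_real by blast
  show ge2: "\<forall>\<^sub>F n in sequentially. f n \<ge> 2" using ft by (simp add: filterlim_at_top)
  have "(\<lambda>n. ln (real (f n) / real n)) \<longlonglongrightarrow> ln c" using c by (intro tendsto_ln f) auto
  moreover have "filterlim (\<lambda>n::nat. ln (real n)) at_infinity sequentially"
    by (rule filterlim_at_top_imp_at_infinity) real_asymp
  ultimately have "(\<lambda>n. ln (real (f n) / real n) / ln (real n)) \<longlonglongrightarrow> 0" by (rule tendsto_divide_0)
  hence "(\<lambda>n. 1 / (1 + ln (real (f n) / real n) / ln (real n))) \<longlonglongrightarrow> 1 / (1 + 0)"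
    by (intro tendsto_intros) auto
  hence "(\<lambda>n. 1 / (1 + ln (real (f n) / real n) / ln (real n))) \<longlonglongrightarrow> 1" by simp
  thus "(\<lambda>n. ln (real n) / ln (real (f n))) \<longlonglongrightarrow> 1"
  proof (rule Lim_transform_eventually)
    show "\<forall>\<^sub>F n in sequentially. 1 / (1 + ln (real (f n) / real n) / ln (real n)) = ln (real n) / ln (real (f n))"
      using ge2 eventually_ge_at_top[of 2]
    proof eventually_elim
      case (elim n)
      have l: "ln (real n) > 0" "ln (real (f n)) > 0" using elim by auto
      have "1 + ln (real (f n) / real n) / ln (real n) = ln (real (f n)) / ln (real n)"
        using elim l by (simp add: ln_div field_simps)
      thus ?case using l by simp
    qed
  qed
qed

lemma prime_sum_scaled:
  fixes f :: "nat \<Rightarrow> nat"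
  assumes f: "(\<lambda>n. real (f n) / real n) \<longlonglongrightarrow> c" and c: "c > 0"
  shows "(\<lambda>n. prime_power_sum 1 (f n) * ln (real n) / real n ^ 2) \<longlonglongrightarrow> c ^ 2 / 2"
    and "(\<lambda>n. prime_power_sum 2 (f n) * ln (real n) / real n ^ 3) \<longlonglongrightarrow> c ^ 3 / 3"
proof -
  note g = linear_growth[OF f c]
  have ev: "\<forall>\<^sub>F n in sequentially. f n \<ge> 2 \<and> n \<ge> 2" using g(3) eventually_ge_at_top[of 2] by eventually_elim auto
  have "(\<lambda>n. prime_power_sum 1 (f n) * ln (real (f n)) / real (f n) ^ 2 * (real (f n) / real n) ^ 2 * (ln (real n) / ln (real (f n))))
     \<longlonglongrightarrow> 1 / 2 * c ^ 2 * 1"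
    by (intro tendsto_mult filterlim_compose[OF prime_sum_asymp g(1)] tendsto_power f g(2))
  hence "(\<lambda>n. prime_power_sum 1 (f n) * ln (real (f n)) / real (f n) ^ 2 * (real (f n) / real n) ^ 2 * (ln (real n) / ln (real (f n))))
     \<longlonglongrightarrow> c ^ 2 / 2" by simp
  thus "(\<lambda>n. prime_power_sum 1 (f n) * ln (real n) / real n ^ 2) \<longlonglongrightarrow> c ^ 2 / 2"
    by (rule Lim_transform_eventually) (use ev in \<open>eventually_elim, simp add: power_divide\<close>)
  have "(\<lambda>n. prime_power_sum 2 (f n) * ln (real (f n)) / real (f n) ^ 3 * (real (f n) / real n) ^ 3 * (ln (real n) / ln (real (f n))))
     \<longlonglongrightarrow> 1 / 3 * c ^ 3 * 1"
    by (intro tendsto_mult filterlim_compose[OF prime_square_sum_asymp g(1)] tendsto_power f g(2))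
  hence "(\<lambda>n. prime_power_sum 2 (f n) * ln (real (f n)) / real (f n) ^ 3 * (real (f n) / real n) ^ 3 * (ln (real n) / ln (real (f n))))
     \<longlonglongrightarrow> c ^ 3 / 3" by simp
  thus "(\<lambda>n. prime_power_sum 2 (f n) * ln (real n) / real n ^ 3) \<longlonglongrightarrow> c ^ 3 / 3"
    by (rule Lim_transform_eventually) (use ev in \<open>eventually_elim, simp add: power_divide\<close>)
qed

lemma div_ratio:
  fixes d :: nat
  assumes "d > 0"
  shows "(\<lambda>n. real (n div d) / real n) \<longlonglongrightarrow> 1 / real d"
proof (rule tendsto_sandwich)
  have fl: "\<lfloor>real n / real d\<rfloor> = int (n div d)" for n
    by (rule floor_divide_of_nat_eq)
  show "\<forall>\<^sub>F n in sequentially. 1 / real d - 1 / real n \<le> real (n div d) / real n"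
    using eventually_gt_at_top[of 0]
  proof eventually_elim
    case (elim n)
    have "real n / real d - 1 \<le> real (n div d)" using fl[of n] by linarith
    hence "(real n / real d - 1) / real n \<le> real (n div d) / real n" using elim by (intro divide_right_mono) auto
    thus ?case using elim by (simp add: diff_divide_distrib)
  qed
  show "\<forall>\<^sub>F n in sequentially. real (n div d) / real n \<le> 1 / real d"
    using eventually_gt_at_top[of 0]
  proof eventually_elim
    case (elim n)
    have "real (n div d) \<le> real n / real d" using fl[of n] by linarith
    hence "real (n div d) / real n \<le> (real n / real d) / real n" by (rule divide_right_mono) simp
    thus ?case using elim by simp
  qed
  show "(\<lambda>n::nat. 1 / real d - 1 / real n) \<longlonglongrightarrow> 1 / real d" by real_asymp
qed auto

section \<open>Packings and the lower bound\<close>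

lemma translate_progression:
  "translate s (progression n d) = (\<lambda>j. s + int j * int d) ` {1..n}"
  by (auto simp: translate_def progression_def image_image)

abbreviation ap :: "int \<Rightarrow> nat \<Rightarrow> nat \<Rightarrow> int set" where
  "ap s n d \<equiv> translate s (progression n d)"

lemma mem_translate_progression_iff:
  assumes "d > 0"
  shows "y \<in> ap s n d \<longleftrightarrow>
    int d dvd y - s \<and> s + int d \<le> y \<and> y \<le> s + int n * int d"
proof
  assume "y \<in> ap s n d"
  then obtain j where "j \<in> {1..n}" "y = s + int j * int d" by (auto simp: translate_progression)
  moreover from this have "int d \<le> int j * int d" "int j * int d \<le> int n * int d"
    using mult_right_mono[of 1 "int j" "int d"] mult_right_mono[of "int j" "int n" "int d"] by auto
  ultimately show "int d dvd y - s \<and> s + int d \<le> y \<and> y \<le> s + int n * int d" by auto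
next
  assume y: "int d dvd y - s \<and> s + int d \<le> y \<and> y \<le> s + int n * int d"
  then obtain k where k: "y - s = int d * k" by (auto elim: dvdE)
  have "int d * 1 \<le> int d * k" "int d * k \<le> int d * int n" using y k by (simp_all add: mult.commute)
  hence "1 \<le> k" "k \<le> int n" using assms by (simp_all only: mult_le_cancel_left_pos of_nat_0_less_iff)
  hence "nat k \<in> {1..n}" "y = s + int (nat k) * int d" using k by (auto simp: mult.commute)
  thus "y \<in> ap s n d" unfolding translate_progression by blast
qed

lemma can_be_packed_mono:
  assumes "can_be_packed D C N" "N \<le> N'" shows "can_be_packed D C N'"
  using assms unfolding can_be_packed_def by (meson atLeastatMost_subset_iff of_nat_mono order.refl subset_trans)

lemma translate_translate: "translate a (translate b C) = translate (a + b) C"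
  by (auto simp: translate_def image_image add.assoc)

lemma can_be_packed_Un:
  assumes "can_be_packed D1 C N1" "can_be_packed D2 C N2" "D1 \<inter> D2 = {}"
  shows "can_be_packed (D1 \<union> D2) C (N1 + N2)"
proof -
  obtain \<sigma> where \<sigma>: "\<And>d. d \<in> D1 \<Longrightarrow> translate (\<sigma> d) (C d) \<subseteq> {1..int N1}"
    "disjoint_family_on (\<lambda>d. translate (\<sigma> d) (C d)) D1"
    using assms(1) by (auto simp: can_be_packed_def)
  obtain \<tau> where \<tau>: "\<And>d. d \<in> D2 \<Longrightarrow> translate (\<tau> d) (C d) \<subseteq> {1..int N2}"
    "disjoint_family_on (\<lambda>d. translate (\<tau> d) (C d)) D2"
    using assms(2) by (auto simp: can_be_packed_def)
  define \<rho> where "\<rho> = (\<lambda>d. if d \<in> D1 then \<sigma> d else int N1 + \<tau> d)"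
  have 1: "translate (\<rho> d) (C d) = translate (\<sigma> d) (C d)" if "d \<in> D1" for d
    using that by (simp add: \<rho>_def)
  have 2: "translate (\<rho> d) (C d) = translate (int N1) (translate (\<tau> d) (C d))" if "d \<in> D2" for d
    using that assms(3) by (auto simp: \<rho>_def translate_translate)
  have 3: "translate (\<rho> d) (C d) \<subseteq> {int N1 + 1..int N1 + int N2}" if "d \<in> D2" for d
    unfolding 2[OF that] using \<tau>(1)[OF that] by (force simp: translate_def)
  have sub: "translate (\<rho> d) (C d) \<subseteq> {1..int (N1 + N2)}" if "d \<in> D1 \<union> D2" for d
  proof (cases "d \<in> D1")
    case True
    have "translate (\<rho> d) (C d) \<subseteq> {1..int N1}" using 1[OF True] \<sigma>(1)[OF True] by simp
    also have "\<dots> \<subseteq> {1..int (N1 + N2)}" by auto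
    finally show ?thesis .
  next
    case False
    hence "translate (\<rho> d) (C d) \<subseteq> {int N1 + 1..int N1 + int N2}" using 3 that by blast
    also have "\<dots> \<subseteq> {1..int (N1 + N2)}" by auto
    finally show ?thesis .
  qed
  have cross: "translate (\<rho> d) (C d) \<inter> translate (\<rho> e) (C e) = {}" if "d \<in> D1" "e \<in> D2" for d e
  proof -
    have "translate (\<rho> d) (C d) \<subseteq> {1..int N1}" using 1[OF that(1)] \<sigma>(1)[OF that(1)] by simp
    thus ?thesis using 3[OF that(2)] by force
  qed
  have in1: "translate (\<rho> d) (C d) \<inter> translate (\<rho> e) (C e) = {}" if "d \<in> D1" "e \<in> D1" "d \<noteq> e" for d e
    using disjoint_family_onD[OF \<sigma>(2) that] 1 that by simp
  have in2: "translate (\<rho> d) (C d) \<inter> translate (\<rho> e) (C e) = {}" if "d \<in> D2" "e \<in> D2" "d \<noteq> e" for d e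
    using disjoint_family_onD[OF \<tau>(2) that] unfolding 2[OF that(1)] 2[OF that(2)] by (auto simp: translate_def)
  have "disjoint_family_on (\<lambda>d. translate (\<rho> d) (C d)) (D1 \<union> D2)"
    unfolding disjoint_family_on_def using in1 in2 cross by (metis Int_commute Un_iff)
  thus ?thesis using sub unfolding can_be_packed_def by blast
qed

lemma can_be_packed_singleton:
  assumes "d > 0" shows "can_be_packed {d} (progression n) (n * d)"
  unfolding can_be_packed_def
proof (intro exI[of _ "\<lambda>_. 0"] conjI ballI)
  fix d' assume "d' \<in> {d}"
  hence "d' = d" by simp
  thus "ap 0 n d' \<subseteq> {1..int (n * d)}"
    using assms by (auto simp: mem_translate_progression_iff)
qed (simp add: disjoint_family_on_def)

text \<open>
  One progression after the other; in particular a packing exists, so that the least N is attained.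
\<close>
lemma can_be_packed_finite:
  assumes "finite D" "\<And>d. d \<in> D \<Longrightarrow> 0 < d"
  shows "can_be_packed D (progression n) (\<Sum>d\<in>D. n * d)"
  using assms
proof (induction D rule: finite_induct)
  case empty
  show ?case by (simp add: can_be_packed_def disjoint_family_on_def)
next
  case (insert d D)
  have "can_be_packed ({d} \<union> D) (progression n) (n * d + (\<Sum>d\<in>D. n * d))"
    using insert by (intro can_be_packed_Un can_be_packed_singleton) auto
  thus ?case using insert by simp
qed

lemma can_be_packed_min_packing:
  assumes "finite D" "\<And>d. d \<in> D \<Longrightarrow> 0 < d"
  shows "can_be_packed D (progression n) (min_packing D n)"
proof -
  have "1 \<le> (\<Sum>d\<in>D. n * d) + 1 \<and> can_be_packed D (progression n) ((\<Sum>d\<in>D. n * d) + 1)"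
    using can_be_packed_mono[OF can_be_packed_finite[OF assms]] by auto
  from LeastI[where P = "\<lambda>N. 1 \<le> N \<and> can_be_packed D (progression n) N", OF this] show ?thesis
    unfolding min_packing_def by blast
qed

lemma min_packing_le:
  assumes "can_be_packed D (progression n) N" "1 \<le> N"
  shows "min_packing D n \<le> N"
  unfolding min_packing_def by (rule Least_le) (use assms in auto)

text \<open>
  Otherwise the common residue class modulo lcm(d, d') has a member in a window that both progressions
  cover.
\<close>
lemma overlap_lt_lcm:
  fixes d d' :: nat and s s' :: int
  assumes pos: "d > 0" "d' > 0"
    and disj: "ap s n d \<inter> ap s' n d' = {}"
    and g: "int (gcd d d') dvd s - s'"
  shows "min (s + int n * int d) (s' + int n * int d') - max (s + int d) (s' + int d') + 1 < int (lcm d d')"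
proof (rule ccontr)
  define M where "M = max (s + int d) (s' + int d')"
  define L where "L = int (lcm d d')"
  assume "\<not> ?thesis"
  hence le: "M + L - 1 \<le> s + int n * int d" "M + L - 1 \<le> s' + int n * int d'"
    unfolding M_def L_def by linarith+
  have L: "L > 0" "int d dvd L" "int d' dvd L" using pos by (simp_all add: L_def lcm_pos_nat)
  obtain u v where uv: "u * int d + v * int d' = gcd (int d) (int d')" using bezout_int by blast
  obtain k where k: "s' - s = gcd (int d) (int d') * k"
    using g by (metis dvdE dvd_minus_iff gcd_int_int_eq minus_diff_eq)
  define x where "x = s + k * u * int d"
  have x': "x = s' - k * v * int d'"
  proof -
    have "s' - s = k * (u * int d + v * int d')" using k uv by (simp add: mult.commute)
    thus ?thesis by (simp add: x_def algebra_simps)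
  qed
  \<comment> \<open>The representative of the class of x in the window of length L that starts at M.\<close>
  define y where "y = M + (x - M) mod L"
  have yb: "M \<le> y" "y \<le> M + L - 1" using L(1) by (simp_all add: y_def)
  have yx: "L dvd y - x"
  proof -
    have "y - x = - (L * ((x - M) div L))" unfolding y_def
      using mult_div_mod_eq[of L "x - M"] by linarith
    thus ?thesis by simp
  qed
  have "int d dvd (y - x) + (x - s)" using yx L(2) by (intro dvd_add) (auto simp: x_def intro: dvd_trans)
  hence 1: "int d dvd y - s" by simp
  have "int d' dvd (y - x) + (x - s')" using yx L(3) by (intro dvd_add) (auto simp: x' intro: dvd_trans)
  hence 2: "int d' dvd y - s'" by simp
  have "y \<in> ap s n d \<inter> ap s' n d'"
    using 1 2 yb le pos by (auto simp: mem_translate_progression_iff M_def)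
  thus False using disj by simp
qed

text \<open>
  What is left of the span after removing half of d^2 at both ends. Rounding the half down loses 1 in
  \<open>half_squares_ge\<close>, which the strict inequality in \<open>overlap_lt_lcm\<close> makes up for.
\<close>
definition core :: "int \<Rightarrow> nat \<Rightarrow> nat \<Rightarrow> int set" where
  "core s n d = {s + int d + int (d ^ 2 div 2) .. s + int n * int d - int (d ^ 2 div 2)}"

lemma core_subset:
  assumes "ap s n d \<subseteq> {1..int N}" "n \<ge> 1" "d > 0"
  shows "core s n d \<subseteq> {1..int N}"
proof -
  have "s + int 1 * int d \<in> ap s n d" "s + int n * int d \<in> ap s n d"
    unfolding translate_progression using assms(2) by (intro imageI; simp)+
  hence "1 \<le> s + int d" "s + int n * int d \<le> int N" using assms(1) by auto
  thus ?thesis unfolding core_def by auto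
qed

lemma card_core_ge: "real (card (core s n d)) \<ge> (real n - 1) * real d - real d ^ 2"
proof -
  have "2 * (d ^ 2 div 2) \<le> d ^ 2" by simp
  hence "2 * real (d ^ 2 div 2) \<le> real (d ^ 2)" by (metis of_nat_le_iff of_nat_mult of_nat_numeral)
  hence "(real n - 1) * real d - real d ^ 2 \<le> real n * real d - real d + 1 - 2 * real (d ^ 2 div 2)"
    by (simp add: algebra_simps)
  also have "\<dots> = of_int (int n * int d - int d + 1 - 2 * int (d ^ 2 div 2))" by simp
  also have "\<dots> \<le> real (nat (int n * int d - int d + 1 - 2 * int (d ^ 2 div 2)))" by linarith
  also have "\<dots> = real (card (core s n d))"
    unfolding core_def by (simp add: algebra_simps)
  finally show ?thesis .
qed

lemma half_squares_ge: "int (d ^ 2 div 2) + int (d' ^ 2 div 2) \<ge> int d * int d' - 1"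
proof -
  have h: "2 * int (e ^ 2 div 2) \<ge> int e ^ 2 - 1" for e :: nat
  proof -
    have "m \<le> 2 * (m div 2) + 1" for m :: nat by arith
    from this[of "e ^ 2"] have "int (e ^ 2) \<le> 2 * int (e ^ 2 div 2) + 1" by linarith
    thus ?thesis by simp
  qed
  have "0 \<le> (int d - int d') ^ 2" by simp
  hence "2 * (int d * int d') \<le> int d ^ 2 + int d' ^ 2" by (simp add: power2_eq_square algebra_simps)
  thus ?thesis using h[of d] h[of d'] by linarith
qed

text \<open>
  The hypotheses on the least common multiple say that neither span can contain the other, so an overlap
  is at the right end of one and at the left end of the other, where the cut pieces cover it.
\<close>
lemma cores_disjoint:
  assumes pos: "d > 0" "d' > 0"
    and disj: "ap s n d \<inter> ap s' n d' = {}"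
    and g: "int (gcd d d') dvd s - s'"
    and big: "lcm d d' \<le> (n - 1) * d + 1" "lcm d d' \<le> (n - 1) * d' + 1" and n: "n \<ge> 1"
  shows "core s n d \<inter> core s' n d' = {}"
proof (rule equals0I)
  fix x assume x: "x \<in> core s n d \<inter> core s' n d'"
  have ov: "min (s + int n * int d) (s' + int n * int d') - max (s + int d) (s' + int d') + 1 < int (lcm d d')"
    by (rule overlap_lt_lcm) fact+
  have "lcm d d' \<le> d * d'" using pos by (intro dvd_imp_le lcm_least) auto
  hence L: "int (lcm d d') \<le> int d * int d'" by (metis of_nat_le_iff of_nat_mult)
  have b1: "int (lcm d d') \<le> int n * int d - int d + 1"
  proof -
    have "int (lcm d d') \<le> int ((n - 1) * d + 1)" using big(1) of_nat_le_iff by blast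
    also have "\<dots> = int n * int d - int d + 1" using n by (simp add: of_nat_diff algebra_simps)
    finally show ?thesis .
  qed
  have b2: "int (lcm d d') \<le> int n * int d' - int d' + 1"
  proof -
    have "int (lcm d d') \<le> int ((n - 1) * d' + 1)" using big(2) of_nat_le_iff by blast
    also have "\<dots> = int n * int d' - int d' + 1" using n by (simp add: of_nat_diff algebra_simps)
    finally show ?thesis .
  qed
  show False
    using x ov L b1 b2 half_squares_ge[of d d'] unfolding core_def by (auto simp: min_def max_def split: if_splits)
qed

lemma lcm_primes_le:
  fixes p q n :: nat
  assumes "prime p" "prime q" "p \<noteq> q" "q < n"
  shows "lcm p q \<le> (n - 1) * p + 1"
proof -
  have "lcm p q = p * q" using assms by (simp add: lcm_coprime primes_coprime)
  also have "\<dots> \<le> p * (n - 1)" using assms by (intro mult_left_mono) auto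
  finally show ?thesis by (simp add: mult.commute)
qed

text \<open>
  For p in T the core of 2p can take the place of the core of p, but cores of 2p and 2q may meet when their
  progressions lie in different classes modulo 2. One of the two classes carries at least half of the
  weight.
\<close>
theorem min_packing_lower_bound:
  fixes D P T :: "nat set"
  assumes D: "finite D" "\<And>d. d \<in> D \<Longrightarrow> 0 < d"
    and P: "P \<subseteq> D" "\<And>p. p \<in> P \<Longrightarrow> prime p \<and> odd p \<and> p < n"
    and T: "T \<subseteq> P" "\<And>p. p \<in> T \<Longrightarrow> 2 * p \<in> D \<and> 3 * p \<le> n"
  shows "real (min_packing D n) \<ge> (\<Sum>p\<in>P. (real n - 1) * real p - real p ^ 2)
           + (\<Sum>p\<in>T. (real n - 1) * real p - 3 * real p ^ 2) / 2"
proof (cases "P = {}")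
  case True
  thus ?thesis using T by auto
next
  case False
  then obtain p0 where "p0 \<in> P" by blast
  hence n: "n \<ge> 3" using P(2)[of p0] prime_ge_2_nat[of p0] by auto
  have fin: "finite P" "finite T" using D P T finite_subset by metis+
  define N where "N = min_packing D n"
  obtain \<sigma> where \<sigma>: "\<And>d. d \<in> D \<Longrightarrow> ap (\<sigma> d) n d \<subseteq> {1..int N}"
    "disjoint_family_on (\<lambda>d. ap (\<sigma> d) n d) D"
    using can_be_packed_min_packing[OF D, of n] unfolding can_be_packed_def N_def by blast
  define I where "I = (\<lambda>p. core (\<sigma> p) n p)"
  define J where "J = (\<lambda>p. core (\<sigma> (2 * p)) n (2 * p))"
  define w where "w = (\<lambda>p. (real n - 1) * real p - 3 * real p ^ 2)"
  define Tc where "Tc = (\<lambda>b. {p \<in> T. even (\<sigma> (2 * p)) = b})"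
  have "(\<Sum>p\<in>T. w p) = (\<Sum>p\<in>Tc True. w p) + (\<Sum>p\<in>Tc False. w p)"
    unfolding Tc_def using fin by (subst sum.union_disjoint[symmetric]) (auto intro!: sum.cong)
  then obtain b where b: "(\<Sum>p\<in>Tc b. w p) \<ge> (\<Sum>p\<in>T. w p) / 2"
  proof (cases "(\<Sum>p\<in>Tc True. w p) \<ge> (\<Sum>p\<in>T. w p) / 2")
    case False
    with \<open>(\<Sum>p\<in>T. w p) = _\<close> have "(\<Sum>p\<in>Tc False. w p) \<ge> (\<Sum>p\<in>T. w p) / 2" by linarith
    thus ?thesis by (rule that)
  qed (rule that)
  define E where "E = (\<lambda>p. if p \<in> Tc b then J p else I p)"
  have TcT: "Tc b \<subseteq> T" by (auto simp: Tc_def)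
  have pr: "prime p" "odd p" "p < n" "p \<in> D" "p > 0" if "p \<in> P" for p
    using P that prime_gt_0_nat[of p] by auto
  have tr: "p \<in> P" "2 * p \<in> D" "2 * p \<le> n - 1" if "p \<in> Tc b" for p
    using T that TcT n by fastforce+
  have cop: "coprime p q" if "p \<in> P" "q \<in> P" "p \<noteq> q" for p q
    using pr that by (intro primes_coprime) auto
  have disjD: "ap (\<sigma> d) n d \<inter> ap (\<sigma> e) n e = {}"
    if "d \<in> D" "e \<in> D" "d \<noteq> e" for d e
    using disjoint_family_onD[OF \<sigma>(2) that] .
  have II: "I p \<inter> I q = {}" if "p \<in> P" "q \<in> P" "p \<noteq> q" for p q
    unfolding I_def
  proof (rule cores_disjoint)
    show "int (gcd p q) dvd \<sigma> p - \<sigma> q" using cop[OF that] by (simp add: coprime_iff_gcd_eq_1)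
    show "lcm p q \<le> (n - 1) * p + 1" using that pr by (intro lcm_primes_le) auto
    show "lcm p q \<le> (n - 1) * q + 1" using that pr by (subst lcm.commute, intro lcm_primes_le) auto
  qed (use that pr n disjD in auto)
  have JI: "J p \<inter> I q = {}" if "p \<in> Tc b" "q \<in> P" "p \<noteq> q" for p q
    unfolding I_def J_def
  proof (rule cores_disjoint)
    have c: "coprime (2 * p) q" using cop[of p q] that tr pr(2)[of q] by (simp add: coprime_commute)
    hence l: "lcm (2 * p) q = 2 * p * q" by (simp add: lcm_coprime)
    show "int (gcd (2 * p) q) dvd \<sigma> (2 * p) - \<sigma> q" using c by (simp add: coprime_iff_gcd_eq_1)
    have "2 * p * q \<le> 2 * p * (n - 1)" using pr[OF that(2)] by (intro mult_left_mono) auto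
    thus "lcm (2 * p) q \<le> (n - 1) * (2 * p) + 1"
      unfolding l mult.commute[of "n - 1"] by (rule trans_le_add1)
    have "2 * p * q \<le> (n - 1) * q" using tr[OF that(1)] by (intro mult_right_mono) auto
    thus "lcm (2 * p) q \<le> (n - 1) * q + 1" unfolding l by (rule trans_le_add1)
    show "ap (\<sigma> (2 * p)) n (2 * p) \<inter> ap (\<sigma> q) n q = {}"
      using tr[OF that(1)] pr[OF that(2)] by (intro disjD) auto
  qed (use that pr tr n in auto)
  have JJ: "J p \<inter> J q = {}" if "p \<in> Tc b" "q \<in> Tc b" "p \<noteq> q" for p q
    unfolding J_def
  proof (rule cores_disjoint)
    have c: "coprime p q" using cop that tr by blast
    hence l: "lcm (2 * p) (2 * q) = 2 * p * q" by (simp add: lcm_mult_left lcm_coprime)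
    have "even (\<sigma> (2 * p)) = even (\<sigma> (2 * q))" using that by (simp add: Tc_def)
    hence "2 dvd \<sigma> (2 * p) - \<sigma> (2 * q)" by simp
    moreover have "gcd (2 * p) (2 * q) = 2" using c by (simp add: gcd_mult_left coprime_iff_gcd_eq_1)
    ultimately show "int (gcd (2 * p) (2 * q)) dvd \<sigma> (2 * p) - \<sigma> (2 * q)" by simp
    have "2 * p * q \<le> 2 * p * (n - 1)" using pr tr[OF that(2)] by (intro mult_left_mono) auto
    thus "lcm (2 * p) (2 * q) \<le> (n - 1) * (2 * p) + 1"
      unfolding l mult.commute[of "n - 1"] by (rule trans_le_add1)
    have "2 * q * p \<le> 2 * q * (n - 1)" using pr tr[OF that(1)] by (intro mult_left_mono) auto
    hence "2 * p * q \<le> 2 * q * (n - 1)" by (simp only: mult_ac)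
    thus "lcm (2 * p) (2 * q) \<le> (n - 1) * (2 * q) + 1"
      unfolding l mult.commute[of "n - 1"] by (rule trans_le_add1)
    show "ap (\<sigma> (2 * p)) n (2 * p) \<inter> ap (\<sigma> (2 * q)) n (2 * q) = {}"
      using tr that by (intro disjD) auto
  qed (use that pr tr n in auto)
  have disjE: "E p \<inter> E q = {}" if "p \<in> P" "q \<in> P" "p \<noteq> q" for p q
    using II[OF that] JI[of p q] JI[of q p] JJ[of p q] that unfolding E_def by auto
  have subE: "E p \<subseteq> {1..int N}" if "p \<in> P" for p
  proof (cases "p \<in> Tc b")
    case True
    have "core (\<sigma> (2 * p)) n (2 * p) \<subseteq> {1..int N}"
      using tr[OF True] pr[OF that] n by (intro core_subset \<sigma>(1)) auto
    thus ?thesis using True by (simp add: E_def J_def)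
  next
    case False
    have "core (\<sigma> p) n p \<subseteq> {1..int N}"
      using pr[OF that] n by (intro core_subset \<sigma>(1)) auto
    thus ?thesis using False by (simp add: E_def I_def)
  qed
  have "(\<Sum>p\<in>P. (real n - 1) * real p - real p ^ 2) + (\<Sum>p\<in>Tc b. w p) =
     (\<Sum>p\<in>P. ((real n - 1) * real p - real p ^ 2) + (if p \<in> Tc b then w p else 0))"
  proof -
    have "P \<inter> Tc b = Tc b" using tr by auto
    hence "(\<Sum>p\<in>Tc b. w p) = (\<Sum>p\<in>P. if p \<in> Tc b then w p else 0)"
      using sum.inter_restrict[OF fin(1), of w "Tc b"] by simp
    thus ?thesis by (simp add: sum.distrib)
  qed
  also have "\<dots> \<le> (\<Sum>p\<in>P. real (card (E p)))"
  proof (rule sum_mono)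
    fix p assume "p \<in> P"
    show "((real n - 1) * real p - real p ^ 2) + (if p \<in> Tc b then w p else 0) \<le> real (card (E p))"
      using card_core_ge[of n p "\<sigma> p"] card_core_ge[of n "2 * p" "\<sigma> (2 * p)"]
      by (auto simp: E_def I_def J_def w_def power_mult_distrib algebra_simps)
  qed
  also have "\<dots> = real (card (\<Union>p\<in>P. E p))"
  proof -
    have "card (\<Union>p\<in>P. E p) = (\<Sum>p\<in>P. card (E p))"
      using fin disjE by (intro card_UN_disjoint) (auto intro: finite_subset[OF subE])
    thus ?thesis by simp
  qed
  also have "card (\<Union>p\<in>P. E p) \<le> card {1..int N}"
    using subE by (intro card_mono) auto
  also have "card {1..int N} = N" by simp
  finally have "(\<Sum>p\<in>P. (real n - 1) * real p - real p ^ 2) + (\<Sum>p\<in>Tc b. w p) \<le> real N"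
    by simp
  thus ?thesis using b unfolding N_def w_def by linarith
qed

section \<open>Small residues for several moduli at once\<close>

lemma sum_cis_roots:
  fixes m :: int and q :: nat
  assumes "q > 0"
  shows "(\<Sum>r<q. cis (2 * pi * real r * of_int m / real q)) = (if int q dvd m then of_nat q else 0)"
proof -
  define z where "z = cis (2 * pi * of_int m / real q)"
  have zr: "cis (2 * pi * real r * of_int m / real q) = z ^ r" for r
  proof -
    have "2 * pi * real r * of_int m / real q = real r * (2 * pi * of_int m / real q)" by simp
    thus ?thesis unfolding z_def Complex.DeMoivre by (rule arg_cong)
  qed
  have zq: "z ^ q = 1"
  proof -
    have "z ^ q = cis (2 * pi * of_int m)" unfolding z_def Complex.DeMoivre using assms by simp
    also have "\<dots> = 1" using cis_multiple_2pi[of "of_int m"] by simp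
    finally show ?thesis .
  qed
  show ?thesis
  proof (cases "int q dvd m")
    case True
    then obtain k where "m = int q * k" by (auto elim: dvdE)
    hence e: "2 * pi * of_int m / real q = 2 * pi * of_int k" using assms by simp
    have "z = cis (2 * pi * of_int k)" unfolding z_def by (simp only: e)
    also have "\<dots> = 1" by (rule cis_multiple_2pi) simp
    finally show ?thesis using True by (simp add: zr)
  next
    case False
    have "z \<noteq> 1"
    proof
      assume "z = 1"
      hence "cos (2 * pi * of_int m / real q) = 1" unfolding z_def by (simp add: complex_eq_iff)
      then obtain k :: int where "2 * pi * of_int m / real q = of_int k * 2 * pi"
        using cos_one_2pi_int by blast
      hence "2 * pi * of_int m = 2 * pi * (of_int k * real q)" using assms by (simp add: field_simps)
      hence "of_int m = real_of_int (k * int q)" by simp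
      hence "m = k * int q" by (simp only: of_int_eq_iff)
      with False show False by simp
    qed
    hence "(\<Sum>r<q. z ^ r) = 0" using zq by (simp add: geometric_sum)
    thus ?thesis using False by (simp add: zr)
  qed
qed

lemma cos_power_expand:
  "complex_of_real (cos x ^ (2 * L)) =
    (\<Sum>k\<le>2*L. of_real (real (2 * L choose k) / 4 ^ L) * cis (2 * (real k - real L) * x))"
proof -
  have "complex_of_real (cos x) = (cis x + cis (- x)) / 2" by (simp add: complex_eq_iff)
  hence "complex_of_real (cos x ^ (2 * L)) = ((cis x + cis (- x)) / 2) ^ (2 * L)"
    by (simp only: of_real_power)
  also have "\<dots> = (cis x + cis (- x)) ^ (2 * L) / 4 ^ L"
    by (simp add: power_divide power_mult)
  also have "(cis x + cis (- x)) ^ (2 * L) =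
      (\<Sum>k\<le>2*L. of_nat (2 * L choose k) * cis x ^ k * cis (- x) ^ (2 * L - k))"
    by (rule binomial_ring)
  also have "\<dots> = (\<Sum>k\<le>2*L. of_nat (2 * L choose k) * cis (2 * (real k - real L) * x))"
  proof (intro sum.cong refl)
    fix k assume "k \<in> {..2*L}"
    hence k: "k \<le> 2 * L" by simp
    have "cis x ^ k * cis (- x) ^ (2 * L - k) = cis (real k * x + real (2 * L - k) * (- x))"
      by (simp only: Complex.DeMoivre cis_mult)
    also have "real k * x + real (2 * L - k) * (- x) = 2 * (real k - real L) * x"
      using k by (simp add: of_nat_diff algebra_simps)
    finally show "of_nat (2 * L choose k) * cis x ^ k * cis (- x) ^ (2 * L - k) =
        of_nat (2 * L choose k) * cis (2 * (real k - real L) * x)" by (simp add: mult.assoc)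
  qed
  finally show ?thesis by (simp add: sum_divide_distrib)
qed

lemma prod_cis: "(\<Prod>i\<in>A. cis (f i)) = cis (\<Sum>i\<in>A. f i)"
  by (induction A rule: infinite_finite_induct) (auto simp: cis_mult)

text \<open>
  Expand the product into characters modulo q. By the independence hypothesis only the constant term
  survives the summation over r, and it is what it would be for independent variables.
\<close>
lemma cos_prod_mean:
  fixes q L :: nat and \<alpha> :: "'i \<Rightarrow> int" and \<beta> :: "'i \<Rightarrow> real"
  assumes I: "finite I" and q: "q > 0"
    and indep: "\<And>h. (\<forall>i\<in>I. \<bar>h i\<bar> \<le> int L) \<Longrightarrow> int q dvd (\<Sum>i\<in>I. h i * \<alpha> i) \<Longrightarrow> \<forall>i\<in>I. h i = 0"
  shows "(\<Sum>r<q. \<Prod>i\<in>I. cos (pi * real r * of_int (\<alpha> i) / real q + \<beta> i) ^ (2 * L)) =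
     real q * (real (2 * L choose L) / 4 ^ L) ^ card I"
proof -
  define W where "W = (\<lambda>k. complex_of_real (real (2 * L choose k) / 4 ^ L))"
  define x where "x = (\<lambda>i r. pi * real r * of_int (\<alpha> i) / real q + \<beta> i)"
  define G where "G = PiE I (\<lambda>_. {..2*L})"
  define g0 where "g0 = (\<lambda>i\<in>I. L)"
  have G: "finite G" "g0 \<in> G" unfolding G_def g0_def using I by (auto intro: finite_PiE)
  have expand: "(\<Prod>i\<in>I. complex_of_real (cos (x i r) ^ (2 * L))) =
     (\<Sum>g\<in>G. (\<Prod>i\<in>I. W (g i)) * cis (\<Sum>i\<in>I. 2 * (real (g i) - real L) * \<beta> i) *
        cis (2 * pi * real r * of_int (\<Sum>i\<in>I. (int (g i) - int L) * \<alpha> i) / real q))" for r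
  proof -
    have "(\<Prod>i\<in>I. complex_of_real (cos (x i r) ^ (2 * L))) =
       (\<Prod>i\<in>I. \<Sum>k\<in>{..2*L}. W k * cis (2 * (real k - real L) * x i r))"
      unfolding W_def by (intro prod.cong refl cos_power_expand)
    also have "\<dots> = (\<Sum>g\<in>G. \<Prod>i\<in>I. W (g i) * cis (2 * (real (g i) - real L) * x i r))"
      unfolding G_def by (rule prod_sum_PiE) (use I in auto)
    also have "\<dots> = (\<Sum>g\<in>G. (\<Prod>i\<in>I. W (g i)) * cis (\<Sum>i\<in>I. 2 * (real (g i) - real L) * \<beta> i) *
        cis (2 * pi * real r * of_int (\<Sum>i\<in>I. (int (g i) - int L) * \<alpha> i) / real q))"
    proof (intro sum.cong refl)
      fix g
      have "(\<Sum>i\<in>I. 2 * (real (g i) - real L) * x i r) =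
         (\<Sum>i\<in>I. 2 * (real (g i) - real L) * \<beta> i + 2 * pi * real r / real q * ((real (g i) - real L) * of_int (\<alpha> i)))"
        unfolding x_def by (intro sum.cong refl) (simp add: algebra_simps)
      also have "\<dots> = (\<Sum>i\<in>I. 2 * (real (g i) - real L) * \<beta> i) +
          2 * pi * real r * of_int (\<Sum>i\<in>I. (int (g i) - int L) * \<alpha> i) / real q"
        unfolding sum.distrib sum_distrib_left[symmetric] by simp
      finally have *: "(\<Sum>i\<in>I. 2 * (real (g i) - real L) * x i r) = \<dots>" .
      show "(\<Prod>i\<in>I. W (g i) * cis (2 * (real (g i) - real L) * x i r)) =
         (\<Prod>i\<in>I. W (g i)) * cis (\<Sum>i\<in>I. 2 * (real (g i) - real L) * \<beta> i) *
        cis (2 * pi * real r * of_int (\<Sum>i\<in>I. (int (g i) - int L) * \<alpha> i) / real q)"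
        unfolding prod.distrib prod_cis * by (simp add: cis_mult mult.assoc)
    qed
    finally show ?thesis .
  qed
  have "complex_of_real (\<Sum>r<q. \<Prod>i\<in>I. cos (x i r) ^ (2 * L)) =
      (\<Sum>r<q. \<Prod>i\<in>I. complex_of_real (cos (x i r) ^ (2 * L)))" by simp
  also have "\<dots> = (\<Sum>g\<in>G. \<Sum>r<q. (\<Prod>i\<in>I. W (g i)) * cis (\<Sum>i\<in>I. 2 * (real (g i) - real L) * \<beta> i) *
        cis (2 * pi * real r * of_int (\<Sum>i\<in>I. (int (g i) - int L) * \<alpha> i) / real q))"
    unfolding expand by (rule sum.swap)
  also have "\<dots> = (\<Sum>g\<in>G. (\<Prod>i\<in>I. W (g i)) * cis (\<Sum>i\<in>I. 2 * (real (g i) - real L) * \<beta> i) *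
        (if int q dvd (\<Sum>i\<in>I. (int (g i) - int L) * \<alpha> i) then of_nat q else 0))"
    unfolding sum_distrib_left[symmetric] sum_cis_roots[OF q] ..
  also have "\<dots> = (\<Sum>g\<in>G. if g = g0 then W L ^ card I * of_nat q else 0)"
  proof (intro sum.cong refl)
    fix g assume g: "g \<in> G"
    show "(\<Prod>i\<in>I. W (g i)) * cis (\<Sum>i\<in>I. 2 * (real (g i) - real L) * \<beta> i) *
        (if int q dvd (\<Sum>i\<in>I. (int (g i) - int L) * \<alpha> i) then of_nat q else 0) =
        (if g = g0 then W L ^ card I * of_nat q else 0)"
    proof (cases "g = g0")
      case True
      thus ?thesis by (simp add: g0_def)
    next
      case False
      have "\<not> int q dvd (\<Sum>i\<in>I. (int (g i) - int L) * \<alpha> i)"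
      proof
        assume d: "int q dvd (\<Sum>i\<in>I. (int (g i) - int L) * \<alpha> i)"
        have "\<forall>i\<in>I. \<bar>int (g i) - int L\<bar> \<le> int L" using g by (auto simp: G_def PiE_iff)
        from indep[OF this d] have "\<forall>i\<in>I. g i = L" by simp
        hence "g = g0" using g unfolding G_def g0_def by (auto simp: PiE_iff extensional_def fun_eq_iff)
        with False show False by simp
      qed
      thus ?thesis using False by simp
    qed
  qed
  also have "\<dots> = W L ^ card I * of_nat q" using G by simp
  also have "\<dots> = complex_of_real (real q * (real (2 * L choose L) / 4 ^ L) ^ card I)"
    by (simp add: W_def)
  finally show ?thesis unfolding x_def of_real_eq_iff .
qed

lemma cos_sq_shift_int_pi: "cos (y + of_int t * pi) ^ 2 = cos y ^ 2" for t :: int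
proof -
  have s: "sin (of_int t * pi) = 0" using sin_zero_iff_int2 by blast
  hence "cos (of_int t * pi) ^ 2 = 1" using sin_cos_squared_add[of "of_int t * pi"] by simp
  thus ?thesis using s by (simp add: cos_add power_mult_distrib)
qed

lemma cos_sq_le_away_from_multiples:
  assumes "0 < \<epsilon>" "\<epsilon> < 1" "\<epsilon> \<le> v" "v \<le> 1"
  shows "cos (pi * (v - \<epsilon> / 2)) ^ 2 \<le> cos (pi * \<epsilon> / 2) ^ 2"
proof -
  have "pi * \<epsilon> / 2 \<le> pi * (v - \<epsilon> / 2)" using assms by (simp add: field_simps)
  moreover have "pi * (v - \<epsilon> / 2) \<le> pi * (1 - \<epsilon> / 2)" using assms by (intro mult_left_mono) auto
  moreover have "pi * (1 - \<epsilon> / 2) \<le> pi" using assms by (simp add: algebra_simps)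
  moreover have "0 \<le> pi * \<epsilon> / 2" using assms by simp
  ultimately have "cos (pi * (v - \<epsilon> / 2)) \<le> cos (pi * \<epsilon> / 2)"
    "cos (pi * (1 - \<epsilon> / 2)) \<le> cos (pi * (v - \<epsilon> / 2))"
    by (intro cos_monotone_0_pi_le; linarith)+
  moreover have "cos (pi * (1 - \<epsilon> / 2)) = - cos (pi * \<epsilon> / 2)"
    using cos_minus_pi[of "pi * \<epsilon> / 2"] cos_minus[of "pi * (1 - \<epsilon> / 2)"] by (simp add: right_diff_distrib)
  ultimately have "\<bar>cos (pi * (v - \<epsilon> / 2))\<bar> \<le> \<bar>cos (pi * \<epsilon> / 2)\<bar>" by linarith
  thus ?thesis by (simp only: abs_le_square_iff)
qed

text \<open>
  The power cos^(2L) is so concentrated around its maxima that K times its largest value at distance at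
  least \<epsilon>/2 (in units of pi) from them is less than its mean.
\<close>
abbreviation peaked_exponent :: "nat \<Rightarrow> real \<Rightarrow> nat \<Rightarrow> bool" where
  "peaked_exponent K \<epsilon> L \<equiv> real K * (cos (pi * \<epsilon> / 2) ^ 2) ^ L < real (2 * L choose L) / 4 ^ L"

text \<open>
  Each condition says that a certain angle is within \<epsilon>/2 of a multiple of pi, in units of pi. If for
  every r some condition fails, then for every r some factor of the product of the powers cos^(2L) is at
  most \<rho>. With w the mean of cos^(2L) and k the number of conditions, \<open>cos_prod_mean\<close>, applied to all
  indices and to all but one, then gives w^k \<le> k \<rho> w^(k-1).
\<close>
lemma kronecker_mod:
  fixes q L :: nat and \<alpha> c :: "'i \<Rightarrow> int"
  assumes I: "finite I" and q: "q > 0"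
    and indep: "\<And>h. (\<forall>i\<in>I. \<bar>h i\<bar> \<le> int L) \<Longrightarrow> int q dvd (\<Sum>i\<in>I. h i * \<alpha> i) \<Longrightarrow> \<forall>i\<in>I. h i = 0"
    and \<epsilon>: "0 < \<epsilon>" "\<epsilon> < 1"
    and L: "peaked_exponent (card I) \<epsilon> L"
  obtains r :: nat where "\<And>i. i \<in> I \<Longrightarrow> of_int (((int r - c i) * \<alpha> i) mod int q) \<le> \<epsilon> * real q"
proof (rule ccontr)
  assume no: "\<not> thesis"
  \<comment> \<open>The shift by half of \<epsilon> centres the allowed interval of residues [0, \<epsilon>q] at a maximum of the cosine.\<close>
  define \<beta> where "\<beta> = (\<lambda>i. - (pi * of_int (c i * \<alpha> i) / real q) - pi * \<epsilon> / 2)"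
  define f where "f = (\<lambda>i r. cos (pi * real r * of_int (\<alpha> i) / real q + \<beta> i) ^ (2 * L))"
  define w where "w = real (2 * L choose L) / 4 ^ L"
  define \<rho> where "\<rho> = (cos (pi * \<epsilon> / 2) ^ 2) ^ L"
  have w: "w > 0" unfolding w_def by (simp add: zero_less_binomial)
  have f0: "f i r \<ge> 0" for i r unfolding f_def by (simp add: power_mult)
  have bad: "\<exists>i\<in>I. f i r \<le> \<rho>" for r
  proof -
    have "\<exists>i\<in>I. of_int (((int r - c i) * \<alpha> i) mod int q) > \<epsilon> * real q"
    proof (rule ccontr)
      assume "\<not> ?thesis"
      hence "of_int (((int r - c i) * \<alpha> i) mod int q) \<le> \<epsilon> * real q" if "i \<in> I" for i
        using that by (force simp: not_less)
      thus False using no that by blast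
    qed
    then obtain i where i: "i \<in> I" "of_int (((int r - c i) * \<alpha> i) mod int q) > \<epsilon> * real q"
      by blast
    define a where "a = ((int r - c i) * \<alpha> i) mod int q"
    define t where "t = ((int r - c i) * \<alpha> i) div int q"
    have a: "a < int q" using q by (simp add: a_def)
    have at: "(int r - c i) * \<alpha> i = a + int q * t" unfolding a_def t_def by simp
    have "pi * real r * of_int (\<alpha> i) / real q + \<beta> i = pi * of_int ((int r - c i) * \<alpha> i) / real q - pi * \<epsilon> / 2"
      unfolding \<beta>_def by (simp add: algebra_simps diff_divide_distrib)
    also have "\<dots> = pi * (of_int a / real q - \<epsilon> / 2) + of_int t * pi"
      unfolding at using q by (simp add: field_simps)
    finally have "f i r = (cos (pi * (of_int a / real q - \<epsilon> / 2)) ^ 2) ^ L"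
      unfolding f_def power_mult by (simp only: cos_sq_shift_int_pi)
    also have "\<dots> \<le> \<rho>" unfolding \<rho>_def
    proof (rule power_mono[OF cos_sq_le_away_from_multiples[OF \<epsilon>]])
      show "\<epsilon> \<le> of_int a / real q" using i(2) q unfolding a_def[symmetric] by (simp add: le_divide_eq)
      show "of_int a / real q \<le> 1" using a q by simp
    qed auto
    finally show ?thesis using i by blast
  qed
  have mean: "(\<Sum>r<q. \<Prod>i\<in>I'. f i r) = real q * w ^ card I'" if "I' \<subseteq> I" for I'
    unfolding f_def w_def
  proof (rule cos_prod_mean)
    show "finite I'" using that I finite_subset by blast
    fix h assume h: "\<forall>i\<in>I'. \<bar>h i\<bar> \<le> int L" "int q dvd (\<Sum>i\<in>I'. h i * \<alpha> i)"
    define h' where "h' = (\<lambda>i. if i \<in> I' then h i else 0)"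
    have "(\<Sum>i\<in>I. h' i * \<alpha> i) = (\<Sum>i\<in>I'. h' i * \<alpha> i)"
      using that I by (intro sum.mono_neutral_right) (auto simp: h'_def)
    also have "\<dots> = (\<Sum>i\<in>I'. h i * \<alpha> i)" by (intro sum.cong) (auto simp: h'_def)
    finally have "\<forall>i\<in>I. h' i = 0" using h by (intro indep) (auto simp: h'_def)
    thus "\<forall>i\<in>I'. h i = 0" using that by (auto simp: h'_def split: if_splits)
  qed (rule q)
  have "real q * w ^ card I = (\<Sum>r<q. \<Prod>i\<in>I. f i r)" using mean[of I] by simp
  also have "\<dots> \<le> (\<Sum>r<q. \<Sum>i\<in>I. \<rho> * (\<Prod>j\<in>I-{i}. f j r))"
  proof (rule sum_mono)
    fix r
    obtain i where i: "i \<in> I" "f i r \<le> \<rho>" using bad by blast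
    have "(\<Prod>i\<in>I. f i r) = f i r * (\<Prod>j\<in>I-{i}. f j r)" using i I by (simp add: prod.remove)
    also have "\<dots> \<le> \<rho> * (\<Prod>j\<in>I-{i}. f j r)" using i f0 by (intro mult_right_mono prod_nonneg) auto
    also have "\<dots> \<le> (\<Sum>i\<in>I. \<rho> * (\<Prod>j\<in>I-{i}. f j r))"
      using i I f0 by (intro member_le_sum mult_nonneg_nonneg prod_nonneg) (auto simp: \<rho>_def)
    finally show "(\<Prod>i\<in>I. f i r) \<le> (\<Sum>i\<in>I. \<rho> * (\<Prod>j\<in>I-{i}. f j r))" .
  qed
  also have "\<dots> = (\<Sum>i\<in>I. \<rho> * (\<Sum>r<q. \<Prod>j\<in>I-{i}. f j r))"
    by (subst sum.swap) (simp add: sum_distrib_left)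
  also have "\<dots> = (\<Sum>i\<in>I. \<rho> * (real q * w ^ (card I - 1)))"
    using I by (intro sum.cong refl) (simp add: mean)
  also have "\<dots> = real (card I) * \<rho> * (real q * w ^ (card I - 1))" by simp
  finally have le: "real q * w ^ card I \<le> real (card I) * \<rho> * (real q * w ^ (card I - 1))" .
  have "card I > 0" using bad[of 0] I by (auto simp: card_gt_0_iff)
  hence "w ^ card I = w * w ^ (card I - 1)" by (metis power_eq_if not_gr0)
  hence "w * (real q * w ^ (card I - 1)) \<le> real (card I) * \<rho> * (real q * w ^ (card I - 1))"
    using le by (simp add: mult_ac)
  moreover have "real q * w ^ (card I - 1) > 0" using q w by simp
  ultimately have "w \<le> real (card I) * \<rho>" by (simp only: mult_le_cancel_right_pos)
  thus False using L by (simp add: w_def \<rho>_def)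
qed

text \<open>
  The mean of cos^(2L) decays only like a power of L, while its values away from the maxima decay
  exponentially.
\<close>
lemma exists_kronecker_exponent:
  fixes K :: nat and \<epsilon> :: real
  assumes "0 < \<epsilon>" "\<epsilon> < 1"
  obtains L :: nat where "peaked_exponent K \<epsilon> L"
proof -
  define \<rho> where "\<rho> = cos (pi * \<epsilon> / 2) ^ 2"
  have "0 < pi * \<epsilon> / 2" "pi * \<epsilon> / 2 < pi" using assms by (auto simp: field_simps)
  hence "sin (pi * \<epsilon> / 2) > 0" by (rule sin_gt_zero)
  hence "sin (pi * \<epsilon> / 2) ^ 2 > 0" by simp
  hence "\<rho> < 1" unfolding \<rho>_def cos_squared_eq by simp
  moreover have "0 \<le> \<rho>" unfolding \<rho>_def by simp
  ultimately have \<rho>: "0 \<le> \<rho>" "\<rho> < 1" by auto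
  have "(\<lambda>n. real n * \<rho> ^ n) \<longlonglongrightarrow> 0" using \<rho> by (intro powser_times_n_limit_0) auto
  hence "(\<lambda>n. 2 * real K * (real n * \<rho> ^ n)) \<longlonglongrightarrow> 2 * real K * 0" by (intro tendsto_intros)
  hence "\<forall>\<^sub>F n in sequentially. 2 * real K * (real n * \<rho> ^ n) < 1" by (intro order_tendstoD) auto
  with eventually_gt_at_top[of 0] have "\<forall>\<^sub>F n in sequentially. n > 0 \<and> 2 * real K * (real n * \<rho> ^ n) < 1"
    by eventually_elim auto
  then obtain L where L: "L > 0" "2 * real K * (real L * \<rho> ^ L) < 1"
    using eventually_happens'[OF sequentially_bot] by blast
  have "real K * \<rho> ^ L < 1 / (2 * real L)" using L by (simp add: field_simps)
  also have "\<dots> \<le> real (2 * L choose L) / 4 ^ L"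
    using central_binomial_lower_bound[OF L(1)] by (simp add: field_simps)
  finally show ?thesis using that unfolding \<rho>_def by blast
qed

lemma prod_primes_dvd:
  fixes A :: int
  assumes "finite Q" "\<And>q. q \<in> Q \<Longrightarrow> prime q \<and> int q dvd A"
  shows "int (\<Prod>Q) dvd A"
  using assms
proof (induction Q rule: finite_induct)
  case (insert q Q)
  have "coprime q (\<Prod>Q)"
    using insert by (intro prod_coprime_right) (auto intro: primes_coprime)
  hence "coprime (int q) (int (\<Prod>Q))" by (simp only: coprime_int_iff)
  hence "int q * int (\<Prod>Q) dvd A" using insert by (intro divides_mult) auto
  thus ?case using insert by simp
qed auto

lemma card_prime_divisors_le:
  fixes A :: int
  assumes "finite Q" "\<And>q. q \<in> Q \<Longrightarrow> prime q \<and> int q dvd A" "A \<noteq> 0" "\<bar>A\<bar> < 2 ^ E"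
  shows "card Q \<le> E"
proof -
  have "(2::nat) ^ card Q = (\<Prod>q\<in>Q. 2)" by simp
  also have "\<dots> \<le> \<Prod>Q" using assms by (intro prod_mono) (auto intro: prime_ge_2_nat)
  finally have "(2::int) ^ card Q \<le> int (\<Prod>Q)" by (metis of_nat_le_iff of_nat_numeral of_nat_power)
  also have "\<dots> \<le> \<bar>A\<bar>" using prod_primes_dvd[OF assms(1,2)] assms(3) by (intro zdvd_imp_le) auto
  also have "\<dots> < 2 ^ E" by fact
  finally have "card Q < E" by (simp add: power_strict_increasing_iff)
  thus ?thesis by simp
qed

text \<open>
  Multiplied by the product of all p in I, a relation between their inverses becomes the divisibility by q
  of the sum of h(p) times the product of the other primes. That integer is nonzero: modulo a p with
  h(p) \<noteq> 0 only one summand remains, and |h(p)| < p. So each of the (2L + 1)^K coefficient vectors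
  excludes at most E primes q.
\<close>
lemma exists_independent_prime:
  fixes I Q :: "nat set" and n L K E :: nat
  assumes I: "finite I" "card I \<le> K" "\<And>p. p \<in> I \<Longrightarrow> prime p \<and> L < p \<and> p \<le> n"
    and Q: "finite Q" "\<And>q. q \<in> Q \<Longrightarrow> prime q" "Q \<inter> I = {}"
    and E: "K * L * n ^ K < 2 ^ E"
    and big: "card Q > (2 * L + 1) ^ K * E"
  obtains q where "q \<in> Q" "\<And>h \<alpha>. (\<And>p. p \<in> I \<Longrightarrow> [\<alpha> p * int p = 1] (mod int q)) \<Longrightarrow>
     (\<forall>p\<in>I. \<bar>h p\<bar> \<le> int L) \<Longrightarrow> int q dvd (\<Sum>p\<in>I. h p * \<alpha> p) \<Longrightarrow> \<forall>p\<in>I. h p = 0"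
proof -
  define A where "A = (\<lambda>h :: nat \<Rightarrow> int. \<Sum>p\<in>I. h p * int (\<Prod>(I - {p})))"
  define H where "H = {h \<in> PiE I (\<lambda>_. {- int L..int L}). \<exists>p\<in>I. h p \<noteq> 0}"
  define Bad where "Bad = (\<lambda>h. {q\<in>Q. int q dvd A h})"
  have Hfin: "finite H" unfolding H_def
    by (rule finite_subset[OF _ finite_PiE[OF I(1), of "\<lambda>_. {- int L..int L}"]]) auto
  have Hcard: "card H \<le> (2 * L + 1) ^ K"
  proof -
    have "card H \<le> card (PiE I (\<lambda>_. {- int L..int L}))"
      unfolding H_def using I by (intro card_mono finite_PiE) auto
    also have "\<dots> = card {- int L..int L} ^ card I" using I by (simp add: card_PiE)
    also have "card {- int L..int L} = 2 * L + 1"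
    proof -
      have "card {- int L..int L} = nat (2 * int L + 1)" by simp
      thus ?thesis by linarith
    qed
    also have "(2 * L + 1) ^ card I \<le> (2 * L + 1) ^ K" using I by (intro power_increasing) auto
    finally show ?thesis .
  qed
  have bad: "card (Bad h) \<le> E" if h: "h \<in> H" for h
  proof (rule card_prime_divisors_le)
    show "finite (Bad h)" using Q by (simp add: Bad_def)
    show "prime q \<and> int q dvd A h" if "q \<in> Bad h" for q using that Q by (simp add: Bad_def)
    obtain p0 where p0: "p0 \<in> I" "h p0 \<noteq> 0" using h by (auto simp: H_def)
    have hb: "\<bar>h p\<bar> \<le> int L" if "p \<in> I" for p using h that by (auto simp: H_def PiE_iff)
    have Pp: "prime p0" "L < p0" using I p0 by auto
    show "A h \<noteq> 0"
    proof
      assume "A h = 0"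
      hence "h p0 * int (\<Prod>(I - {p0})) = - (\<Sum>p\<in>I-{p0}. h p * int (\<Prod>(I - {p})))"
        unfolding A_def using p0 I by (simp add: sum.remove)
      moreover have "int p0 dvd (\<Sum>p\<in>I-{p0}. h p * int (\<Prod>(I - {p})))"
      proof (rule dvd_sum)
        fix p assume "p \<in> I - {p0}"
        hence "p0 dvd \<Prod>(I - {p})" using p0 I by (intro dvd_prodI[of _ _ "\<lambda>x. x", simplified]) auto
        thus "int p0 dvd h p * int (\<Prod>(I - {p}))" by (intro dvd_mult) (simp only: int_dvd_int_iff)
      qed
      ultimately have "int p0 dvd h p0 * int (\<Prod>(I - {p0}))" by simp
      moreover have "prime (int p0)" using Pp by simp
      ultimately have "int p0 dvd h p0 \<or> int p0 dvd int (\<Prod>(I - {p0}))" by (simp only: prime_dvd_mult_iff)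
      moreover have "\<not> int p0 dvd h p0"
        using zdvd_imp_le[of "int p0" "\<bar>h p0\<bar>"] p0 hb[OF p0(1)] Pp by auto
      moreover have "\<not> p0 dvd \<Prod>(I - {p0})"
      proof
        assume "p0 dvd \<Prod>(I - {p0})"
        then obtain p where "p \<in> I - {p0}" "p0 dvd p"
          using prime_dvd_prod_iff[of "I - {p0}" p0 "\<lambda>x. x"] I Pp by auto
        thus False using I Pp primes_dvd_imp_eq by blast
      qed
      ultimately show False by (auto simp only: int_dvd_int_iff)
    qed
    have "\<bar>A h\<bar> \<le> (\<Sum>p\<in>I. \<bar>h p * int (\<Prod>(I - {p}))\<bar>)" unfolding A_def by (rule sum_abs)
    also have "\<dots> \<le> (\<Sum>p\<in>I. int L * int n ^ K)"
    proof (rule sum_mono)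
      fix p assume p: "p \<in> I"
      have n1: "n \<ge> 1" using I(3)[OF p] prime_gt_0_nat[of p] by linarith
      have "\<Prod>(I - {p}) \<le> (\<Prod>x\<in>I-{p}. n)" using I by (intro prod_mono) auto
      also have "\<dots> = n ^ card (I - {p})" by simp
      also have "\<dots> \<le> n ^ K" using n1 I p by (intro power_increasing) (auto simp: card_Diff_singleton)
      finally have "int (\<Prod>(I - {p})) \<le> int n ^ K" by (metis of_nat_le_iff of_nat_power)
      thus "\<bar>h p * int (\<Prod>(I - {p}))\<bar> \<le> int L * int n ^ K"
        unfolding abs_mult abs_of_nat using hb[OF p] by (intro mult_mono) (auto intro: prod_nonneg)
    qed
    also have "\<dots> = int (card I) * (int L * int n ^ K)" by simp
    also have "\<dots> \<le> int K * (int L * int n ^ K)" using I by (intro mult_right_mono) auto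
    also have "\<dots> = int (K * L * n ^ K)" by simp
    also have "\<dots> < 2 ^ E" using E by (metis of_nat_less_iff of_nat_numeral of_nat_power)
    finally show "\<bar>A h\<bar> < 2 ^ E" .
  qed
  have "card (\<Union>h\<in>H. Bad h) \<le> (\<Sum>h\<in>H. card (Bad h))" by (rule card_UN_le[OF Hfin])
  also have "\<dots> \<le> (\<Sum>h\<in>H. E)" by (intro sum_mono bad)
  also have "\<dots> \<le> (2 * L + 1) ^ K * E" using Hcard by simp
  also have "\<dots> < card Q" by (rule big)
  finally have "\<not> Q \<subseteq> (\<Union>h\<in>H. Bad h)"
    using card_mono[of "\<Union>h\<in>H. Bad h" Q] Hfin Q by (auto simp: Bad_def)
  then obtain q where q: "q \<in> Q" "\<And>h. h \<in> H \<Longrightarrow> \<not> int q dvd A h" by (auto simp: Bad_def)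
  show ?thesis
  proof (rule that[OF q(1)])
    fix h \<alpha> assume \<alpha>: "\<And>p. p \<in> I \<Longrightarrow> [\<alpha> p * int p = 1] (mod int q)"
      and h: "\<forall>p\<in>I. \<bar>h p\<bar> \<le> int L" and d: "int q dvd (\<Sum>p\<in>I. h p * \<alpha> p)"
    define h' where "h' = restrict h I"
    have "[int (\<Prod>I) * (\<Sum>p\<in>I. h p * \<alpha> p) = A h'] (mod int q)"
    proof -
      have "int (\<Prod>I) * (\<Sum>p\<in>I. h p * \<alpha> p) = (\<Sum>p\<in>I. h' p * int (\<Prod>(I - {p})) * (\<alpha> p * int p))"
        unfolding sum_distrib_left
      proof (intro sum.cong refl)
        fix p assume p: "p \<in> I"
        have "\<Prod>I = p * \<Prod>(I - {p})" using prod.remove[OF I(1) p, of "\<lambda>x. x"] by simp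
        thus "int (\<Prod>I) * (h p * \<alpha> p) = h' p * int (\<Prod>(I - {p})) * (\<alpha> p * int p)"
          using p by (simp add: h'_def)
      qed
      also have "[\<dots> = (\<Sum>p\<in>I. h' p * int (\<Prod>(I - {p})) * 1)] (mod int q)"
        by (intro cong_sum cong_mult cong_refl \<alpha>)
      finally show ?thesis by (simp add: A_def)
    qed
    hence "int q dvd A h'" using d by (metis cong_dvd_iff dvd_mult)
    hence "h' \<notin> H" using q(2) by blast
    moreover have "h' \<in> PiE I (\<lambda>_. {- int L..int L})" using h by (force simp: h'_def abs_le_iff)
    ultimately show "\<forall>p\<in>I. h p = 0" by (auto simp: H_def h'_def)
  qed
qed

section \<open>Packing the primes of a short interval\<close>

text \<open>
  Of pq - p - q - t and t, not both are combinations of p and q with nonnegative coefficients.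
\<close>
lemma no_collision_frobenius:
  fixes p q A B a b :: int
  assumes "coprime p q" "p > 0" "q > 0" "A \<ge> 0" "B \<ge> 0" "a \<ge> 0" "b \<ge> 0"
    and eq: "A * p + B * q + a * p + b * q = p * q - p - q"
  shows False
proof -
  have e: "p * q = (A + a + 1) * p + (B + b + 1) * q" using eq by (simp add: algebra_simps)
  have "(B + b + 1) * q = p * (q - (A + a + 1))" using e by (simp add: algebra_simps)
  hence "p dvd (B + b + 1) * q" by simp
  hence "p dvd B + b + 1" using assms(1) by (simp add: coprime_dvd_mult_left_iff)
  hence 1: "p \<le> B + b + 1" using assms by (intro zdvd_imp_le) auto
  have "(A + a + 1) * p > 0" using assms by simp
  moreover have "p * q \<le> (B + b + 1) * q" using 1 assms by (intro mult_right_mono) auto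
  ultimately show False using e by linarith
qed

lemma greedy_step:
  fixes I Q :: "nat set" and n L K E :: nat
  assumes I: "finite I" "card I \<le> K" "\<And>p. p \<in> I \<Longrightarrow> prime p \<and> L < p \<and> p \<le> n"
    and Q: "finite Q" "\<And>q. q \<in> Q \<Longrightarrow> prime q" "Q \<inter> I = {}"
    and E: "K * L * n ^ K < 2 ^ E"
    and big: "card Q > (2 * L + 1) ^ K * E"
    and \<epsilon>: "0 < \<epsilon>" "\<epsilon> < 1"
    and L: "peaked_exponent K \<epsilon> L"
  obtains q where "q \<in> Q" "\<And>c :: nat \<Rightarrow> int. \<exists>r. \<forall>p\<in>I. \<exists>a\<ge>0. of_int a \<le> \<epsilon> * real q \<and> int q dvd r - c p - a * int p"
proof -
  obtain q where q: "q \<in> Q" and ind: "\<And>h \<alpha>. (\<And>p. p \<in> I \<Longrightarrow> [\<alpha> p * int p = 1] (mod int q)) \<Longrightarrow>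
     (\<forall>p\<in>I. \<bar>h p\<bar> \<le> int L) \<Longrightarrow> int q dvd (\<Sum>p\<in>I. h p * \<alpha> p) \<Longrightarrow> \<forall>p\<in>I. h p = 0"
    using exists_independent_prime[OF I Q E big] by blast
  have qp: "prime q" "q > 0" using Q(2)[OF q] prime_gt_0_nat by auto
  have "\<exists>a. [a * int p = 1] (mod int q)" if p: "p \<in> I" for p
  proof -
    have "coprime p q" using I(3)[OF p] qp Q(3) q p by (intro primes_coprime) auto
    hence "coprime (int p) (int q)" by simp
    from cong_solve_coprime_int[OF this] show ?thesis by (simp add: mult.commute)
  qed
  then obtain \<alpha> where \<alpha>: "\<And>p. p \<in> I \<Longrightarrow> [\<alpha> p * int p = 1] (mod int q)" by metis
  have ind': "\<And>h. (\<forall>p\<in>I. \<bar>h p\<bar> \<le> int L) \<Longrightarrow> int q dvd (\<Sum>p\<in>I. h p * \<alpha> p) \<Longrightarrow> \<forall>p\<in>I. h p = 0"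
    using ind[of \<alpha>] \<alpha> by blast
  have "real (card I) * (cos (pi * \<epsilon> / 2) ^ 2) ^ L \<le> real K * (cos (pi * \<epsilon> / 2) ^ 2) ^ L"
    using I by (intro mult_right_mono) auto
  hence L': "peaked_exponent (card I) \<epsilon> L" using L by linarith
  show ?thesis
  proof (rule that[OF q])
    fix c :: "nat \<Rightarrow> int"
    obtain r :: nat where r: "\<And>p. p \<in> I \<Longrightarrow> of_int (((int r - c p) * \<alpha> p) mod int q) \<le> \<epsilon> * real q"
      using kronecker_mod[OF I(1) qp(2) ind' \<epsilon> L', where c = c] by blast
    show "\<exists>r. \<forall>p\<in>I. \<exists>a\<ge>0. of_int a \<le> \<epsilon> * real q \<and> int q dvd r - c p - a * int p"
    proof (rule exI[of _ "int r"], rule ballI)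
      fix p assume p: "p \<in> I"
      define a where "a = ((int r - c p) * \<alpha> p) mod int q"
      have "[a * int p = ((int r - c p) * \<alpha> p) * int p] (mod int q)"
        unfolding a_def by (intro cong_mult cong_refl) (simp add: cong_def)
      also have "((int r - c p) * \<alpha> p) * int p = (int r - c p) * (\<alpha> p * int p)" by simp
      also have "[\<dots> = (int r - c p) * 1] (mod int q)" by (intro cong_mult cong_refl \<alpha> p)
      finally have "[a * int p = int r - c p] (mod int q)" by simp
      hence "int q dvd (int r - c p) - a * int p" by (metis cong_iff_dvd_diff cong_sym)
      moreover have "a \<ge> 0" using qp by (simp add: a_def)
      ultimately show "\<exists>a\<ge>0. of_int a \<le> \<epsilon> * real q \<and> int q dvd int r - c p - a * int p"
        using r[OF p] by (auto simp: a_def)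
    qed
  qed
qed

text \<open>
  The i-th progression starts in a window of the length of its own difference at iS: the window leaves
  room for every residue class modulo that difference.
\<close>
definition chain_placed :: "nat \<Rightarrow> nat \<Rightarrow> nat list \<Rightarrow> (nat \<Rightarrow> int) \<Rightarrow> bool" where
  "chain_placed n S ps x \<longleftrightarrow> distinct ps \<and>
     (\<forall>i<length ps. int (i * S) \<le> x (ps ! i) \<and> x (ps ! i) < int (i * S) + int (ps ! i)) \<and>
     (\<forall>j<length ps. \<forall>i<j. ap (x (ps ! i) - int (ps ! i)) n (ps ! i) \<inter>
          ap (x (ps ! j) - int (ps ! j)) n (ps ! j) = {})"

text \<open>
  For p earlier in the chain, with last element e, the number c(p) = e - (p - 1)(q - 1) + 1 is chosen so
  that a new progression started at y avoids the one of p as soon as y - c(p) is a combination ap + bq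
  with a, b \<ge> 0. Fixing a \<le> \<epsilon>q to give the right residue modulo q, b is nonnegative because S exceeds
  p(n - q) by at least \<epsilon>n^2. Progressions K or more places back have already ended.
\<close>
lemma chain_extend:
  fixes P :: "nat set" and n u w S L K E :: nat
  assumes P: "finite P" "\<And>p. p \<in> P \<Longrightarrow> prime p \<and> L < p \<and> u < p \<and> p \<le> u + w" "u + w \<le> n"
    and \<epsilon>: "0 < \<epsilon>" "\<epsilon> < 1"
    and L: "peaked_exponent K \<epsilon> L"
    and K: "real K * \<epsilon> \<ge> 1"
    and E: "K * L * n ^ K < 2 ^ E"
    and S: "real S \<ge> real (u + w) * (real n - real u) + 2 * real n + \<epsilon> * real n ^ 2"
    and ch: "chain_placed n S ps x" "set ps \<subseteq> P"
    and big: "card P > length ps + (2 * L + 1) ^ K * E"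
  obtains q y where "q \<in> P" "q \<notin> set ps" "chain_placed n S (ps @ [q]) (x(q := y))"
proof -
  define m where "m = length ps"
  \<comment> \<open>The places in the chain whose progressions may still reach the new window.\<close>
  define idx where "idx = {i. i < m \<and> m < i + K}"
  define I where "I = (\<lambda>i. ps ! i) ` idx"
  define Q where "Q = P - set ps"
  have dist: "distinct ps" using ch by (simp add: chain_placed_def)
  have idxf: "finite idx" "card idx \<le> K"
  proof -
    have sub: "idx \<subseteq> {m - K..<m}" by (auto simp: idx_def)
    show "finite idx" using finite_subset[OF sub] by simp
    show "card idx \<le> K" using card_mono[OF _ sub] by simp
  qed
  have I: "finite I" "card I \<le> K" "I \<subseteq> set ps"
    using idxf card_image_le[of idx "\<lambda>i. ps ! i"] by (auto simp: I_def idx_def m_def)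
  have IP: "prime p \<and> L < p \<and> p \<le> n" if "p \<in> I" for p
    using I that ch(2) P(2)[of p] P(3) by auto
  have "card Q = card P - m" unfolding Q_def m_def
    using ch(2) P(1) dist by (simp add: card_Diff_subset distinct_card)
  hence Qbig: "card Q > (2 * L + 1) ^ K * E" using big by (simp add: m_def)
  obtain q where q: "q \<in> Q" and qr: "\<And>c :: nat \<Rightarrow> int. \<exists>r. \<forall>p\<in>I. \<exists>a\<ge>0. of_int a \<le> \<epsilon> * real q \<and> int q dvd r - c p - a * int p"
  proof (rule greedy_step[OF I(1,2) IP _ _ _ E Qbig \<epsilon> L])
    show "finite Q" "\<And>q. q \<in> Q \<Longrightarrow> prime q" "Q \<inter> I = {}"
      using P I by (auto simp: Q_def)
  qed (assumption | rule that)+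
  have qP: "q \<in> P" "q \<notin> set ps" "prime q" "q > 0" "u < q" "q \<le> n"
    using q P(2)[of q] P(3) by (auto simp: Q_def prime_gt_0_nat)
  define c where "c = (\<lambda>p::nat. x p - int p + int n * int p - (int p - 1) * (int q - 1) + 1)"
  obtain r where r: "\<And>p. p \<in> I \<Longrightarrow> \<exists>a\<ge>0. of_int a \<le> \<epsilon> * real q \<and> int q dvd r - c p - a * int p"
    using qr[of c] by blast
  \<comment> \<open>The starting point in the window of length q at mS with the residue of r modulo q.\<close>
  define y where "y = int (m * S) + (r - int (m * S)) mod int q"
  have y: "int (m * S) \<le> y" "y < int (m * S) + int q" using qP by (simp_all add: y_def)
  have yr: "int q dvd y - r"
  proof -
    have "y - r = - (int q * ((r - int (m * S)) div int q))"
      unfolding y_def using mult_div_mod_eq[of "int q" "r - int (m * S)"] by linarith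
    thus ?thesis by simp
  qed
  have S0: "real n ^ 2 * \<epsilon> \<le> real S"
  proof -
    have "real (u + w) * (real n - real u) \<ge> 0" using P(3) by (intro mult_nonneg_nonneg) auto
    thus ?thesis using S by (simp add: mult.commute)
  qed
  have disj: "ap (x (ps ! i) - int (ps ! i)) n (ps ! i) \<inter>
          ap (y - int q) n q = {}" if i: "i < m" for i
  proof (rule equals0I)
    define p where "p = ps ! i"
    have pP: "p \<in> P" "p \<in> set ps" using i ch(2) by (auto simp: p_def m_def)
    have pp: "prime p" "p > 0" "p \<le> u + w" "p \<le> n" "p \<noteq> q"
      using P(2)[OF pP(1)] P(3) qP pP by (auto simp: prime_gt_0_nat)
    have xp: "int (i * S) \<le> x p" "x p < int (i * S) + int p"
      using ch(1) i unfolding chain_placed_def p_def m_def by auto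
    fix z assume "z \<in> ap (x (ps ! i) - int (ps ! i)) n (ps ! i) \<inter>
          ap (y - int q) n q"
    hence z: "int p dvd z - (x p - int p)" "z \<le> x p - int p + int n * int p"
        "int q dvd z - (y - int q)" "y \<le> z"
      using pp qP by (auto simp: mem_translate_progression_iff p_def[symmetric])
    show False
    proof (cases "m < i + K")
      case False
      hence "i + K \<le> m" by simp
      hence "i * S + K * S \<le> m * S" by (metis add_mult_distrib mult_le_mono1)
      hence 1: "int (i * S) + int (K * S) \<le> int (m * S)" by (metis of_nat_add of_nat_le_iff)
      have "real n ^ 2 * 1 \<le> real n ^ 2 * (real K * \<epsilon>)" using K by (intro mult_left_mono) auto
      also have "\<dots> = real K * (real n ^ 2 * \<epsilon>)" by simp
      also have "\<dots> \<le> real K * real S" using S0 by (intro mult_left_mono) auto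
      finally have "real (n ^ 2) \<le> real (K * S)" by simp
      hence "n ^ 2 \<le> K * S" by (simp only: of_nat_le_iff)
      hence 2: "int n * int n \<le> int (K * S)" by (metis of_nat_le_iff of_nat_mult power2_eq_square)
      have "int n * int p \<le> int n * int n" using pp by (intro mult_left_mono) auto
      thus False using 1 2 z(2,4) y(1) xp(2) by linarith
    next
      case True
      hence "p \<in> I" using i by (auto simp: I_def idx_def p_def)
      from r[OF this] obtain a where a: "a \<ge> 0" "of_int a \<le> \<epsilon> * real q" "int q dvd r - c p - a * int p" by blast
      have "int q dvd (y - r) + (r - c p - a * int p)" using yr a(3) by (rule dvd_add)
      hence "int q dvd y - c p - a * int p" by (simp add: algebra_simps)
      then obtain b where b: "y - c p - a * int p = int q * b" by (auto elim: dvdE)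
      have "real_of_int (a * int p) \<le> \<epsilon> * real n ^ 2"
      proof -
        have "real_of_int (a * int p) \<le> (\<epsilon> * real q) * real p"
          using a(2) by (simp add: mult_right_mono)
        also have "\<dots> \<le> (\<epsilon> * real n) * real n" using pp qP \<epsilon> by (intro mult_mono) auto
        finally show ?thesis by (simp add: power2_eq_square mult.assoc)
      qed
      moreover have "real p * (real n - real q) \<le> real (u + w) * (real n - real u)"
        using pp qP by (intro mult_mono) auto
      ultimately have "real_of_int (a * int p) + real p * (real n - real q) + 2 * real n \<le> real S"
        using S by linarith
      hence "real_of_int (a * int p + int p * (int n - int q) + 2 * int n) \<le> real_of_int (int S)" by simp
      hence 3: "a * int p + int p * (int n - int q) + 2 * int n \<le> int S" by (simp only: of_int_le_iff)
      have "int (i * S) + int S \<le> int (m * S)"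
        using i by (metis Suc_leI add.commute mult_Suc mult_le_mono1 of_nat_add of_nat_le_iff)
      hence 4: "c p \<le> int (m * S) - int S + int n * int p - (int p - 1) * (int q - 1) + 1"
        using xp(2) unfolding c_def by linarith
      have 3: "a * int p + int n * int p - int p * int q + 2 * int n \<le> int S"
        using 3 by (simp add: algebra_simps)
      have 4: "c p \<le> int (m * S) - int S + int n * int p - int p * int q + int p + int q"
        using 4 by (simp add: algebra_simps)
      have "y - c p - a * int p \<ge> 0" using 3 4 y(1) pp(4) qP(6) by linarith
      hence "int q * b \<ge> 0" using b by simp
      hence b0: "b \<ge> 0" using qP by (simp add: zero_le_mult_iff)
      obtain A' where A': "z - (x p - int p) = int p * A'" using z(1) by (auto elim: dvdE)
      obtain B' where B': "z - (y - int q) = int q * B'" using z(3) by (auto elim: dvdE)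
      define A where "A = int n - A'"
      define B where "B = B' - 1"
      have zA: "z = x p - int p + int n * int p - A * int p" using A' by (simp add: A_def algebra_simps)
      have zB: "z = y + B * int q" using B' by (simp add: B_def algebra_simps)
      have "A * int p \<ge> 0" using z(2) zA by linarith
      hence A0: "A \<ge> 0" using pp by (simp add: zero_le_mult_iff)
      have "B * int q \<ge> 0" using z(4) zB by linarith
      hence B0: "B \<ge> 0" using qP by (simp add: zero_le_mult_iff)
      have "coprime p q" using pp qP by (intro primes_coprime) auto
      hence cop: "coprime (int p) (int q)" by simp
      show False
      proof (rule no_collision_frobenius[OF cop _ _ A0 B0 a(1) b0])
        show "A * int p + B * int q + a * int p + b * int q = int p * int q - int p - int q"
          using zA zB b unfolding c_def by (simp add: algebra_simps)
      qed (use pp qP in auto)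
    qed
  qed
  have nq: "ps ! i \<noteq> q" if "i < m" for i using that qP by (metis m_def nth_mem)
  have "chain_placed n S (ps @ [q]) (x(q := y))"
    unfolding chain_placed_def
  proof (intro conjI allI impI)
    show "distinct (ps @ [q])" using dist qP by simp
  next
    fix i assume "i < length (ps @ [q])"
    hence i: "i < m \<or> i = m" by (auto simp: m_def)
    show "int (i * S) \<le> (x(q := y)) ((ps @ [q]) ! i)" "(x(q := y)) ((ps @ [q]) ! i) < int (i * S) + int ((ps @ [q]) ! i)"
      using i y ch(1) nq unfolding chain_placed_def m_def by (auto simp: nth_append)
  next
    fix j i assume j: "j < length (ps @ [q])" and ij: "i < j"
    show "ap ((x(q := y)) ((ps @ [q]) ! i) - int ((ps @ [q]) ! i)) n ((ps @ [q]) ! i) \<inter>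
       ap ((x(q := y)) ((ps @ [q]) ! j) - int ((ps @ [q]) ! j)) n ((ps @ [q]) ! j) = {}"
    proof (cases "j < m")
      case True
      thus ?thesis using ch(1) ij nq[of i] nq[of j] unfolding chain_placed_def m_def by (simp add: nth_append)
    next
      case False
      hence "j = m" using j by (simp add: m_def)
      thus ?thesis using disj[of i] ij nq[of i] by (simp add: nth_append m_def)
    qed
  qed
  thus ?thesis using that qP by blast
qed

lemma chain_exists:
  fixes P :: "nat set" and n u w S L K E m :: nat
  assumes P: "finite P" "\<And>p. p \<in> P \<Longrightarrow> prime p \<and> L < p \<and> u < p \<and> p \<le> u + w" "u + w \<le> n"
    and \<epsilon>: "0 < \<epsilon>" "\<epsilon> < 1"
    and L: "peaked_exponent K \<epsilon> L"
    and K: "real K * \<epsilon> \<ge> 1"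
    and E: "K * L * n ^ K < 2 ^ E"
    and S: "real S \<ge> real (u + w) * (real n - real u) + 2 * real n + \<epsilon> * real n ^ 2"
    and m: "m \<le> card P - (2 * L + 1) ^ K * E"
  shows "\<exists>ps x. length ps = m \<and> set ps \<subseteq> P \<and> chain_placed n S ps x"
  using m
proof (induction m)
  case 0
  show ?case by (intro exI[of _ "[]"]) (simp add: chain_placed_def)
next
  case (Suc m)
  then obtain ps x where ps: "length ps = m" "set ps \<subseteq> P" "chain_placed n S ps x" by auto
  have "card P > length ps + (2 * L + 1) ^ K * E" using Suc.prems ps(1) by linarith
  from chain_extend[OF P \<epsilon> L K E S ps(3,2) this] obtain q y where
    q: "q \<in> P" "chain_placed n S (ps @ [q]) (x(q := y))" by blast
  have "length (ps @ [q]) = Suc m" "set (ps @ [q]) \<subseteq> P" using ps q(1) by auto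
  thus ?case using q(2) by blast
qed

lemma translate_disjoint: "A \<inter> B = {} \<Longrightarrow> translate s A \<inter> translate s B = {}"
  by (auto simp: translate_def)

lemma chain_packed:
  assumes ch: "chain_placed n S ps x" and ps: "\<And>p. p \<in> set ps \<Longrightarrow> 0 < p \<and> p \<le> n"
  shows "can_be_packed (set ps) (progression n) (length ps * S + n ^ 2)"
  unfolding can_be_packed_def
proof (intro exI[of _ "\<lambda>p. 1 + (x p - int p)"] conjI ballI)
  fix p assume p: "p \<in> set ps"
  then obtain i where i: "i < length ps" "p = ps ! i" by (auto simp: in_set_conv_nth)
  have xp: "int (i * S) \<le> x p" "x p < int (i * S) + int p"
    using ch i unfolding chain_placed_def by auto
  have "int (i * S) \<le> int (length ps * S)" using i by (intro of_nat_mono mult_right_mono) auto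
  moreover have "int n * int p \<le> int n ^ 2" unfolding power2_eq_square using ps[OF p] by (intro mult_left_mono) auto
  ultimately have "int (i * S) + int n * int p \<le> int (length ps * S) + int n ^ 2" by (rule add_mono)
  hence "int (i * S) + int n * int p \<le> int (length ps * S + n ^ 2)" by simp
  moreover have "0 \<le> int (i * S)" by (rule of_nat_0_le_iff)
  ultimately show "ap (1 + (x p - int p)) n p \<subseteq> {1..int (length ps * S + n ^ 2)}"
    using xp ps[OF p] by (auto simp: mem_translate_progression_iff simp del: of_nat_mult of_nat_add)
next
  have key: "ap (x p - int p) n p \<inter> ap (x q - int q) n q = {}"
    if pq: "p \<in> set ps" "q \<in> set ps" "p \<noteq> q" for p q
  proof -
    obtain i j where ij: "i < length ps" "p = ps ! i" "j < length ps" "q = ps ! j"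
      using pq by (auto simp: in_set_conv_nth)
    have "i \<noteq> j" using ij pq by auto
    thus ?thesis using ch ij unfolding chain_placed_def by (metis Int_commute nat_neq_iff)
  qed
  show "disjoint_family_on (\<lambda>d. ap (1 + (x d - int d)) n d) (set ps)"
    unfolding disjoint_family_on_def translate_translate[symmetric]
    using translate_disjoint[OF key] by blast
qed

text \<open>
  The greedy chain stops when O(log n) primes remain; those, and the primes up to L for which a coefficient
  bounded by L may vanish modulo p, are packed separately with cost at most n^2 each.
\<close>
lemma block_packed:
  fixes P :: "nat set" and n u w S L K E :: nat
  assumes P: "finite P" "\<And>p. p \<in> P \<Longrightarrow> prime p \<and> u < p \<and> p \<le> u + w" "u + w \<le> n"
    and \<epsilon>: "0 < \<epsilon>" "\<epsilon> < 1"
    and L: "peaked_exponent K \<epsilon> L"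
    and K: "real K * \<epsilon> \<ge> 1"
    and E: "K * L * n ^ K < 2 ^ E"
    and S: "real S \<ge> real (u + w) * (real n - real u) + 2 * real n + \<epsilon> * real n ^ 2"
  shows "can_be_packed P (progression n) (card P * S + (1 + L + (2 * L + 1) ^ K * E) * n ^ 2)"
proof -
  define P1 where "P1 = {p \<in> P. L < p}"
  define C where "C = (2 * L + 1) ^ K * E"
  have P1: "finite P1" "P1 \<subseteq> P" using P by (auto simp: P1_def)
  have P1': "\<And>p. p \<in> P1 \<Longrightarrow> prime p \<and> L < p \<and> u < p \<and> p \<le> u + w" using P by (auto simp: P1_def)
  obtain ps x where ps: "length ps = card P1 - C" "set ps \<subseteq> P1" "chain_placed n S ps x"
    using chain_exists[OF P1(1) P1' P(3) \<epsilon> L K E S order.refl] by (auto simp: C_def)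
  have Pn: "0 < p \<and> p \<le> n" if "p \<in> P" for p using P(2)[OF that] P(3) by (auto simp: prime_gt_0_nat)
  define R where "R = P - set ps"
  have A: "can_be_packed (set ps) (progression n) (length ps * S + n ^ 2)"
    using ps P1 Pn by (intro chain_packed) auto
  have B: "can_be_packed R (progression n) (\<Sum>d\<in>R. n * d)"
    unfolding R_def using P Pn by (intro can_be_packed_finite) auto
  have AB: "can_be_packed (set ps \<union> R) (progression n) ((length ps * S + n ^ 2) + (\<Sum>d\<in>R. n * d))"
    by (intro can_be_packed_Un A B) (auto simp: R_def)
  have un: "set ps \<union> R = P" using ps P1 by (auto simp: R_def)
  have "card R \<le> L + C"
  proof -
    have "distinct ps" using ps(3) by (simp add: chain_placed_def)
    hence "card (P1 - set ps) = card P1 - (card P1 - C)"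
      using ps P1 by (simp add: card_Diff_subset distinct_card)
    hence 1: "card (P1 - set ps) \<le> C" by simp
    have "R \<subseteq> {1..L} \<union> (P1 - set ps)" using Pn by (auto simp: R_def P1_def Suc_le_eq)
    hence "card R \<le> card ({1..L} \<union> (P1 - set ps))" using P1 by (intro card_mono) auto
    also have "\<dots> \<le> L + card (P1 - set ps)" using card_Un_le[of "{1..L}" "P1 - set ps"] by simp
    finally show ?thesis using 1 by simp
  qed
  hence "(\<Sum>d\<in>R. n * d) \<le> (L + C) * n ^ 2"
  proof -
    have "(\<Sum>d\<in>R. n * d) \<le> (\<Sum>d\<in>R. n ^ 2)"
      unfolding power2_eq_square using Pn by (intro sum_mono mult_left_mono) (auto simp: R_def)
    also have "\<dots> = card R * n ^ 2" by simp
    also have "\<dots> \<le> (L + C) * n ^ 2" using \<open>card R \<le> L + C\<close> by (intro mult_right_mono) auto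
    finally show ?thesis .
  qed
  moreover have "length ps * S \<le> card P * S"
    using ps(1) card_mono[OF P(1) P1(2)] by (intro mult_right_mono) auto
  ultimately have "(length ps * S + n ^ 2) + (\<Sum>d\<in>R. n * d) \<le> (card P * S + n ^ 2) + (L + C) * n ^ 2"
    by (intro add_mono) auto
  also have "\<dots> = card P * S + (1 + L + C) * n ^ 2" by (simp add: algebra_simps)
  finally have le: "(length ps * S + n ^ 2) + (\<Sum>d\<in>R. n * d) \<le> card P * S + (1 + L + C) * n ^ 2" .
  from can_be_packed_mono[OF AB[unfolded un] le] show ?thesis by (simp add: C_def)
qed

section \<open>Asymptotics\<close>

lemma finite_primes_le: "finite {p::nat. prime p \<and> p \<le> n}"
  by (rule finite_subset[of _ "{..n}"]) auto

lemma sum_primes_poly: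
  "(\<Sum>p | prime p \<and> p \<le> n. A * real p - B * real p ^ 2) = A * prime_power_sum 1 n - B * prime_power_sum 2 n"
  by (simp add: prime_power_sum_def sum_subtractf sum_distrib_left)

text \<open>
  The lower bound concerns odd primes, since AP(2) and AP(2p) do not have coprime differences. Dropping the
  prime 2 costs at most 2A.
\<close>
lemma sum_odd_primes_ge:
  assumes "A \<ge> 0" "B \<ge> 0"
  shows "(\<Sum>p | prime p \<and> odd p \<and> p \<le> n. A * real p - B * real p ^ 2) \<ge>
     A * prime_power_sum 1 n - B * prime_power_sum 2 n - 2 * A"
proof -
  let ?f = "\<lambda>p::nat. A * real p - B * real p ^ 2"
  let ?P = "{p::nat. prime p \<and> p \<le> n}" and ?O = "{p::nat. prime p \<and> odd p \<and> p \<le> n}"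
  have "?P \<subseteq> insert 2 ?O" by (auto dest: primes_dvd_imp_eq[OF two_is_prime_nat])
  hence eq: "?P = ?O \<or> ?P = insert 2 ?O" by auto
  have "sum ?f ?P \<le> sum ?f ?O + 2 * A"
  proof (cases "?P = ?O")
    case False
    hence "?P = insert 2 ?O" using eq by simp
    moreover have "finite ?O" by (rule finite_subset[of _ "{..n}"]) auto
    ultimately have "sum ?f ?P = ?f 2 + sum ?f ?O" by simp
    thus ?thesis using assms by simp
  qed (use assms in simp)
  thus ?thesis unfolding sum_primes_poly by simp
qed

lemma min_packing_lower_prime_sums:
  fixes D :: "nat set" and n k t :: nat
  assumes D: "finite D" "\<And>d. d \<in> D \<Longrightarrow> 0 < d" and k: "k < n" "{p. prime p \<and> p \<le> k} \<subseteq> D"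
    and t: "t \<le> k" "3 * t \<le> n" "\<And>p. prime p \<Longrightarrow> p \<le> t \<Longrightarrow> 2 * p \<in> D"
  shows "real (min_packing D n) \<ge> (real n - 1) * prime_power_sum 1 k - prime_power_sum 2 k
      + ((real n - 1) * prime_power_sum 1 t - 3 * prime_power_sum 2 t) / 2 - 3 * real n"
proof -
  let ?P = "{p::nat. prime p \<and> odd p \<and> p \<le> k}" and ?T = "{p::nat. prime p \<and> odd p \<and> p \<le> t}"
  have n: "real n - 1 \<ge> 0" using k by simp
  have "real (min_packing D n) \<ge> (\<Sum>p\<in>?P. (real n - 1) * real p - real p ^ 2)
           + (\<Sum>p\<in>?T. (real n - 1) * real p - 3 * real p ^ 2) / 2"
    by (rule min_packing_lower_bound[OF D]) (use k t in \<open>auto intro: order.trans[OF mult_le_mono2]\<close>)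
  moreover have "(\<Sum>p\<in>?P. (real n - 1) * real p - real p ^ 2) \<ge>
      (real n - 1) * prime_power_sum 1 k - prime_power_sum 2 k - 2 * (real n - 1)"
    using sum_odd_primes_ge[OF n, of 1 k] by simp
  moreover have "(\<Sum>p\<in>?T. (real n - 1) * real p - 3 * real p ^ 2) \<ge>
      (real n - 1) * prime_power_sum 1 t - 3 * prime_power_sum 2 t - 2 * (real n - 1)"
    using sum_odd_primes_ge[OF n, of 3 t] by simp
  moreover have "M \<ge> A + B / 2 - 3 * N" if "M \<ge> P + T / 2" "P \<ge> A - 2 * (N - 1)" "T \<ge> B - 2 * (N - 1)"
    for M P T A B N :: real using that by (simp add: field_simps)
  ultimately show ?thesis by blast
qed

lemma smallo_loss_from_limit:
  fixes f g h :: "nat \<Rightarrow> real"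
  assumes "h \<longlonglongrightarrow> c" "\<forall>\<^sub>F n in sequentially. f n \<ge> h n * g n"
  shows "\<exists>\<epsilon>. \<epsilon> \<in> o[at_top](\<lambda>_. 1) \<and> (\<forall>\<^sub>F n in at_top. f n \<ge> (c - \<epsilon> n) * g n)"
proof (intro exI[of _ "\<lambda>n. c - h n"] conjI)
  have "(\<lambda>n. c - h n) \<longlonglongrightarrow> c - c" by (intro tendsto_intros assms)
  thus "(\<lambda>n. c - h n) \<in> o[at_top](\<lambda>_. 1)" by (intro smalloI_tendsto) auto
qed (use assms in simp)

text \<open>
  For k = o(n) the squares are negligible, and the primes up to k and up to k/2 contribute 1/2 and
  (1/2)(1/8).
\<close>
lemma small_k_lower:
  fixes k :: "nat \<Rightarrow> nat"
  assumes top: "filterlim k at_top at_top" and small: "(\<lambda>n. real (k n)) \<in> o[at_top](\<lambda>n. real n)"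
  shows "\<exists>\<epsilon> :: nat \<Rightarrow> real. \<epsilon> \<in> o[at_top](\<lambda>_. 1) \<and>
           (\<forall>\<^sub>F n in at_top. real (min_packing {1..k n} n)
                \<ge> (9 / 16 - \<epsilon> n) * (real n * real (k n) ^ 2 / ln (real (k n))))"
proof -
  have ratio: "(\<lambda>n. real (k n) / real n) \<longlonglongrightarrow> 0" using smalloD_tendsto[OF small] .
  define h where "h = (\<lambda>n. (1 - 1 / real n) * (prime_power_sum 1 (k n) * ln (real (k n)) / real (k n) ^ 2)
     - real (k n) / real n * (prime_power_sum 2 (k n) * ln (real (k n)) / real (k n) ^ 3)
     + ((1 - 1 / real n) * (prime_power_sum 1 (k n div 2) * ln (real (k n)) / real (k n) ^ 2)
     - 3 * (real (k n) / real n) * (prime_power_sum 2 (k n div 2) * ln (real (k n)) / real (k n) ^ 3)) / 2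
     - 3 * (ln (real (k n)) / real (k n) ^ 2))"
  have inv: "(\<lambda>n::nat. 1 - 1 / real n) \<longlonglongrightarrow> 1" by real_asymp
  have lk: "(\<lambda>n. ln (real (k n)) / real (k n) ^ 2) \<longlonglongrightarrow> 0"
    by (rule filterlim_compose[OF _ top, of "\<lambda>m. ln (real m) / real m ^ 2"]) real_asymp
  have half: "(\<lambda>m. real (m div 2) / real m) \<longlonglongrightarrow> 1 / 2" using div_ratio[of 2] by simp
  note s = filterlim_compose[OF prime_sum_asymp top] filterlim_compose[OF prime_square_sum_asymp top]
  note s2 = filterlim_compose[OF prime_sum_scaled(1)[OF half] top] filterlim_compose[OF prime_sum_scaled(2)[OF half] top]
  have "h \<longlonglongrightarrow> 1 * (1 / 2) - 0 * (1 / 3) + (1 * ((1 / 2) ^ 2 / 2) - 3 * 0 * ((1 / 2) ^ 3 / 3)) / 2 - 3 * 0"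
    unfolding h_def by (intro tendsto_add tendsto_diff tendsto_mult tendsto_divide tendsto_const inv s s2 ratio lk) auto
  hence lim: "h \<longlonglongrightarrow> 9 / 16" by (simp add: power2_eq_square)
  have "\<forall>\<^sub>F n in sequentially. real (k n) / real n < 1 / 3" using ratio by (intro order_tendstoD) auto
  moreover have "\<forall>\<^sub>F n in sequentially. k n \<ge> 2" using top by (simp add: filterlim_at_top)
  ultimately have "\<forall>\<^sub>F n in sequentially. real (min_packing {1..k n} n) \<ge> h n * (real n * real (k n) ^ 2 / ln (real (k n)))"
    using eventually_gt_at_top[of 0]
  proof eventually_elim
    case (elim n)
    have kn: "3 * k n < n" using elim by (simp add: field_simps)
    have "real (min_packing {1..k n} n) \<ge> (real n - 1) * prime_power_sum 1 (k n) - prime_power_sum 2 (k n)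
      + ((real n - 1) * prime_power_sum 1 (k n div 2) - 3 * prime_power_sum 2 (k n div 2)) / 2 - 3 * real n"
      using kn by (intro min_packing_lower_prime_sums) (auto simp: Suc_le_eq prime_gt_0_nat)
    also have "(real n - 1) * prime_power_sum 1 (k n) - prime_power_sum 2 (k n)
      + ((real n - 1) * prime_power_sum 1 (k n div 2) - 3 * prime_power_sum 2 (k n div 2)) / 2 - 3 * real n
       = h n * (real n * real (k n) ^ 2 / ln (real (k n)))"
    proof -
      define K N where "K = real (k n)" and "N = real n"
      define l where "l = ln K"
      have "K > 0" "l > 0" "N > 0" using elim by (auto simp: K_def l_def N_def)
      thus ?thesis unfolding h_def K_def[symmetric] l_def[symmetric] N_def[symmetric]
        by (simp add: field_simps power2_eq_square power3_eq_cube)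
    qed
    finally show ?case .
  qed
  from smallo_loss_from_limit[OF lim this] show ?thesis .
qed

lemma linear_k_lower:
  fixes k :: "nat \<Rightarrow> nat" and l a :: real
  assumes l: "0 < l" "l < 1" and k: "(\<lambda>n. real (k n) / real n) \<longlonglongrightarrow> l" and a: "a = min (l / 2) (1 / 3)"
  shows "\<exists>\<epsilon> :: nat \<Rightarrow> real. \<epsilon> \<in> o[at_top](\<lambda>_. 1) \<and>
           (\<forall>\<^sub>F n in at_top. real (min_packing {1..k n} n)
                \<ge> (l ^ 2 / 2 - l ^ 3 / 3 + a ^ 2 / 4 - a ^ 3 / 2 - \<epsilon> n) * (real n ^ 3 / ln (real n)))"
proof -
  define t where "t = (\<lambda>n. min (k n div 2) (n div 3))"
  have a0: "a > 0" using l a by simp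
  note g = linear_growth[OF k l(1)]
  have "(\<lambda>n. real (k n div 2) / real (k n) * (real (k n) / real n)) \<longlonglongrightarrow> 1 / 2 * l"
    using filterlim_compose[OF div_ratio[of 2] g(1)] k by (intro tendsto_mult) auto
  hence k2: "(\<lambda>n. real (k n div 2) / real n) \<longlonglongrightarrow> l / 2"
    using Lim_transform_eventually[where g = "\<lambda>n. real (k n div 2) / real n"] g(3)
    by (force elim: eventually_mono)
  have "(\<lambda>n. min (real (k n div 2) / real n) (real (n div 3) / real n)) \<longlonglongrightarrow> a"
    unfolding a using div_ratio[of 3] by (intro tendsto_min k2) auto
  hence t: "(\<lambda>n. real (t n) / real n) \<longlonglongrightarrow> a"
    by (rule Lim_transform_eventually) (auto simp: t_def min_def divide_le_cancel intro!: always_eventually)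
  define h where "h = (\<lambda>n. (1 - 1 / real n) * (prime_power_sum 1 (k n) * ln (real n) / real n ^ 2)
     - prime_power_sum 2 (k n) * ln (real n) / real n ^ 3
     + ((1 - 1 / real n) * (prime_power_sum 1 (t n) * ln (real n) / real n ^ 2)
     - 3 * (prime_power_sum 2 (t n) * ln (real n) / real n ^ 3)) / 2
     - 3 * (ln (real n) / real n ^ 2))"
  have inv: "(\<lambda>n::nat. 1 - 1 / real n) \<longlonglongrightarrow> 1" by real_asymp
  have lk: "(\<lambda>n::nat. ln (real n) / real n ^ 2) \<longlonglongrightarrow> 0" by real_asymp
  have "h \<longlonglongrightarrow> 1 * (l ^ 2 / 2) - l ^ 3 / 3 + (1 * (a ^ 2 / 2) - 3 * (a ^ 3 / 3)) / 2 - 3 * 0"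
    unfolding h_def by (intro tendsto_add tendsto_diff tendsto_mult tendsto_divide tendsto_const inv
       prime_sum_scaled[OF k l(1)] prime_sum_scaled[OF t a0] lk) auto
  moreover have "1 * (l ^ 2 / 2) - l ^ 3 / 3 + (1 * (a ^ 2 / 2) - 3 * (a ^ 3 / 3)) / 2 - 3 * 0 =
      l ^ 2 / 2 - l ^ 3 / 3 + a ^ 2 / 4 - a ^ 3 / 2" by (simp add: diff_divide_distrib)
  ultimately have lim: "h \<longlonglongrightarrow> l ^ 2 / 2 - l ^ 3 / 3 + a ^ 2 / 4 - a ^ 3 / 2" by (simp only:)
  have "\<forall>\<^sub>F n in sequentially. real (k n) / real n < 1" using k l by (intro order_tendstoD) auto
  hence "\<forall>\<^sub>F n in sequentially. real (min_packing {1..k n} n) \<ge> h n * (real n ^ 3 / ln (real n))"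
    using eventually_ge_at_top[of 2]
  proof eventually_elim
    case (elim n)
    have kn: "k n < n" using elim by (simp add: field_simps)
    have "2 * p \<le> k n" if "p \<le> t n" for p
    proof -
      have "p \<le> k n div 2" using that by (simp add: t_def)
      thus ?thesis by linarith
    qed
    moreover have "t n \<le> k n" "3 * t n \<le> n" by (auto simp: t_def)
    ultimately have "real (min_packing {1..k n} n) \<ge> (real n - 1) * prime_power_sum 1 (k n) - prime_power_sum 2 (k n)
      + ((real n - 1) * prime_power_sum 1 (t n) - 3 * prime_power_sum 2 (t n)) / 2 - 3 * real n"
      using kn by (intro min_packing_lower_prime_sums) (auto simp: Suc_le_eq prime_gt_0_nat)
    also have "(real n - 1) * prime_power_sum 1 (k n) - prime_power_sum 2 (k n)
      + ((real n - 1) * prime_power_sum 1 (t n) - 3 * prime_power_sum 2 (t n)) / 2 - 3 * real n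
       = h n * (real n ^ 3 / ln (real n))"
    proof -
      define N where "N = real n"
      define L where "L = ln N"
      have "L > 0" "N > 0" using elim by (auto simp: L_def N_def)
      thus ?thesis unfolding h_def L_def[symmetric] N_def[symmetric]
        by (simp add: field_simps power2_eq_square power3_eq_cube)
    qed
    finally show ?case .
  qed
  from smallo_loss_from_limit[OF lim this] show ?thesis .
qed

lemma primes_upto_eq: "primes_upto (real n) = {p. prime p \<and> p \<le> n}"
  by (simp add: primes_upto_def)

lemma primes_lower:
  obtains h where "h \<longlonglongrightarrow> 1 / 6"
    "\<forall>\<^sub>F n in sequentially. h n \<le> real (min_packing (primes_upto (real n)) n) * ln (real n) / real n ^ 3"
proof -
  define k where "k = (\<lambda>n::nat. n - 1)"
  have k: "(\<lambda>n. real (k n) / real n) \<longlonglongrightarrow> 1"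
  proof (rule Lim_transform_eventually)
    show "(\<lambda>n. 1 - 1 / real n) \<longlonglongrightarrow> 1" by real_asymp
    show "\<forall>\<^sub>F n in sequentially. 1 - 1 / real n = real (k n) / real n"
      using eventually_gt_at_top[of 0] by eventually_elim (simp add: k_def of_nat_diff field_simps)
  qed
  define h where "h = (\<lambda>n. (1 - 1 / real n) * (prime_power_sum 1 (k n) * ln (real n) / real n ^ 2)
     - prime_power_sum 2 (k n) * ln (real n) / real n ^ 3 - 3 * (ln (real n) / real n ^ 2))"
  have inv: "(\<lambda>n::nat. 1 - 1 / real n) \<longlonglongrightarrow> 1" by real_asymp
  have lk: "(\<lambda>n::nat. ln (real n) / real n ^ 2) \<longlonglongrightarrow> 0" by real_asymp
  have "h \<longlonglongrightarrow> 1 * (1 ^ 2 / 2) - 1 ^ 3 / 3 - 3 * 0"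
    unfolding h_def by (intro tendsto_diff tendsto_mult tendsto_const inv prime_sum_scaled[OF k zero_less_one] lk)
  hence lim: "h \<longlonglongrightarrow> 1 / 6" by simp
  show ?thesis
  proof (rule that[OF lim])
    show "\<forall>\<^sub>F n in sequentially. h n \<le> real (min_packing (primes_upto (real n)) n) * ln (real n) / real n ^ 3"
      using eventually_ge_at_top[of 2]
    proof eventually_elim
      case (elim n)
      define N where "N = real n"
      define L where "L = ln N"
      have LN: "L > 0" "N > 0" using elim by (auto simp: L_def N_def)
      have "real (min_packing (primes_upto (real n)) n) \<ge> (real n - 1) * prime_power_sum 1 (k n) - prime_power_sum 2 (k n)
        + ((real n - 1) * prime_power_sum 1 0 - 3 * prime_power_sum 2 0) / 2 - 3 * real n"
        unfolding primes_upto_eq using elim finite_primes_le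
        by (intro min_packing_lower_prime_sums) (auto simp: k_def prime_gt_0_nat)
      hence "((N - 1) * prime_power_sum 1 (k n) - prime_power_sum 2 (k n) - 3 * N) * (L / N ^ 3)
          \<le> real (min_packing (primes_upto (real n)) n) * (L / N ^ 3)"
        using LN by (intro mult_right_mono) (auto simp: prime_power_sum_0 N_def)
      moreover have "((N - 1) * prime_power_sum 1 (k n) - prime_power_sum 2 (k n) - 3 * N) * (L / N ^ 3) = h n"
        unfolding h_def L_def[symmetric] N_def[symmetric] using LN
        by (simp add: field_simps power2_eq_square power3_eq_cube)
      ultimately show ?case by (simp add: L_def N_def)
    qed
  qed
qed

lemma product_le_near:
  fixes u w p n :: real
  assumes "u < p" "p \<le> u + w" "u + w \<le> n" "u \<ge> 0"
  shows "(u + w) * (n - u) \<le> p * (n - p) + w * n"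
proof -
  have "(u + w) * (n - u) = p * (n - p) + p * (p - u) + (u + w - p) * (n - u)" by (simp add: algebra_simps)
  also have "p * (p - u) \<le> n * (p - u)" using assms by (intro mult_right_mono) auto
  also have "(u + w - p) * (n - u) \<le> (u + w - p) * n" using assms by (intro mult_left_mono) auto
  finally show ?thesis by (simp add: algebra_simps)
qed

text \<open>
  The summand wn in X bounds how much (u + w)(n - u) exceeds p(n - p) for p in (u, u + w], see
  \<open>product_le_near\<close>. Induction over the number b of blocks.
\<close>
lemma primes_packed_blocks:
  fixes n w L K E b :: nat
  assumes \<epsilon>: "0 < \<epsilon>" "\<epsilon> < 1"
    and L: "peaked_exponent K \<epsilon> L"
    and K: "real K * \<epsilon> \<ge> 1"
    and E: "K * L * n ^ K < 2 ^ E"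
  defines "Y \<equiv> {p. prime p \<and> p \<le> n}"
  defines "X \<equiv> real w * real n + 2 * real n + \<epsilon> * real n ^ 2 + 1"
  defines "C \<equiv> 1 + L + (2 * L + 1) ^ K * E"
  shows "\<exists>N. can_be_packed {p \<in> Y. p \<le> b * w} (progression n) N \<and>
     real N \<le> (\<Sum>p\<in>{p \<in> Y. p \<le> b * w}. real p * (real n - real p) + X) + real b * (real C * real n ^ 2)"
proof (induction b)
  case 0
  have none: "{p \<in> Y. p \<le> 0 * w} = {}" by (auto simp: Y_def)
  show ?case unfolding none by (intro exI[of _ 0]) (simp add: can_be_packed_def disjoint_family_on_def)
next
  case (Suc b)
  have Yf: "finite Y" unfolding Y_def by (rule finite_primes_le)
  define A where "A = {p \<in> Y. p \<le> b * w}"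
  define P where "P = {p \<in> Y. b * w < p \<and> p \<le> b * w + w}"
  have split: "{p \<in> Y. p \<le> Suc b * w} = A \<union> P" "A \<inter> P = {}" by (auto simp: A_def P_def)
  have fin: "finite A" "finite P" using Yf by (auto simp: A_def P_def)
  obtain N1 where N1: "can_be_packed A (progression n) N1"
    "real N1 \<le> (\<Sum>p\<in>A. real p * (real n - real p) + X) + real b * (real C * real n ^ 2)"
    using Suc by (auto simp: A_def)
  have "\<exists>N2. can_be_packed P (progression n) N2 \<and> real N2 \<le> (\<Sum>p\<in>P. real p * (real n - real p) + X) + real C * real n ^ 2"
  proof (cases "b * w < n")
    case False
    hence "P = {}" by (auto simp: P_def Y_def)
    thus ?thesis by (intro exI[of _ 0]) (simp add: can_be_packed_def disjoint_family_on_def)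
  next
    case True
    define u v where "u = b * w" and "v = min w (n - b * w)"
    have uv: "u + v \<le> n" using True by (auto simp: u_def v_def)
    have P: "prime p \<and> u < p \<and> p \<le> u + v" if "p \<in> P" for p
      using that by (auto simp: P_def Y_def u_def v_def)
    define S where "S = nat \<lceil>real (u + v) * (real n - real u) + 2 * real n + \<epsilon> * real n ^ 2\<rceil>"
    have S1: "real S \<ge> real (u + v) * (real n - real u) + 2 * real n + \<epsilon> * real n ^ 2"
      unfolding S_def by linarith
    have "real (u + v) * (real n - real u) + 2 * real n + \<epsilon> * real n ^ 2 \<ge> 0"
      using uv \<epsilon> by (intro add_nonneg_nonneg mult_nonneg_nonneg) auto
    hence S2: "real S \<le> real (u + v) * (real n - real u) + 2 * real n + \<epsilon> * real n ^ 2 + 1"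
      unfolding S_def by linarith
    have "real S \<le> real p * (real n - real p) + X" if "p \<in> P" for p
    proof -
      have "(real u + real v) * (real n - real u) \<le> real p * (real n - real p) + real v * real n"
        using P[OF that] uv by (intro product_le_near) auto
      moreover have "real v * real n \<le> real w * real n" by (intro mult_right_mono) (auto simp: v_def)
      ultimately show ?thesis using S2 unfolding X_def of_nat_add by linarith
    qed
    hence "real (card P) * real S \<le> (\<Sum>p\<in>P. real p * (real n - real p) + X)"
      using sum_mono[of P "\<lambda>_. real S"] by simp
    hence "real (card P * S + C * n ^ 2) \<le> (\<Sum>p\<in>P. real p * (real n - real p) + X) + real C * real n ^ 2"
      by simp
    moreover have "can_be_packed P (progression n) (card P * S + C * n ^ 2)"
      unfolding C_def by (rule block_packed[OF fin(2) P uv \<epsilon> L K E S1])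
    ultimately show ?thesis by blast
  qed
  then obtain N2 where N2: "can_be_packed P (progression n) N2"
    "real N2 \<le> (\<Sum>p\<in>P. real p * (real n - real p) + X) + real C * real n ^ 2" by blast
  have "can_be_packed (A \<union> P) (progression n) (N1 + N2)" by (intro can_be_packed_Un N1 N2 split)
  moreover have "real (N1 + N2) \<le> (\<Sum>p\<in>A \<union> P. real p * (real n - real p) + X) + real (Suc b) * (real C * real n ^ 2)"
    using N1(2) N2(2) fin split(2) by (simp add: sum.union_disjoint algebra_simps)
  ultimately show ?case unfolding split(1) by blast
qed

text \<open>
  The parameter e controls everything: there are B = ceiling(1/e) blocks, the slack in S is en^2, and
  so B earlier progressions suffice in each step. The terms 1/B and e in U come from the block length
  and from the slack.
\<close>
lemma primes_upper:
  assumes e: "0 < (e :: real)" "e < 1"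
  shows "\<forall>\<^sub>F n in sequentially. real (min_packing (primes_upto (real n)) n) * ln (real n) / real n ^ 3 \<le> 1 / 6 + 3 * e"
proof -
  define B where "B = nat \<lceil>1 / e\<rceil>"
  have "1 / e > 0" using e by simp
  hence B: "real B \<ge> 1 / e" "B > 0" unfolding B_def by linarith+
  have Be: "real B * e \<ge> 1" using B e by (simp add: field_simps)
  obtain L where L: "peaked_exponent B e L"
    using exists_kronecker_exponent[OF e] by blast
  define E where "E = (\<lambda>n::nat. B * L + B * (nat \<lfloor>log 2 (real n)\<rfloor> + 1))"
  define C where "C = (\<lambda>n. 1 + L + (2 * L + 1) ^ B * E n)"
  define w where "w = (\<lambda>n. n div B + 1)"
  define X where "X = (\<lambda>n. real (w n) * real n + 2 * real n + e * real n ^ 2 + 1)"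
  define c1 c2 where "c1 = 1 + real L + (2 * real L + 1) ^ B * (real B * real L + real B)" and "c2 = (2 * real L + 1) ^ B * real B"
  define U where "U = (\<lambda>n. (prime_power_sum 1 n * ln (real n) / real n ^ 2 - prime_power_sum 2 n * ln (real n) / real n ^ 3)
     + prime_pi n * ln (real n) / real n * (1 / real B + 3 / real n + e + 1 / real n ^ 2)
     + real B * (c1 + c2 * log 2 (real n)) * (ln (real n) / real n) + ln (real n) / real n ^ 3)"
  have "U \<longlonglongrightarrow> (1 / 2 - 1 / 3) + 1 * (1 / real B + 0 + e + 0) + 0 + 0"
    unfolding U_def
  proof (intro tendsto_add tendsto_diff tendsto_mult prime_sum_asymp prime_square_sum_asymp prime_number_theorem tendsto_const)
    show "(\<lambda>n::nat. 3 / real n) \<longlonglongrightarrow> 0" "(\<lambda>n::nat. 1 / real n ^ 2) \<longlonglongrightarrow> 0" "(\<lambda>n::nat. ln (real n) / real n ^ 3) \<longlonglongrightarrow> 0"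
      by real_asymp+
    have 1: "(\<lambda>n::nat. ln (real n) / real n) \<longlonglongrightarrow> 0" by real_asymp
    have 2: "(\<lambda>n::nat. log 2 (real n) * (ln (real n) / real n)) \<longlonglongrightarrow> 0" by real_asymp
    have "(\<lambda>n::nat. real B * c1 * (ln (real n) / real n) + real B * c2 * (log 2 (real n) * (ln (real n) / real n))) \<longlonglongrightarrow>
       real B * c1 * 0 + real B * c2 * 0" by (intro tendsto_add tendsto_mult tendsto_const 1 2)
    thus "(\<lambda>n::nat. real B * (c1 + c2 * log 2 (real n)) * (ln (real n) / real n)) \<longlonglongrightarrow> 0"
      by (simp add: algebra_simps)
  qed
  moreover have "1 / real B \<le> e" using Be B by (simp add: field_simps)
  hence "(1 / 2 - 1 / 3) + 1 * (1 / real B + 0 + e + 0) + 0 + 0 < 1 / 6 + 3 * e" using e by simp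
  ultimately have "\<forall>\<^sub>F n in sequentially. U n < 1 / 6 + 3 * e" by (rule order_tendstoD(2))
  thus ?thesis using eventually_ge_at_top[of 2]
  proof eventually_elim
    case (elim n)
    have n: "n \<ge> 2" using elim by simp
    have En: "B * L * n ^ B < 2 ^ E n"
    proof -
      define m where "m = nat \<lfloor>log 2 (real n)\<rfloor> + 1"
      have "log 2 (real n) \<ge> 0" using n by simp
      hence "log 2 (real n) < real m" unfolding m_def by linarith
      hence "real n < 2 powr real m" using n by (simp add: log_less_iff)
      hence "real n < real (2 ^ m)" by (simp add: powr_realpow)
      hence "n < 2 ^ m" by (simp only: of_nat_less_iff)
      hence "n ^ B \<le> (2 ^ m) ^ B" by (intro power_mono) auto
      hence "n ^ B \<le> 2 ^ (B * m)" by (simp add: power_mult[symmetric] mult.commute)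
      moreover have "B * L < 2 ^ (B * L)" by (rule less_exp)
      moreover have "n ^ B > 0" using n by simp
      ultimately have "B * L * n ^ B < 2 ^ (B * L) * 2 ^ (B * m)" by (intro mult_less_le_imp_less) auto
      thus ?thesis by (simp add: E_def m_def power_add)
    qed
    have cov: "{p \<in> {p. prime p \<and> p \<le> n}. p \<le> B * w n} = {p. prime p \<and> p \<le> n}"
    proof -
      have "n \<le> B * w n"
        using dividend_less_times_div[of B n] B(2) by (simp add: w_def)
      thus ?thesis by auto
    qed
    obtain N where N: "can_be_packed {p. prime p \<and> p \<le> n} (progression n) N"
      "real N \<le> (\<Sum>p | prime p \<and> p \<le> n. real p * (real n - real p) + X n) + real B * (real (C n) * real n ^ 2)"
      using primes_packed_blocks[OF e L Be En, where w = "w n" and b = B] unfolding cov X_def C_def by blast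
    have "(\<Sum>p | prime p \<and> p \<le> n. real p * (real n - real p) + X n) =
        (\<Sum>p | prime p \<and> p \<le> n. (real n * real p - 1 * real p ^ 2) + X n)"
      by (intro sum.cong refl) (simp add: algebra_simps power2_eq_square)
    also have "\<dots> = (\<Sum>p | prime p \<and> p \<le> n. real n * real p - 1 * real p ^ 2) + prime_pi n * X n"
      unfolding sum.distrib by (simp add: prime_power_sum_def)
    also have "\<dots> = real n * prime_power_sum 1 n - prime_power_sum 2 n + prime_pi n * X n"
      unfolding sum_primes_poly by simp
    finally have N2: "real N \<le> real n * prime_power_sum 1 n - prime_power_sum 2 n + prime_pi n * X n
        + real B * (real (C n) * real n ^ 2)" using N(2) by simp
    have "can_be_packed (primes_upto (real n)) (progression n) (N + 1)"
      unfolding primes_upto_eq using can_be_packed_mono[OF N(1)] by simp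
    hence "min_packing (primes_upto (real n)) n \<le> N + 1" by (rule min_packing_le) simp
    hence M: "real (min_packing (primes_upto (real n)) n) \<le> real n * prime_power_sum 1 n - prime_power_sum 2 n + prime_pi n * X n
        + real B * (real (C n) * real n ^ 2) + 1" using N2 by linarith
    have Xn: "X n \<le> (1 / real B + 3 / real n + e + 1 / real n ^ 2) * real n ^ 2"
    proof -
      have "\<lfloor>real n / real B\<rfloor> = int (n div B)" by (rule floor_divide_of_nat_eq)
      hence "real (n div B) \<le> real n / real B" by linarith
      hence "real (w n) * real n \<le> (real n / real B + 1) * real n" unfolding w_def by (intro mult_right_mono) auto
      hence "X n \<le> (real n / real B + 1) * real n + 2 * real n + e * real n ^ 2 + 1" unfolding X_def by simp
      also have "\<dots> = (1 / real B + 3 / real n + e + 1 / real n ^ 2) * real n ^ 2"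
        using n B by (simp add: field_simps power2_eq_square)
      finally show ?thesis .
    qed
    have Cn: "real (C n) \<le> c1 + c2 * log 2 (real n)"
    proof -
      have "log 2 (real n) \<ge> 0" using n by simp
      hence "real (nat \<lfloor>log 2 (real n)\<rfloor> + 1) \<le> log 2 (real n) + 1" by linarith
      hence "real B * real (nat \<lfloor>log 2 (real n)\<rfloor> + 1) \<le> real B * (log 2 (real n) + 1)" by (intro mult_left_mono) auto
      hence "real (E n) \<le> real B * real L + real B * (log 2 (real n) + 1)" unfolding E_def of_nat_add[of "B * L"] of_nat_mult by (rule add_left_mono)
      hence "(2 * real L + 1) ^ B * real (E n) \<le> (2 * real L + 1) ^ B * (real B * real L + real B * (log 2 (real n) + 1))"
        by (intro mult_left_mono) auto
      moreover have "real (C n) = 1 + real L + (2 * real L + 1) ^ B * real (E n)" by (simp add: C_def add.commute[of 1 "2 * real L"])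
      ultimately show ?thesis by (simp add: c1_def c2_def algebra_simps)
    qed
    define N' where "N' = real n"
    define lg where "lg = ln N'"
    have pos: "lg > 0" "N' > 0" using n by (auto simp: lg_def N'_def)
    have pi0: "prime_pi n \<ge> 0" by (simp add: prime_power_sum_def)
    have "real (min_packing (primes_upto (real n)) n) \<le> N' * prime_power_sum 1 n - prime_power_sum 2 n
        + prime_pi n * ((1 / real B + 3 / N' + e + 1 / N' ^ 2) * N' ^ 2)
        + real B * ((c1 + c2 * log 2 N') * N' ^ 2) + 1"
      unfolding N'_def using mult_left_mono[OF Xn pi0]
        mult_left_mono[OF mult_right_mono[OF Cn, of "real n ^ 2"], of "real B"] M by simp
    hence "real (min_packing (primes_upto (real n)) n) * (lg / N' ^ 3) \<le> (N' * prime_power_sum 1 n - prime_power_sum 2 n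
        + prime_pi n * ((1 / real B + 3 / N' + e + 1 / N' ^ 2) * N' ^ 2)
        + real B * ((c1 + c2 * log 2 N') * N' ^ 2) + 1) * (lg / N' ^ 3)"
      using pos by (intro mult_right_mono) auto
    also have "\<dots> = U n"
    proof -
      define q1 q2 where "q1 = 1 / real B + 3 / N' + e + 1 / N' ^ 2" and "q2 = c1 + c2 * log 2 N'"
      show ?thesis unfolding U_def lg_def[symmetric] N'_def[symmetric] q1_def[symmetric] q2_def[symmetric]
        using pos by (simp add: field_simps power2_eq_square power3_eq_cube)
    qed
    finally show ?case using elim(1) by (simp add: lg_def N'_def)
  qed
qed

lemma primes_asymp:
  "(\<lambda>n::nat. real (min_packing (primes_upto (real n)) n)) \<sim>[at_top] (\<lambda>n. real n ^ 3 / (6 * ln (real n)))"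
proof -
  let ?r = "\<lambda>n::nat. real (min_packing (primes_upto (real n)) n) * ln (real n) / real n ^ 3"
  obtain h where h: "h \<longlonglongrightarrow> 1 / 6" "\<forall>\<^sub>F n in sequentially. h n \<le> ?r n" by (rule primes_lower)
  have "?r \<longlonglongrightarrow> 1 / 6"
  proof (rule order_tendstoI)
    fix a :: real assume "a < 1 / 6"
    hence "\<forall>\<^sub>F n in sequentially. a < h n" using h(1) by (intro order_tendstoD)
    with h(2) show "\<forall>\<^sub>F n in sequentially. a < ?r n" by eventually_elim simp
  next
    fix a :: real assume a: "1 / 6 < a"
    define e where "e = min ((a - 1 / 6) / 6) (1 / 2)"
    have e: "0 < e" "e < 1" "1 / 6 + 3 * e < a" using a by (auto simp: e_def min_def field_simps)
    from primes_upper[OF e(1,2)] show "\<forall>\<^sub>F n in sequentially. ?r n < a"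
      by eventually_elim (use e in linarith)
  qed
  hence "(\<lambda>n. 6 * ?r n) \<longlonglongrightarrow> 6 * (1 / 6)" by (intro tendsto_mult tendsto_const)
  hence "(\<lambda>n. real (min_packing (primes_upto (real n)) n) / (real n ^ 3 / (6 * ln (real n)))) \<longlonglongrightarrow> 1"
    by (simp add: field_simps)
  thus ?thesis by (rule asymp_equivI')
qed

theorem theorem1p5:
  shows
   "((\<lambda>n::nat. real (min_packing (primes_upto (real n)) n))
        \<sim>[at_top] (\<lambda>n. real n ^ 3 / (6 * ln (real n))))
    \<and>
    (\<forall>k :: nat \<Rightarrow> nat.
        (\<forall>n\<ge>1. 0 < k n) \<longrightarrow>
        filterlim k at_top at_top \<longrightarrow>
        (\<lambda>n. real (k n)) \<in> o[at_top](\<lambda>n. real n) \<longrightarrow>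
        (\<exists>\<epsilon> :: nat \<Rightarrow> real. \<epsilon> \<in> o[at_top](\<lambda>_. 1) \<and>
           (\<forall>\<^sub>F n in at_top.
              real (min_packing {1..k n} n)
                \<ge> (9 / 16 - \<epsilon> n) * (real n * real (k n) ^ 2 / ln (real (k n))))))
    \<and>
    (\<forall>(k :: nat \<Rightarrow> nat) (l :: real) (a :: real).
        (\<forall>n\<ge>1. 0 < k n) \<longrightarrow>
        0 < l \<longrightarrow> l < 1 \<longrightarrow>
        (\<lambda>n. real (k n) / real n) \<longlonglongrightarrow> l \<longrightarrow>
        a = min (l / 2) (1 / 3) \<longrightarrow>
        (\<exists>\<epsilon> :: nat \<Rightarrow> real. \<epsilon> \<in> o[at_top](\<lambda>_. 1) \<and>
           (\<forall>\<^sub>F n in at_top.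
              real (min_packing {1..k n} n)
                \<ge> (l ^ 2 / 2 - l ^ 3 / 3 + a ^ 2 / 4 - a ^ 3 / 2 - \<epsilon> n)
                   * (real n ^ 3 / ln (real n)))))"
  using primes_asymp small_k_lower linear_k_lower by blast

end
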